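(* Let $K\in GL_n(\mathbb{F}_q)$ be a symmetric matrix and let $M$ be chosen uniformly at random from $SO_n(\mathbb{F}_q,K)=\{M\in GL_n(\mathbb{F}_q): M^tKM=K,\ \det M=1\}$. Let $f\in\mathbb{F}_q[x]$ be a monic self-reciprocal polynomial of degree $n$ with $x\nmid f$. Then for every integer $0\le\delta<n$, $$\Pr\big[\deg\min(M)=n-\delta\ \text{and}\ \mathrm{char}(M)=f\big]\ll q^{\frac n2-\frac{n^2}{2(n-\delta)}+o(n)}.$$
   Context: $q$ is a power of an odd prime. A monic $f\in\mathbb{F}_q[x]$ with $f(0)\ne0$ is self-reciprocal if $x^{\deg f}f(1/x)/f(0)=f(x)$. $\mathrm{char}(M)=\det(xI-M)$, $\min(M)$ is the minimal polynomial. (The paper works with the groups $SO_n^{\pm}(\mathbb{F}_q)$ attached to fixed representatives of the two congruence classes of nondegenerate symmetric forms; groups attached to congruent forms are conjugate in $GL_n(\mathbb{F}_q)$.) *)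

theory Defs
  imports
    "Jordan_Normal_Form.Char_Poly"
    "HOL-Probability.Probability_Mass_Function"
    "HOL-Library.Landau_Symbols"
begin

hide_const (open) Determinants.det Finite_Cartesian_Product.mat Module.smult

(* reflect_poly f is x^(degree f) * f(1/x). *)
definition self_reciprocal :: "'a::field poly \<Rightarrow> bool" where
  "self_reciprocal f \<longleftrightarrow>
     monic f \<and> poly f 0 \<noteq> 0 \<and> smult (inverse (poly f 0)) (reflect_poly f) = f"

definition special_orthogonal :: "nat \<Rightarrow> 'a::field mat \<Rightarrow> 'a mat set" where
  "special_orthogonal n K =
     {M \<in> carrier_mat n n. invertible_mat M \<and> transpose_mat M * K * M = K \<and> det M = 1}"

(* Matrices of all sizes share one type, which has no addition with a neutral element,
   so the value of a polynomial at a square matrix is written entrywise. *)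
definition poly_mat :: "'a::comm_ring_1 poly \<Rightarrow> 'a mat \<Rightarrow> 'a mat" where
  "poly_mat p M = mat (dim_row M) (dim_row M)
     (\<lambda>(i, j). \<Sum>k\<le>degree p. coeff p k * (M ^\<^sub>m k) $$ (i, j))"

definition is_min_poly :: "'a::field mat \<Rightarrow> 'a poly \<Rightarrow> bool" where
  "is_min_poly M p \<longleftrightarrow>
     monic p \<and> poly_mat p M = 0\<^sub>m (dim_row M) (dim_row M) \<and>
     (\<forall>r. r \<noteq> 0 \<and> poly_mat r M = 0\<^sub>m (dim_row M) (dim_row M) \<longrightarrow> degree p \<le> degree r)"

definition min_poly :: "'a::field mat \<Rightarrow> 'a poly" where
  "min_poly M = (THE p. is_min_poly M p)"

lemma finite_carrier_mat: "finite (carrier_mat n m :: 'a::finite mat set)"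
proof -
  have "(carrier_mat n m :: 'a mat set)
      \<subseteq> (\<lambda>f. mat n m f) ` (({..<n} \<times> {..<m}) \<rightarrow>\<^sub>E UNIV)"
  proof
    fix A :: "'a mat" assume A: "A \<in> carrier_mat n m"
    have "A = mat n m (restrict (\<lambda>ij. A $$ ij) ({..<n} \<times> {..<m}))"
      using A by (intro eq_matI) auto
    then show "A \<in> (\<lambda>f. mat n m f) ` (({..<n} \<times> {..<m}) \<rightarrow>\<^sub>E UNIV)"
      by (intro image_eqI[where x = "restrict (\<lambda>ij. A $$ ij) ({..<n} \<times> {..<m})"]) auto
  qed
  then show ?thesis by (rule finite_subset) (intro finite_imageI finite_PiE; simp)
qed

lemma finite_special_orthogonal:
  "finite (special_orthogonal n K :: 'a::{field,finite} mat set)"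
  by (rule finite_subset[OF _ finite_carrier_mat[of n n]]) (auto simp: special_orthogonal_def)

lemma one_in_special_orthogonal:
  assumes "K \<in> carrier_mat n n"
  shows "1\<^sub>m n \<in> special_orthogonal n K"
  using assms
  by (auto simp: special_orthogonal_def invertible_mat_def inverts_mat_def intro!: exI[of _ "1\<^sub>m n"])

lemma poly_mat_index:
  assumes "degree p \<le> N" "i < dim_row M" "j < dim_row M"
  shows "poly_mat p M $$ (i, j) = (\<Sum>k\<le>N. coeff p k * (M ^\<^sub>m k) $$ (i, j))"
proof -
  have "\<forall>k\<in>{..N} - {..degree p}. coeff p k * (M ^\<^sub>m k) $$ (i, j) = 0"
    by (auto simp: coeff_eq_0)
  then have "(\<Sum>k\<le>degree p. coeff p k * (M ^\<^sub>m k) $$ (i, j))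
      = (\<Sum>k\<le>N. coeff p k * (M ^\<^sub>m k) $$ (i, j))"
    using assms(1) by (intro sum.mono_neutral_left) auto
  then show ?thesis using assms(2,3) by (simp add: poly_mat_def)
qed

lemma poly_mat_eq_0_iff:
  assumes "degree p \<le> N"
  shows "poly_mat p M = 0\<^sub>m (dim_row M) (dim_row M) \<longleftrightarrow>
    (\<forall>i<dim_row M. \<forall>j<dim_row M. (\<Sum>k\<le>N. coeff p k * (M ^\<^sub>m k) $$ (i, j)) = 0)"
proof -
  have "dim_row (poly_mat p M) = dim_row M" "dim_col (poly_mat p M) = dim_row M"
    by (auto simp: poly_mat_def)
  then have "poly_mat p M = 0\<^sub>m (dim_row M) (dim_row M) \<longleftrightarrow>
      (\<forall>i<dim_row M. \<forall>j<dim_row M. poly_mat p M $$ (i, j) = 0)"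
    by (auto simp: mat_eq_iff)
  then show ?thesis by (simp add: poly_mat_index[OF assms])
qed

lemma is_min_poly_unique:
  assumes p: "is_min_poly M p" and q: "is_min_poly M q"
  shows "p = q"
proof (rule ccontr)
  assume ne: "p \<noteq> q"
  have p0: "p \<noteq> 0" and q0: "q \<noteq> 0" using p q by (auto simp: is_min_poly_def)
  have deg: "degree p = degree q"
    using p q p0 q0 by (auto simp: is_min_poly_def intro!: antisym)
  have "degree (p - q) \<le> degree p" using deg by (metis degree_diff_le order_refl)
  then have "poly_mat (p - q) M = 0\<^sub>m (dim_row M) (dim_row M)"
    using p q deg
    by (auto simp: is_min_poly_def poly_mat_eq_0_iff[of _ "degree p"] sum_subtractf algebra_simps)
  then have "degree p \<le> degree (p - q)" using p ne by (auto simp: is_min_poly_def)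
  with \<open>degree (p - q) \<le> degree p\<close> have "degree (p - q) = degree p" by simp
  moreover have "coeff (p - q) (degree p) = 0"
    using p q deg by (auto simp: is_min_poly_def)
  ultimately have "p - q = 0" by (metis leading_coeff_0_iff)
  then show False using ne by simp
qed

lemma is_min_poly_min_poly:
  fixes M :: "'a::{field,finite} mat"
  assumes M: "M \<in> carrier_mat n n"
  shows "is_min_poly M (min_poly M)"
proof -
  define Z where "Z p \<longleftrightarrow> poly_mat p M = 0\<^sub>m (dim_row M) (dim_row M)" for p
  have "range (\<lambda>k. M ^\<^sub>m k) \<subseteq> carrier_mat n n" using M by auto
  then have "finite (range (\<lambda>k. M ^\<^sub>m k))" using finite_carrier_mat finite_subset by blast
  then have "\<not> inj (\<lambda>k. M ^\<^sub>m k)" using finite_imageD by blast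
  then obtain a b where ab: "a < b" "M ^\<^sub>m a = M ^\<^sub>m b"
    unfolding inj_def by (metis linorder_neqE_nat)
  define r where "r = monom (1::'a) b - monom 1 a"
  have cr: "coeff r k = (if k = b then 1 else 0) - (if k = a then 1 else 0)" for k
    by (simp add: r_def)
  have "degree r \<le> b" using ab(1) by (auto intro!: degree_le simp: cr)
  moreover have "(\<Sum>k\<le>b. coeff r k * (M ^\<^sub>m k) $$ (i, j)) = 0" for i j
    using ab by (simp add: cr left_diff_distrib sum_subtractf if_distrib[of "\<lambda>x. x * _"] cong: if_cong)
  ultimately have "Z r" unfolding Z_def by (simp add: poly_mat_eq_0_iff)
  moreover have "r \<noteq> 0"
  proof
    assume "r = 0"
    then have "coeff r b = 0" by simp
    then show False using ab(1) by (simp add: cr)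
  qed
  ultimately have ex: "r \<noteq> 0 \<and> Z r" by simp
  define s where "s = arg_min degree (\<lambda>p. p \<noteq> 0 \<and> Z p)"
  have s: "s \<noteq> 0" "Z s" and least: "\<And>p. p \<noteq> 0 \<Longrightarrow> Z p \<Longrightarrow> degree s \<le> degree p"
    using arg_min_nat_lemma[of "\<lambda>p. p \<noteq> 0 \<and> Z p" r degree, OF ex] by (auto simp: s_def)
  define t where "t = smult (inverse (lead_coeff s)) s"
  have dt: "degree t = degree s" and mt: "monic t" using s(1) by (auto simp: t_def)
  have "(\<Sum>k\<le>degree s. coeff t k * (M ^\<^sub>m k) $$ (i, j))
      = inverse (lead_coeff s) * (\<Sum>k\<le>degree s. coeff s k * (M ^\<^sub>m k) $$ (i, j))" for i j
    by (simp add: t_def sum_distrib_left mult.assoc)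
  then have "Z t" using s(2) dt
    by (simp add: Z_def poly_mat_eq_0_iff[of _ "degree s"])
  then have "is_min_poly M t" using mt least dt by (auto simp: is_min_poly_def Z_def)
  then show ?thesis unfolding min_poly_def by (rule theI) (rule is_min_poly_unique[OF _ \<open>is_min_poly M t\<close>])
qed

end

theory Submission
  imports Defs "HOL-Library.Function_Algebras"
begin

text \<open>
  Write \<open>F\<close> for the field of \<open>q\<close> elements and let \<open>m = n - \<delta>\<close>. Counting the pairs \<open>(M, P)\<close> with \<open>M\<close> in the
  orthogonal group of \<open>K\<close> and \<open>P\<close> invertible through \<open>(P\<inverse>MP, P\<^sup>tKP)\<close> bounds the probability by
  \<open>2/|GL\<^sub>n|\<close> times the sum, over all matrices \<open>M\<close> with the prescribed characteristic and minimal polynomial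
  data, of the number of \<open>M\<close>-invariant symmetric forms. Decompose \<open>F\<^sup>n\<close> as an \<open>F[x]\<close>-module into cyclic
  summands of dimensions \<open>n\<^sub>1 \<ge> n\<^sub>2 \<ge> \<dots>\<close> with \<open>n\<^sub>1 \<le> m\<close>, whose annihilators divide one another. There are
  at most \<open>q^(\<Sum> j n\<^sub>j)\<close> invariant symmetric forms, while the centralizer of \<open>M\<close> has at least
  \<open>q^(\<Sum> (2j - 1) n\<^sub>j)\<close> elements and \<open>n\<^sup>2 \<le> m \<cdot> \<Sum> (2j - 1) n\<^sub>j\<close>; hence there are at most
  \<open>q^(n/2 - n\<^sup>2/(2m))\<close> times as many forms as elements of the centralizer.

  It remains to see that the number of commuting pairs \<open>(M, A)\<close> with \<open>char(M) = f\<close> is at most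
  \<open>|GL\<^sub>n| q^(o(n))\<close>. Every \<open>A\<close> is \<open>u - e\<close> with an invertible \<open>u\<close> and an idempotent \<open>e\<close> commuting with
  each other and with the centralizer of \<open>A\<close>. By orbit-stabilizer the triples \<open>(M, e, u)\<close> number at most
  \<open>|GL\<^sub>n|\<close> times the number of conjugacy classes of pairs \<open>(M, e)\<close>, and such a class is determined by two chains
  of divisors of \<open>f\<close> of total degree at most \<open>n\<close>. There are only \<open>q^(o(n))\<close> of these, because \<open>f\<close> has
  \<open>o(n)\<close> distinct irreducible factors.
\<close>

section \<open>Finite modules over a polynomial ring\<close>

text \<open>Division by a nonzero member \<open>c\<close> of least degree leaves a remainder in
  \<open>I\<close>, which must vanish by minimality.\<close>

lemma poly_ideal_principal:
  fixes I :: "'a::field poly set"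
  assumes "p \<in> I" "p \<noteq> 0"
    and diff: "\<And>x y. x \<in> I \<Longrightarrow> y \<in> I \<Longrightarrow> x - y \<in> I"
    and mult: "\<And>r x. x \<in> I \<Longrightarrow> r * x \<in> I"
  obtains c where "c \<in> I" "c \<noteq> 0" "\<forall>x\<in>I. c dvd x"
proof -
  define c where "c = arg_min degree (\<lambda>x. x \<in> I \<and> x \<noteq> 0)"
  have c: "c \<in> I" "c \<noteq> 0" and least: "\<And>x. x \<in> I \<Longrightarrow> x \<noteq> 0 \<Longrightarrow> degree c \<le> degree x"
    using arg_min_nat_lemma[of "\<lambda>x. x \<in> I \<and> x \<noteq> 0" p degree] assms(1,2) by (auto simp: c_def)
  have "c dvd x" if "x \<in> I" for x
  proof -
    have "x mod c = x - (x div c) * c" by (simp add: minus_div_mult_eq_mod)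
    then have "x mod c \<in> I" using diff mult c that by metis
    then have "x mod c = 0" using least degree_mod_less[OF c(2), of x] by force
    then show ?thesis by (simp add: mod_eq_0_iff_dvd)
  qed
  then show ?thesis using that c by blast
qed

text \<open>The ideal generated by \<open>p\<close> and \<open>f\<close> has a single generator
  \<open>c\<close>. It divides the irreducible \<open>f\<close>, so it is a unit or an associate of
  \<open>f\<close>; the latter would make \<open>f\<close> divide \<open>p\<close>.\<close>

lemma bezout_irreducible:
  fixes f p :: "'a::field poly"
  assumes "irreducible f" "\<not> f dvd p"
  obtains r s where "r * p + s * f = 1"
proof -
  define I where "I = {r * p + s * f | r s. True}"
  have "f = 0 * p + 1 * f" "p = 1 * p + 0 * f" by simp_all
  then have "f \<in> I" "p \<in> I" unfolding I_def by blast+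
  note \<open>f \<in> I\<close>
  moreover have "f \<noteq> 0" using assms(1) by auto
  moreover have "x - y \<in> I" if xy: "x \<in> I" "y \<in> I" for x y
  proof -
    obtain a b c d where "x = a * p + b * f" "y = c * p + d * f" using xy unfolding I_def by blast
    then have "x - y = (a - c) * p + (b - d) * f" by (simp add: algebra_simps)
    then show ?thesis unfolding I_def by blast
  qed
  moreover have "r * x \<in> I" if x: "x \<in> I" for r x
  proof -
    obtain a b where "x = a * p + b * f" using x unfolding I_def by blast
    then have "r * x = (r * a) * p + (r * b) * f" by (simp add: algebra_simps)
    then show ?thesis unfolding I_def by blast
  qed
  ultimately obtain c where c: "c \<in> I" and dvd: "\<forall>x\<in>I. c dvd x"
    by (rule poly_ideal_principal) blast
  have cp: "c dvd p" using dvd \<open>p \<in> I\<close> by blast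
  obtain h where h: "f = c * h" using dvd \<open>f \<in> I\<close> by blast
  have "\<not> is_unit h"
  proof
    assume "is_unit h"
    then have "f dvd c" using h by (metis dvd_mult_unit_iff dvd_refl)
    then show False using cp assms(2) dvd_trans by blast
  qed
  then have "is_unit c" using h assms(1) irreducibleD by blast
  then obtain c' where "1 = c' * c" by (metis dvdE mult.commute)
  moreover obtain a b where "c = a * p + b * f" using c by (auto simp: I_def)
  ultimately have "(c' * a) * p + (c' * b) * f = 1" by (simp add: algebra_simps)
  then show ?thesis using that by blast
qed

definition lin :: "('a \<Rightarrow> 'v \<Rightarrow> 'v) \<Rightarrow> 'a list \<Rightarrow> 'v list \<Rightarrow> 'v::comm_monoid_add" where
  "lin act ps vs = sum_list (map2 act ps vs)"

lemma lin_Nil [simp]: "lin act [] [] = 0"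
  and lin_Cons [simp]: "lin act (p # ps) (v # vs) = act p v + lin act ps vs"
  by (simp_all add: lin_def)

text \<open>Canonical representatives for the direct sum of the quotients \<open>F[x]/(d)\<close>.
  Because \<open>degree 0 = 0\<close>, the zero residue is included only for moduli of positive
  degree, which \<open>divisor_chain\<close> guarantees.\<close>

definition residue_tuples :: "'a::zero poly list \<Rightarrow> 'a poly list set" where
  "residue_tuples ds = {ps. list_all2 (\<lambda>p d. degree p < degree d) ps ds}"

text \<open>Invariant factors with the largest first. Positive degrees exclude trivial summands, so
  that padding a list by \<open>1\<close> can later be undone.\<close>

definition divisor_chain :: "'a::field poly list \<Rightarrow> bool" where
  "divisor_chain ds \<longleftrightarrow>
     (\<forall>d\<in>set ds. monic d \<and> 0 < degree d) \<and> sorted_wrt (\<lambda>a b. b dvd a) ds"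

locale poly_module = Modules.module act
  for act :: "'a::{field,finite} poly \<Rightarrow> 'v::ab_group_add \<Rightarrow> 'v"
begin

text \<open>Expresses that \<open>W\<close> is the direct sum of the cyclic submodules generated by
  \<open>vs\<close> with annihilators \<open>ds\<close>, through existence and uniqueness of reduced
  coordinates.\<close>

definition cyclic_basis :: "'v set \<Rightarrow> 'v list \<Rightarrow> 'a poly list \<Rightarrow> bool" where
  "cyclic_basis W vs ds \<longleftrightarrow> divisor_chain ds \<and>
     list_all2 (\<lambda>v d. v \<in> W \<and> act d v = 0) vs ds \<and>
     bij_betw (\<lambda>ps. lin act ps vs) (residue_tuples ds) W"

definition has_order :: "'v \<Rightarrow> 'a poly \<Rightarrow> bool" where
  "has_order v d \<longleftrightarrow> monic d \<and> (\<forall>p. act p v = 0 \<longleftrightarrow> d dvd p)"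

text \<open>Finiteness of \<open>W\<close> makes two powers of \<open>x\<close> agree on
  \<open>v\<close>, so the annihilator ideal of \<open>v\<close> is nonzero and therefore principal
  with a monic generator.\<close>

lemma has_order_exists:
  assumes "finite W" "subspace W" "v \<in> W"
  obtains d where "has_order v d"
proof -
  have "range (\<lambda>k. act (monom 1 k) v) \<subseteq> W" using assms by (auto intro: subspace_scale)
  then have "\<not> inj (\<lambda>k. act (monom 1 k) v)" using assms(1) finite_subset infinite_UNIV_nat finite_imageD by metis
  then obtain a b where ab: "a \<noteq> b" "act (monom 1 a) v = act (monom 1 b) v" by (auto simp: inj_def)
  define I where "I = {p. act p v = 0}"
  have "monom 1 a - monom 1 b \<in> I" using ab by (simp add: I_def scale_left_diff_distrib)
  moreover have "monom 1 a - monom (1::'a) b \<noteq> 0" using ab by (auto simp: monom_eq_iff')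
  moreover have "x - y \<in> I" if "x \<in> I" "y \<in> I" for x y
    using that by (simp add: I_def scale_left_diff_distrib)
  moreover have "r * x \<in> I" if "x \<in> I" for r x
    using that by (auto simp: I_def scale_scale[symmetric])
  ultimately obtain c where c: "c \<in> I" "c \<noteq> 0" "\<forall>x\<in>I. c dvd x"
    by (rule poly_ideal_principal) blast
  define d where "d = smult (inverse (lead_coeff c)) c"
  have "monic d" using c(2) by (simp add: d_def)
  moreover have "d dvd p \<longleftrightarrow> c dvd p" for p using c(2) by (simp add: d_def smult_dvd_iff)
  moreover have "c dvd p \<longleftrightarrow> act p v = 0" for p
    using c(1,3) by (auto simp: I_def dvd_def mult.commute[of c] scale_scale[symmetric])
  ultimately have "has_order v d" by (simp add: has_order_def)
  then show ?thesis by (rule that)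
qed

section \<open>Vectors of maximal order\<close>

lemma act_coprime_eq_0:
  assumes "irreducible f" "\<not> f dvd p" "act f z = 0" "act p z = 0"
  shows "z = 0"
proof -
  obtain r s where "r * p + s * f = 1" using bezout_irreducible assms by blast
  then have "z = act (r * p + s * f) z" by simp
  also have "\<dots> = 0" using assms by (simp add: scale_left_distrib scale_scale[symmetric])
  finally show ?thesis .
qed

lemma irreducible_power_split:
  fixes a f :: "'a poly"
  assumes "irreducible f" "a \<noteq> 0"
  obtains s b where "a = f ^ s * b" "\<not> f dvd b"
proof -
  have "0 < degree f" using assms(1) by (auto simp: irreducible_def is_unit_iff_degree)
  have "s \<le> degree a" if "f ^ s dvd a" for s
  proof -
    have "f \<noteq> 0" using assms(1) by auto
    then have "degree (f ^ s) = s * degree f" by (induction s) (auto simp: degree_mult_eq)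
    then have "s \<le> degree (f ^ s)" using \<open>0 < degree f\<close> by simp
    then show ?thesis using dvd_imp_degree_le[OF that assms(2)] by linarith
  qed
  then have fin: "finite {s. f ^ s dvd a}" by (meson finite_nat_set_iff_bounded_le mem_Collect_eq)
  define s where "s = Max {s. f ^ s dvd a}"
  have "0 \<in> {s. f ^ s dvd a}" by simp
  then have "s \<in> {s. f ^ s dvd a}" unfolding s_def using Max_in[OF fin] by blast
  then have s: "f ^ s dvd a" by simp
  then obtain b where b: "a = f ^ s * b" by blast
  have "\<not> f dvd b"
  proof
    assume "f dvd b"
    then have "f ^ Suc s dvd a" using b by (metis dvd_refl mult_dvd_mono power_Suc2)
    then have "Suc s \<le> s" using Max_ge[OF fin, of "Suc s"] by (simp add: s_def)
    then show False by simp
  qed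
  then show ?thesis using that b by blast
qed

text \<open>Take \<open>v\<close> whose order \<open>a\<close> has the largest degree. If
  \<open>a\<close> did not kill some \<open>w\<close>, a combination of \<open>v\<close> and a
  multiple of \<open>w\<close> would have order divisible by \<open>f * a\<close> for an irreducible
  \<open>f\<close>, a contradiction.\<close>

lemma max_order_vector:
  assumes "finite W" "subspace W"
  obtains v d where "v \<in> W" "has_order v d" "\<And>w. w \<in> W \<Longrightarrow> act d w = 0"
proof -
  have "\<exists>d. has_order v d" if "v \<in> W" for v using has_order_exists assms that by blast
  then obtain D where D: "\<And>v. v \<in> W \<Longrightarrow> has_order v (D v)" by metis
  have "W \<noteq> {}" using subspace_0[OF assms(2)] by blast
  then obtain v where v: "v \<in> W" "Max ((degree \<circ> D) ` W) = (degree \<circ> D) v"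
    using obtains_MAX[OF assms(1)] by metis
  then have max: "degree (D w) \<le> degree (D v)" if "w \<in> W" for w
    using that assms(1) by (metis Max_ge comp_apply finite_imageI imageI)
  define a where "a = D v"
  have a: "monic a" "\<And>p. act p v = 0 \<longleftrightarrow> a dvd p" using D[OF v(1)] by (auto simp: has_order_def a_def)
  have "act a w = 0" if w: "w \<in> W" for w
  proof (rule ccontr)
    assume ne: "act a w \<noteq> 0"
    have "act a w \<in> W" using assms w by (auto intro: subspace_scale)
    then obtain c where c: "has_order (act a w) c" using has_order_exists assms by blast
    have "\<not> is_unit c" using ne c
      by (metis dvd_trans has_order_def one_dvd scale_one)
    then have "degree c > 0" using c by (auto simp: is_unit_iff_degree has_order_def)
    then obtain f where f: "irreducible f" "f dvd c" 
      using irreducible_monic_factor by (metis dvd_triv_left)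
    obtain c' where c': "c = f * c'" using f(2) by blast
    \<comment> \<open>This multiple of \<open>w\<close> is chosen so that \<open>act a w1\<close> is
      nonzero but killed by the irreducible \<open>f\<close>.\<close>
    define w1 where "w1 = act c' w"
    have "act a w1 \<noteq> 0"
    proof
      assume "act a w1 = 0"
      then have "act c' (act a w) = 0" by (simp add: w1_def mult.commute)
      then have "f * c' dvd c'" using c c' by (auto simp: has_order_def)
      then show False using c c' f(1)
        by (metis dvd_mult_cancel_right has_order_def irreducible_not_unit leading_coeff_0_iff mult.left_neutral mult_zero_right zero_neq_one)
    qed
    have "act f (act a w1) = act c (act a w)" by (simp add: w1_def c' ac_simps)
    then have fa: "act f (act a w1) = 0" using c by (simp add: has_order_def)
    obtain s b where sb: "a = f ^ s * b" "\<not> f dvd b"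
      using irreducible_power_split[OF f(1)] a(1) by (metis leading_coeff_0_iff zero_neq_one)
    \<comment> \<open>The first summand has order \<open>b\<close>, the second has order
      \<open>f ^ Suc s\<close>. These are coprime, so the sum should have order
      \<open>f ^ Suc s * b = f * a\<close>.\<close>
    define u where "u = act (f ^ s) v + act b w1"
    have uW: "u \<in> W" using assms v(1) w by (auto simp: u_def w1_def intro!: subspace_add subspace_scale)
    have prime: "prime_elem f" using f(1) by (rule field_poly_irreducible_imp_prime)
    have bound: "f ^ Suc s * b dvd p" if p: "act p u = 0" for p
    proof (cases "p = 0")
      case False
      obtain i p' where ip: "p = f ^ i * p'" "\<not> f dvd p'" using irreducible_power_split[OF f(1) False] by blast
      have av: "act (f ^ s) (act b v) = 0" using a(2)[of a] sb(1) by (simp add: mult.commute)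
      \<comment> \<open>Applying \<open>b\<close> removes the contribution of \<open>v\<close>; what
        remains forces the factor \<open>f ^ Suc s\<close> into \<open>p\<close>.\<close>
      have "act b (act p u) = act p (act (f ^ s) (act b v)) + act p (act b (act b w1))"
        by (simp add: u_def scale_right_distrib ac_simps)
      then have bp: "act p (act b (act b w1)) = 0" using p av by (metis add_0 scale_zero_right)
      have "Suc s \<le> i"
      proof (rule ccontr)
        assume "\<not> Suc s \<le> i"
        then have "f ^ s = f ^ (s - i) * f ^ i" by (simp add: power_add[symmetric])
        then have "act (p' * b) (act a w1) = act (f ^ (s - i)) (act p (act b (act b w1)))"
          by (simp add: sb(1) ip(1) ac_simps)
        then have "act (p' * b) (act a w1) = 0" using bp scale_zero_right by metis
        moreover have "\<not> f dvd p' * b" using prime ip(2) sb(2) prime_elem_dvd_mult_iff by blast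
        ultimately show False using act_coprime_eq_0[OF f(1) _ fa] \<open>act a w1 \<noteq> 0\<close> by blast
      qed
      then have "f ^ i = f ^ (i - Suc s) * f ^ Suc s" by (metis le_add_diff_inverse2 power_add)
      then obtain p2 where p2: "p = f ^ Suc s * p2" using ip(1) by (metis dvdI dvd_def mult.assoc mult.commute)
      \<comment> \<open>With that factor \<open>p\<close> kills the second summand of
        \<open>u\<close>, hence also the first, which yields the factor \<open>b\<close>.\<close>
      have "act p (act b w1) = act p2 (act f (act a w1))" by (simp add: p2 sb(1) ac_simps)
      then have "act p (act b w1) = 0" using fa scale_zero_right by metis
      then have "act (p * f ^ s) v = 0" using p by (simp add: u_def scale_right_distrib)
      then have "f ^ s * b dvd f ^ s * p" using a(2) sb(1) by (simp add: mult.commute)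
      then have "b dvd p" using f(1) by (auto simp: dvd_mult_cancel_left)
      then obtain k where k: "p = b * k" by blast
      have "f ^ Suc s dvd b * k" using k p2 by (metis dvd_triv_left)
      from prime_elem_power_dvd_cases[OF this, of 1 "Suc s"] prime sb(2)
      have "f ^ Suc s dvd k" by auto
      then show ?thesis using k by (metis dvd_mult_right dvd_refl mult.commute mult_dvd_mono)
    qed simp
    have "act (D u) u = 0" using D[OF uW] by (simp add: has_order_def)
    then have "f ^ Suc s * b dvd D u" by (rule bound)
    moreover have "D u \<noteq> 0" using D[OF uW] by (auto simp: has_order_def)
    ultimately have "degree (f * a) \<le> degree (D u)" using dvd_imp_degree_le sb(1) by (metis mult.assoc power_Suc)
    moreover have "degree (f * a) = degree f + degree a" using f(1) a(1)
      by (metis degree_mult_eq irreducible_def leading_coeff_0_iff zero_neq_one)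
    moreover have "degree f > 0" using f(1) by (auto simp: irreducible_def is_unit_iff_degree)
    ultimately show False using max[OF uW] by (simp add: a_def)
  qed
  then show ?thesis using that v(1) D a_def by blast
qed

end

section \<open>Decomposition of a finite module into cyclic summands\<close>

lemma lin_eq_sum:
  "length ps = length vs \<Longrightarrow> lin act ps vs = (\<Sum>i<length vs. act (ps ! i) (vs ! i))"
  by (simp add: lin_def sum_list_sum_nth lessThan_atLeast0)

context poly_module
begin

text \<open>The complement is a submodule \<open>X\<close> of largest cardinality that meets the
  cyclic submodule of \<open>v\<close> only in \<open>0\<close>. If the two did not span
  \<open>W\<close>, then \<open>X\<close> could be enlarged; that \<open>d\<close> kills all of
  \<open>W\<close> is what makes the enlargement possible.\<close>

lemma cyclic_complement:
  assumes fin: "finite W" and sub: "subspace W" and v: "v \<in> W" and ord: "has_order v d"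
    and ann: "\<And>w. w \<in> W \<Longrightarrow> act d w = 0"
  obtains X where "subspace X" "X \<subseteq> W" "\<And>p. act p v \<in> X \<Longrightarrow> act p v = 0"
    "\<And>w. w \<in> W \<Longrightarrow> \<exists>p. w - act p v \<in> X"
proof -
  define S where "S = {X. subspace X \<and> X \<subseteq> W \<and> (\<forall>p. act p v \<in> X \<longrightarrow> act p v = 0)}"
  have "S \<subseteq> Pow W" by (auto simp: S_def)
  then have "finite S" using fin finite_subset finite_Pow_iff by metis
  moreover have "{0} \<in> S" using subspace_0[OF sub] by (auto simp: S_def)
  ultimately obtain X where X: "X \<in> S" "Max (card ` S) = card X"
    using obtains_MAX[of S card] by blast
  have Xmax: "card Y \<le> card X" if "Y \<in> S" for Y
    using that X(2) \<open>finite S\<close> by (metis Max_ge finite_imageI imageI)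
  have Xs: "subspace X" "X \<subseteq> W" and Xv: "\<And>p. act p v \<in> X \<Longrightarrow> act p v = 0" using X(1) by (auto simp: S_def)
  have "\<exists>p. w - act p v \<in> X" if w: "w \<in> W" for w
  proof (rule ccontr)
    assume none: "\<nexists>p. w - act p v \<in> X"
    \<comment> \<open>The conductor of \<open>w\<close>: the polynomials that move \<open>w\<close>
      into the sum of \<open>X\<close> and the cyclic submodule of \<open>v\<close>.\<close>
    define I where "I = {p. \<exists>g. act p w - act g v \<in> X}"
    have "act d w - act 0 v \<in> X" using ann w subspace_0[OF Xs(1)] by simp
    then have dI: "d \<in> I" unfolding I_def by blast
    have d0: "d \<noteq> 0" using ord by (auto simp: has_order_def)
    have Idiff: "x - y \<in> I" if xy: "x \<in> I" "y \<in> I" for x y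
    proof -
      obtain g h where "act x w - act g v \<in> X" "act y w - act h v \<in> X" using xy unfolding I_def by blast
      then have "(act x w - act g v) - (act y w - act h v) \<in> X" using Xs subspace_diff by blast
      then have "act (x - y) w - act (g - h) v \<in> X" by (simp add: scale_left_diff_distrib algebra_simps)
      then show ?thesis unfolding I_def by blast
    qed
    have Imult: "r * x \<in> I" if x: "x \<in> I" for r x
    proof -
      obtain g where "act x w - act g v \<in> X" using x unfolding I_def by blast
      then have "act r (act x w - act g v) \<in> X" using Xs subspace_scale by blast
      then have "act (r * x) w - act (r * g) v \<in> X" by (simp add: scale_right_diff_distrib)
      then show ?thesis unfolding I_def by blast
    qed
    obtain c where c: "c \<in> I" "c \<noteq> 0" "\<forall>x\<in>I. c dvd x"
      using poly_ideal_principal[OF dI d0 Idiff Imult] by blast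
    obtain c' where c': "d = c * c'" using c(3) dI by blast
    obtain g where g: "act c w - act g v \<in> X" using c(1) unfolding I_def by blast
    \<comment> \<open>Since \<open>d = c * c'\<close> kills \<open>w\<close>, the vector
      \<open>act (c' * g) v\<close> lies in \<open>X\<close> and thus vanishes. Hence
      \<open>c\<close> divides \<open>g\<close>, and subtracting a multiple of \<open>v\<close> from
      \<open>w\<close> gives \<open>w1\<close> with \<open>act c w1\<close> in
      \<open>X\<close>.\<close>
    have "act c' (act c w - act g v) = act d w - act (c' * g) v" by (simp add: scale_right_diff_distrib c' mult.commute)
    then have "act (c' * g) v = - act c' (act c w - act g v)" using ann[OF w] by simp
    then have "act (c' * g) v \<in> X" using g Xs subspace_scale subspace_neg by metis
    then have "d dvd c' * g" using Xv ord by (auto simp: has_order_def)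
    then have "c dvd g" using c' d0 by (simp add: mult.commute[of c])
    then obtain h where h: "g = c * h" by blast
    define w1 where "w1 = w - act h v"
    have w1: "act c w1 \<in> X" using g by (simp add: w1_def h scale_right_diff_distrib)
    define Y where "Y = {y + act p w1 | y p. y \<in> X}"
    have Ysub: "subspace Y"
    proof (rule subspaceI)
      show "0 \<in> Y" unfolding Y_def using subspace_0[OF Xs(1)] by (auto intro!: exI[of _ 0])
    next
      fix x y assume "x \<in> Y" "y \<in> Y"
      then obtain a p b r where "a \<in> X" "b \<in> X" and xy: "x = a + act p w1" "y = b + act r w1" unfolding Y_def by blast
      then have "a + b \<in> X" using Xs subspace_add by blast
      moreover have "x + y = (a + b) + act (p + r) w1" using xy by (simp add: scale_left_distrib)
      ultimately show "x + y \<in> Y" unfolding Y_def by blast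
    next
      fix r x assume "x \<in> Y"
      then obtain a p where "a \<in> X" and x: "x = a + act p w1" unfolding Y_def by blast
      then have "act r a \<in> X" using Xs subspace_scale by blast
      moreover have "act r x = act r a + act (r * p) w1" using x by (simp add: scale_right_distrib)
      ultimately show "act r x \<in> Y" unfolding Y_def by blast
    qed
    have w1W: "w1 \<in> W" using w v sub by (auto simp: w1_def intro!: subspace_diff subspace_scale)
    then have YW: "Y \<subseteq> W" using Xs(2) sub by (auto simp: Y_def intro!: subspace_add subspace_scale)
    have "act p v = 0" if p: "act p v \<in> Y" for p
    proof -
      obtain y r where yr: "y \<in> X" "act p v = y + act r w1" using p unfolding Y_def by blast
      \<comment> \<open>An element of \<open>Y\<close> that is a multiple of \<open>v\<close> puts
        its coefficient \<open>r\<close> into the conductor. So \<open>c\<close> divides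
        \<open>r\<close>, and the element lies in \<open>X\<close> already.\<close>
      have "act r w - act (r * h + p) v = - y"
        using yr(2) by (simp add: w1_def scale_right_diff_distrib scale_left_distrib algebra_simps)
      then have "act r w - act (r * h + p) v \<in> X" using yr(1) Xs subspace_neg by metis
      then have "r \<in> I" unfolding I_def by blast
      then obtain k where "r = c * k" using c(3) by blast
      then have "act r w1 = act k (act c w1)" by (simp add: mult.commute)
      then have "act r w1 \<in> X" using w1 Xs subspace_scale by metis
      then have "act p v \<in> X" using yr Xs subspace_add by metis
      then show ?thesis using Xv by blast
    qed
    then have "Y \<in> S" using Ysub YW by (auto simp: S_def)
    moreover have "card X < card Y"
    proof (rule psubset_card_mono)
      show "finite Y" using YW fin finite_subset by blast
      have "y = y + act 0 w1" "w1 = 0 + act 1 w1" for y by simp_all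
      then have "X \<subseteq> Y" "w1 \<in> Y" unfolding Y_def using subspace_0[OF Xs(1)] by blast+
      moreover have "w1 \<notin> X" using none by (auto simp: w1_def)
      ultimately show "X \<subset> Y" by blast
    qed
    ultimately show False using Xmax by fastforce
  qed
  then show ?thesis using that Xs Xv by blast
qed

text \<open>Shows that \<open>ds ! i\<close> is the full annihilator of \<open>vs ! i\<close>: a
  nonzero remainder of \<open>p\<close> in place \<open>i\<close> would give a second reduced
  coordinate tuple for the zero vector.\<close>

lemma cyclic_basis_dvd:
  assumes "cyclic_basis W vs ds" "i < length ds" "act p (vs ! i) = 0"
  shows "ds ! i dvd p"
proof -
  have len: "length vs = length ds" and deg: "\<And>j. j < length ds \<Longrightarrow> 0 < degree (ds ! j)"
    and ann: "act (ds ! i) (vs ! i) = 0"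
    and inj: "inj_on (\<lambda>ps. lin act ps vs) (residue_tuples ds)"
    using assms by (auto simp: cyclic_basis_def divisor_chain_def list_all2_conv_all_nth bij_betw_def)
  define r where "r = p mod (ds ! i)"
  have "p = (p div (ds ! i)) * (ds ! i) + r" by (simp add: r_def div_mult_mod_eq)
  then have "act p (vs ! i) = act (p div (ds ! i)) (act (ds ! i) (vs ! i)) + act r (vs ! i)"
    by (metis scale_left_distrib scale_scale)
  then have r: "act r (vs ! i) = 0" using assms(3) ann by (metis add_0 scale_zero_right)
  define z where "z = replicate (length ds) (0 :: 'a poly)"
  have "ds ! i \<noteq> 0" using deg[OF assms(2)] by auto
  from degree_mod_less[OF this, of p] have "degree r < degree (ds ! i)"
    using deg[OF assms(2)] by (auto simp: r_def)
  then have zr: "z \<in> residue_tuples ds" "z[i := r] \<in> residue_tuples ds"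
    using deg assms(2) by (auto simp: residue_tuples_def z_def list_all2_conv_all_nth nth_list_update)
  have "lin act (z[i := r]) vs = 0" "lin act z vs = 0"
    using r len assms(2) by (auto simp: lin_eq_sum z_def nth_list_update intro!: sum.neutral)
  then have "z[i := r] = z" using inj_onD[OF inj _ zr(2,1)] by simp
  then have "r = 0" using assms(2) by (metis length_replicate nth_list_update_eq nth_replicate z_def)
  then show ?thesis by (simp add: r_def mod_eq_0_iff_dvd)
qed

text \<open>Split off the cyclic submodule of a vector of maximal order and recurse into a
  complement. The order split off first kills all of \<open>W\<close>, so the later ones divide
  it.\<close>

theorem cyclic_basis_exists:
  assumes "finite W" "subspace W"
  shows "\<exists>vs ds. cyclic_basis W vs ds"
  using assms
proof (induction W rule: finite_psubset_induct)
  case (psubset W)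
  show ?case
  proof (cases "W = {0}")
    case True
    then have "cyclic_basis W [] []"
      by (auto simp: cyclic_basis_def divisor_chain_def residue_tuples_def bij_betw_def)
    then show ?thesis by blast
  next
    case False
    obtain v d where v: "v \<in> W" "has_order v d" and ann: "\<And>w. w \<in> W \<Longrightarrow> act d w = 0"
      using max_order_vector[OF psubset(1,3)] by blast
    have ord: "act p v = 0 \<longleftrightarrow> d dvd p" for p using v(2) by (simp add: has_order_def)
    have d0: "d \<noteq> 0" using v(2) by (auto simp: has_order_def)
    have deg: "0 < degree d"
    proof (rule ccontr)
      assume "\<not> 0 < degree d"
      then have "d = 1" using v(2) by (auto simp: has_order_def one_pCons elim!: degree_eq_zeroE)
      then have "W \<subseteq> {0}" using ann by auto
      then show False using False subspace_0[OF psubset(3)] by blast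
    qed
    then have v0: "v \<noteq> 0" using ord[of 1] by (auto simp: is_unit_iff_degree d0)
    obtain X where X: "subspace X" "X \<subseteq> W" and Xv: "\<And>p. act p v \<in> X \<Longrightarrow> act p v = 0"
      and split: "\<And>w. w \<in> W \<Longrightarrow> \<exists>p. w - act p v \<in> X"
      using cyclic_complement[OF psubset(1,3) v ann] by blast
    have "v \<notin> X" using Xv[of 1] v0 by auto
    then have "X \<subset> W" using X(2) v(1) by blast
    then obtain vs ds where cb: "cyclic_basis X vs ds" using psubset(2) X(1) by blast
    have len: "length vs = length ds" and vsX: "\<And>i. i < length ds \<Longrightarrow> vs ! i \<in> X"
      using cb by (auto simp: cyclic_basis_def list_all2_conv_all_nth)
    have bij: "bij_betw (\<lambda>ps. lin act ps vs) (residue_tuples ds) X" using cb by (simp add: cyclic_basis_def)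
    have "d' dvd d" if d': "d' \<in> set ds" for d'
    proof -
      obtain i where i: "i < length ds" "d' = ds ! i" using d' by (metis in_set_conv_nth)
      then have "act d (vs ! i) = 0" using ann vsX X(2) by blast
      then show ?thesis using cyclic_basis_dvd[OF cb] i by blast
    qed
    then have "divisor_chain (d # ds)"
      using cb deg v(2) by (auto simp: cyclic_basis_def divisor_chain_def has_order_def)
    moreover have "list_all2 (\<lambda>v d. v \<in> W \<and> act d v = 0) (v # vs) (d # ds)"
      using cb X(2) v(1) ord by (auto simp: cyclic_basis_def elim!: list_all2_mono)
    moreover have "bij_betw (\<lambda>ps. lin act ps (v # vs)) (residue_tuples (d # ds)) W"
    proof -
      have red: "residue_tuples (d # ds) = {p # ps | p ps. degree p < degree d \<and> ps \<in> residue_tuples ds}"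
        by (auto simp: residue_tuples_def list_all2_Cons2)
      have inX: "lin act ps vs \<in> X" if "ps \<in> residue_tuples ds" for ps using bij that by (auto simp: bij_betw_def)
      show ?thesis unfolding bij_betw_def
      proof (rule conjI)
        show "inj_on (\<lambda>ps. lin act ps (v # vs)) (residue_tuples (d # ds))"
        proof (rule inj_onI)
          fix x y assume xy: "x \<in> residue_tuples (d # ds)" "y \<in> residue_tuples (d # ds)"
            and eq: "lin act x (v # vs) = lin act y (v # vs)"
          obtain p ps where x: "x = p # ps" "degree p < degree d" "ps \<in> residue_tuples ds"
            using xy(1) unfolding red by blast
          obtain r rs where y: "y = r # rs" "degree r < degree d" "rs \<in> residue_tuples ds"
            using xy(2) unfolding red by blast
          have "act (p - r) v = lin act rs vs - lin act ps vs"
            using eq x(1) y(1) by (simp add: scale_left_diff_distrib algebra_simps)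
          then have "act (p - r) v \<in> X" using inX x y X(1) subspace_diff by metis
          then have "d dvd p - r" using Xv ord by blast
          moreover have "degree (p - r) < degree d" using x y by (simp add: degree_diff_less)
          ultimately have "p = r" using dvd_imp_degree_le[of d "p - r"] by auto
          moreover from this have "lin act ps vs = lin act rs vs" using eq x y by simp
          then have "ps = rs" using inj_onD[OF bij_betw_imp_inj_on[OF bij]] x y by blast
          ultimately show "x = y" using x y by simp
        qed
        show "(\<lambda>ps. lin act ps (v # vs)) ` residue_tuples (d # ds) = W"
        proof
          show "(\<lambda>ps. lin act ps (v # vs)) ` residue_tuples (d # ds) \<subseteq> W"
            using subsetD[OF X(2) inX] v(1) psubset(3) by (auto simp: red intro!: subspace_add subspace_scale)
          show "W \<subseteq> (\<lambda>ps. lin act ps (v # vs)) ` residue_tuples (d # ds)"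
          proof
            fix w assume "w \<in> W"
            then obtain p where p: "w - act p v \<in> X" using split by blast
            have "act p v = act (p div d * d + p mod d) v" by simp
            also have "\<dots> = act (p div d) (act d v) + act (p mod d) v"
              by (metis scale_left_distrib scale_scale)
            also have "\<dots> = act (p mod d) v" using ord by simp
            finally have "w - act (p mod d) v \<in> X" using p by simp
            then obtain ps where ps: "ps \<in> residue_tuples ds" "lin act ps vs = w - act (p mod d) v"
              using bij by (auto simp: bij_betw_def image_def)
            have "degree (p mod d) < degree d" using degree_mod_less[OF d0, of p] deg by auto
            then have "(p mod d) # ps \<in> residue_tuples (d # ds)" using ps unfolding red by blast
            moreover have "w = lin act ((p mod d) # ps) (v # vs)" using ps by simp
            ultimately show "w \<in> (\<lambda>ps. lin act ps (v # vs)) ` residue_tuples (d # ds)" by blast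
          qed
        qed
      qed
    qed
    ultimately show ?thesis unfolding cyclic_basis_def by blast
  qed
qed

end

section \<open>Homomorphisms out of a sum of cyclic modules\<close>

lemma (in poly_module) lin_add:
  assumes "length ps = length vs" "length rs = length vs"
  shows "lin act (map2 (+) ps rs) vs = lin act ps vs + lin act rs vs"
  using assms by (simp add: lin_eq_sum scale_left_distrib sum.distrib)

lemma (in poly_module) lin_scale:
  assumes "length ps = length vs"
  shows "lin act (map ((*) p) ps) vs = act p (lin act ps vs)"
  using assms by (simp add: lin_eq_sum scale_sum_right)

lemma (in poly_module) lin_mod:
  assumes "list_all2 (\<lambda>v d. act d v = 0) vs ds" "length ps = length ds"
  shows "lin act (map2 (mod) ps ds) vs = lin act ps vs"
proof -
  have len: "length vs = length ds" using assms(1) by (simp add: list_all2_lengthD)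
  have "act (ps ! i mod ds ! i) (vs ! i) = act (ps ! i) (vs ! i)" if "i < length ds" for i
  proof -
    have "act (ds ! i) (vs ! i) = 0" using assms(1) that len by (simp add: list_all2_conv_all_nth)
    moreover have "act (ps ! i) (vs ! i) =
        act (ps ! i div ds ! i) (act (ds ! i) (vs ! i)) + act (ps ! i mod ds ! i) (vs ! i)"
      by (metis div_mult_mod_eq scale_left_distrib scale_scale)
    ultimately show ?thesis by simp
  qed
  then show ?thesis using assms len by (simp add: lin_eq_sum)
qed

lemma residue_tuples_mod:
  assumes "divisor_chain ds" "length ps = length ds"
  shows "map2 (mod) ps ds \<in> residue_tuples ds"
proof -
  have "degree (ps ! i mod ds ! i) < degree (ds ! i)" if "i < length ds" for i
  proof -
    have d: "0 < degree (ds ! i)" using assms(1) that by (simp add: divisor_chain_def)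
    then have "ds ! i \<noteq> 0" by auto
    from degree_mod_less[OF this, of "ps ! i"] show ?thesis using d by auto
  qed
  then show ?thesis using assms(2) by (simp add: residue_tuples_def list_all2_conv_all_nth)
qed

text \<open>Generators may be sent to any vectors killed by the same polynomials: reducing the
  coefficients modulo \<open>ds\<close> then changes neither side, so the map is well defined and
  linear.\<close>

lemma cyclic_hom:
  assumes m1: "poly_module act1" and m2: "poly_module act2"
    and cb: "poly_module.cyclic_basis act1 W vs ds"
    and ws: "list_all2 (\<lambda>w d. act2 d w = 0) ws ds"
  obtains h where "\<And>x y. x \<in> W \<Longrightarrow> y \<in> W \<Longrightarrow> h (x + y) = h x + h y"
    "\<And>p x. x \<in> W \<Longrightarrow> h (act1 p x) = act2 p (h x)"
    "\<And>ps. length ps = length ds \<Longrightarrow> h (lin act1 ps vs) = lin act2 ps ws"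
proof -
  interpret M1: poly_module act1 by fact
  interpret M2: poly_module act2 by fact
  have chain: "divisor_chain ds" and len: "length vs = length ds" "length ws = length ds"
    and ann: "list_all2 (\<lambda>v d. act1 d v = 0) vs ds"
    and bij: "bij_betw (\<lambda>ps. lin act1 ps vs) (residue_tuples ds) W"
    using cb ws by (auto simp: M1.cyclic_basis_def list_all2_lengthD elim!: list_all2_mono)
  define h where "h x = lin act2 (inv_into (residue_tuples ds) (\<lambda>ps. lin act1 ps vs) x) ws" for x
  have h: "h (lin act1 ps vs) = lin act2 ps ws" if "length ps = length ds" for ps
  proof -
    have red: "map2 (mod) ps ds \<in> residue_tuples ds" using residue_tuples_mod chain that by blast
    have "h (lin act1 ps vs) = h (lin act1 (map2 (mod) ps ds) vs)" using M1.lin_mod[OF ann that] by simp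
    also have "\<dots> = lin act2 (map2 (mod) ps ds) ws"
      unfolding h_def using inv_into_f_f[OF bij_betw_imp_inj_on[OF bij] red] by simp
    also have "\<dots> = lin act2 ps ws" by (rule M2.lin_mod[OF ws that])
    finally show ?thesis .
  qed
  have rep: "\<exists>ps. length ps = length ds \<and> x = lin act1 ps vs" if "x \<in> W" for x
    using bij that by (auto simp: bij_betw_def image_def residue_tuples_def dest: list_all2_lengthD)
  show ?thesis
  proof (rule that)
    fix x y assume "x \<in> W" "y \<in> W"
    then obtain ps rs where "length ps = length ds" "x = lin act1 ps vs" "length rs = length ds" "y = lin act1 rs vs"
      using rep by metis
    then show "h (x + y) = h x + h y"
      using h len by (simp add: M1.lin_add[symmetric] M2.lin_add[symmetric])
  next
    fix p x assume "x \<in> W"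
    then obtain ps where "length ps = length ds" "x = lin act1 ps vs" using rep by metis
    then show "h (act1 p x) = act2 p (h x)"
      using h len by (simp add: M1.lin_scale[symmetric] M2.lin_scale[symmetric])
  qed (rule h)
qed

text \<open>Equal invariant factors give isomorphic modules. Sending generators to generators
  preserves coordinates, and both modules are parametrized by the same residue tuples.\<close>

lemma cyclic_iso:
  assumes m1: "poly_module act1" and m2: "poly_module act2"
    and cb1: "poly_module.cyclic_basis act1 W1 vs ds"
    and cb2: "poly_module.cyclic_basis act2 W2 ws ds"
  obtains h where "\<And>x y. x \<in> W1 \<Longrightarrow> y \<in> W1 \<Longrightarrow> h (x + y) = h x + h y"
    "\<And>p x. x \<in> W1 \<Longrightarrow> h (act1 p x) = act2 p (h x)" "bij_betw h W1 W2"
proof -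
  interpret M1: poly_module act1 by fact
  interpret M2: poly_module act2 by fact
  have ws: "list_all2 (\<lambda>w d. act2 d w = 0) ws ds"
    using cb2 by (auto simp: M2.cyclic_basis_def elim!: list_all2_mono)
  obtain h where h: "\<And>x y. x \<in> W1 \<Longrightarrow> y \<in> W1 \<Longrightarrow> h (x + y) = h x + h y"
    "\<And>p x. x \<in> W1 \<Longrightarrow> h (act1 p x) = act2 p (h x)"
    and lin: "\<And>ps. length ps = length ds \<Longrightarrow> h (lin act1 ps vs) = lin act2 ps ws"
    using cyclic_hom[OF m1 m2 cb1 ws] by blast
  have "bij_betw (\<lambda>ps. lin act1 ps vs) (residue_tuples ds) W1" using cb1 by (simp add: M1.cyclic_basis_def)
  moreover have "bij_betw (\<lambda>ps. lin act2 ps ws) (residue_tuples ds) W2" using cb2 by (simp add: M2.cyclic_basis_def)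
  then have "bij_betw (h \<circ> (\<lambda>ps. lin act1 ps vs)) (residue_tuples ds) W2"
    by (rule bij_betw_cong[THEN iffD1, rotated]) (auto simp: lin residue_tuples_def dest: list_all2_lengthD)
  ultimately have "bij_betw h W1 W2" by (rule bij_betw_comp_iff[THEN iffD2])
  then show ?thesis using that h by blast
qed

section \<open>The module of a matrix\<close>

text \<open>Vectors of length \<open>n\<close> as functions extended by zero, so that vectors of all
  lengths live in one additive group with pointwise operations.\<close>

definition fvec :: "nat \<Rightarrow> (nat \<Rightarrow> 'a::zero) set" where
  "fvec n = {v. \<forall>i\<ge>n. v i = 0}"

definition mat_op :: "'a::semiring_0 mat \<Rightarrow> (nat \<Rightarrow> 'a) \<Rightarrow> nat \<Rightarrow> 'a" where
  "mat_op M v = (\<lambda>i. if i < dim_row M then \<Sum>j<dim_col M. M $$ (i, j) * v j else 0)"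

text \<open>The vector \<open>p(M) v\<close> by Horner's scheme. This makes the space of all
  functions an \<open>F[x]\<close>-module in which \<open>x\<close> acts as
  \<open>M\<close>.\<close>

definition mat_act :: "'a::comm_semiring_0 mat \<Rightarrow> 'a poly \<Rightarrow> (nat \<Rightarrow> 'a) \<Rightarrow> nat \<Rightarrow> 'a" where
  "mat_act M p v = fold_coeffs (\<lambda>a w. (\<lambda>i. a * v i) + mat_op M w) p 0"

lemma mat_op_zero [simp]: "mat_op M 0 = 0"
  and mat_op_add: "mat_op M (v + w) = mat_op M v + mat_op M w"
  by (auto simp: mat_op_def fun_eq_iff algebra_simps sum.distrib)

lemma mat_op_add_fun: "mat_op M (\<lambda>i. v i + w i) = (\<lambda>i. mat_op M v i + mat_op M w i)"
  using mat_op_add[of M v w] by (simp add: plus_fun_def)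

lemma mat_op_scale: "mat_op M (\<lambda>i. a * v i) = (\<lambda>i. a * mat_op M v i)"
  for M :: "'a::comm_semiring_0 mat"
  by (auto simp: mat_op_def fun_eq_iff sum_distrib_left algebra_simps)

lemma mat_act_0 [simp]: "mat_act M 0 v = 0"
  by (simp add: mat_act_def)

lemma mat_act_pCons [simp]: "mat_act M (pCons a p) v = (\<lambda>i. a * v i) + mat_op M (mat_act M p v)"
  by (cases "p = 0 \<and> a = 0") (auto simp: mat_act_def fold_coeffs_def cCons_def fun_eq_iff)

lemma mat_act_smult: "mat_act M (smult a p) v = (\<lambda>i. a * mat_act M p v i)"
proof (induction p)
  case (pCons b p)
  then show ?case by (simp add: mat_op_scale) (simp add: fun_eq_iff algebra_simps)
qed (simp add: fun_eq_iff)

lemma mat_act_add: "mat_act M (p + q) v = mat_act M p v + mat_act M q v"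
proof (induction p q rule: poly_induct2)
  case (pCons a p b q)
  then show ?case by (simp add: mat_op_add mat_op_add_fun) (simp add: fun_eq_iff algebra_simps mat_op_add_fun)
qed simp

lemma poly_module_mat_act: "poly_module (mat_act (M :: 'a::{field,finite} mat))"
proof unfold_locales
  fix p q :: "'a poly" and v w :: "nat \<Rightarrow> 'a"
  show "mat_act M p (v + w) = mat_act M p v + mat_act M p w"
  proof (induction p)
    case (pCons a p)
    then show ?case by (simp add: mat_op_add mat_op_add_fun) (simp add: fun_eq_iff algebra_simps mat_op_add_fun)
  qed simp
  show "mat_act M (p + q) v = mat_act M p v + mat_act M q v" by (rule mat_act_add)
  show "mat_act M p (mat_act M q v) = mat_act M (p * q) v"
  proof (induction p)
    case (pCons a p)
    then show ?case by (simp add: mult_pCons_left mat_act_add mat_act_smult)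
  qed simp
  show "mat_act M 1 v = v" by (simp add: one_pCons fun_eq_iff)
qed

lemma mat_act_const: "mat_act M [:c:] v = (\<lambda>i. c * v i)"
  and mat_act_X: "mat_act M [:0, 1:] v = mat_op M v" for M :: "'a::comm_semiring_1 mat"
proof -
  show const: "mat_act M [:c:] v = (\<lambda>i. c * v i)" for c by (simp add: fun_eq_iff)
  have "mat_act M [:0, 1:] v = (\<lambda>i. 0 * v i) + mat_op M (\<lambda>i. 1 * v i)" using const[of 1] by simp
  then show "mat_act M [:0, 1:] v = mat_op M v" by (simp add: fun_eq_iff)
qed

lemma mat_op_in_fvec: "mat_op M v \<in> fvec (dim_row M)"
  by (simp add: mat_op_def fvec_def)

lemma mat_act_in_fvec:
  assumes "M \<in> carrier_mat n n" "v \<in> fvec n"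
  shows "mat_act M p v \<in> fvec n"
proof (induction p)
  case (pCons a p)
  then show ?case using assms mat_op_in_fvec[of M "mat_act M p v"] by (auto simp: fvec_def)
qed (simp add: fvec_def)

lemma subspace_fvec:
  fixes M :: "'a::{field,finite} mat"
  assumes "M \<in> carrier_mat n n"
  shows "Modules.module.subspace (mat_act M) (fvec n)"
proof -
  interpret poly_module "mat_act M" by (rule poly_module_mat_act)
  show ?thesis by (rule subspaceI) (use mat_act_in_fvec[OF assms] in \<open>auto simp: fvec_def\<close>)
qed

lemma bij_betw_fvec: "bij_betw (\<lambda>v. restrict v {..<n}) (fvec n) ({..<n} \<rightarrow>\<^sub>E UNIV)"
  by (rule bij_betw_byWitness[where f' = "\<lambda>v i. if i < n then v i else 0"])
     (auto simp: fvec_def fun_eq_iff PiE_def extensional_def)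

lemma finite_fvec: "finite (fvec n :: (nat \<Rightarrow> 'a::{zero,finite}) set)"
  using bij_betw_finite[OF bij_betw_fvec[of n, where 'a = 'a]] by (simp add: finite_PiE)

lemma card_fvec: "card (fvec n :: (nat \<Rightarrow> 'a::{zero,finite}) set) = CARD('a) ^ n"
  using bij_betw_same_card[OF bij_betw_fvec[of n, where 'a = 'a]] by (simp add: card_PiE)

definition unit_fun :: "nat \<Rightarrow> nat \<Rightarrow> 'a::zero_neq_one" where
  "unit_fun j = (\<lambda>i. if i = j then 1 else 0)"

lemma unit_fun_in_fvec: "j < n \<Longrightarrow> unit_fun j \<in> fvec n"
  by (auto simp: unit_fun_def fvec_def)

lemma mat_op_unit_fun:
  fixes M :: "'a::semiring_1 mat"
  assumes "i < dim_row M" "j < dim_col M"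
  shows "mat_op M (unit_fun j) i = M $$ (i, j)"
  using assms by (simp add: mat_op_def unit_fun_def if_distrib[of "\<lambda>x. _ * x"] cong: if_cong)

lemma mat_op_ext:
  fixes A B :: "'a::semiring_1 mat"
  assumes "A \<in> carrier_mat m n" "B \<in> carrier_mat m n" "\<And>v. v \<in> fvec n \<Longrightarrow> mat_op A v = mat_op B v"
  shows "A = B"
proof (rule eq_matI)
  fix i j assume ij: "i < dim_row B" "j < dim_col B"
  then have "mat_op A (unit_fun j) = mat_op B (unit_fun j)" using assms unit_fun_in_fvec by auto
  then have "mat_op A (unit_fun j) i = mat_op B (unit_fun j) i" by simp
  then show "A $$ (i, j) = B $$ (i, j)" using ij assms(1,2) by (simp add: mat_op_unit_fun)
qed (use assms in auto)

lemma mat_op_mult: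
  fixes A B :: "'a::semiring_0 mat"
  assumes "A \<in> carrier_mat m k" "B \<in> carrier_mat k n"
  shows "mat_op (A * B) v = mat_op A (mat_op B v)"
proof
  fix i
  show "mat_op (A * B) v i = mat_op A (mat_op B v) i"
  proof (cases "i < m")
    case True
    have "mat_op (A * B) v i = (\<Sum>j<n. \<Sum>l<k. A $$ (i, l) * B $$ (l, j) * v j)"
      using assms True by (auto simp: mat_op_def scalar_prod_def sum_distrib_right lessThan_atLeast0)
    also have "\<dots> = (\<Sum>l<k. \<Sum>j<n. A $$ (i, l) * B $$ (l, j) * v j)" by (rule sum.swap)
    also have "\<dots> = mat_op A (mat_op B v) i"
      using assms True by (auto simp: mat_op_def sum_distrib_left mult.assoc intro!: sum.cong)
    finally show ?thesis .
  qed (use assms in \<open>simp add: mat_op_def\<close>)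
qed

lemma mat_op_one: "v \<in> fvec n \<Longrightarrow> mat_op (1\<^sub>m n) v = (v :: nat \<Rightarrow> 'a::semiring_1)"
  by (auto simp: mat_op_def fvec_def fun_eq_iff if_distrib[of "\<lambda>x. x * _"] cong: if_cong)

definition op_mat :: "nat \<Rightarrow> ((nat \<Rightarrow> 'a) \<Rightarrow> nat \<Rightarrow> 'a) \<Rightarrow> 'a::zero_neq_one mat" where
  "op_mat n h = mat n n (\<lambda>(i, j). h (unit_fun j) i)"

lemma op_mat_carrier [simp]: "op_mat n h \<in> carrier_mat n n"
  by (simp add: op_mat_def)

text \<open>Turns module homomorphisms constructed abstractly into matrices. Linearity is assumed on
  \<open>fvec n\<close> only, so the induction adds one coordinate of \<open>v\<close> at a time and
  stays inside that set.\<close>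

lemma mat_op_op_mat:
  fixes h :: "(nat \<Rightarrow> 'a) \<Rightarrow> nat \<Rightarrow> 'a::comm_ring_1"
  assumes add: "\<And>x y. x \<in> fvec n \<Longrightarrow> y \<in> fvec n \<Longrightarrow> h (x + y) = h x + h y"
    and scale: "\<And>c x. x \<in> fvec n \<Longrightarrow> h (\<lambda>i. c * x i) = (\<lambda>i. c * h x i)"
    and closed: "\<And>x. x \<in> fvec n \<Longrightarrow> h x \<in> fvec n"
    and v: "v \<in> fvec n"
  shows "mat_op (op_mat n h) v = h v"
proof -
  have partial: "h (\<lambda>i. if i < k then v i else 0) = (\<lambda>i. \<Sum>j<k. v j * h (unit_fun j) i)" if "k \<le> n" for k
    using that
  proof (induction k)
    case 0
    have "h (\<lambda>i. 0 * (0::nat \<Rightarrow> 'a) i) = (\<lambda>i. 0 * h 0 i)" by (rule scale) (simp add: fvec_def)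
    then show ?case by simp
  next
    case (Suc k)
    have "(\<lambda>i. if i < Suc k then v i else 0) = (\<lambda>i. if i < k then v i else 0) + (\<lambda>i. v k * unit_fun k i)"
      by (auto simp: fun_eq_iff unit_fun_def less_Suc_eq)
    moreover have "(\<lambda>i. if i < k then v i else 0) \<in> fvec n" "(\<lambda>i. v k * unit_fun k i) \<in> fvec n" "unit_fun k \<in> (fvec n :: (nat \<Rightarrow> 'a) set)"
      using Suc.prems by (auto simp: fvec_def unit_fun_def)
    ultimately have "h (\<lambda>i. if i < Suc k then v i else 0)
        = h (\<lambda>i. if i < k then v i else 0) + (\<lambda>i. v k * h (unit_fun k) i)"
      using add scale by metis
    then show ?case using Suc by (simp add: fun_eq_iff)
  qed
  have "(\<lambda>i. if i < n then v i else 0) = v" using v by (auto simp: fvec_def)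
  then have "h v = (\<lambda>i. \<Sum>j<n. v j * h (unit_fun j) i)" using partial[of n] by simp
  moreover have "h v i = 0" if "\<not> i < n" for i using closed[OF v] that by (simp add: fvec_def)
  ultimately show ?thesis by (auto simp: mat_op_def op_mat_def fun_eq_iff mult.commute)
qed

section \<open>Invertible matrices\<close>

definition GL :: "nat \<Rightarrow> 'a::field mat set" where
  "GL n = {P \<in> carrier_mat n n. invertible_mat P}"

lemma GL_carrier: "P \<in> GL n \<Longrightarrow> P \<in> carrier_mat n n"
  by (simp add: GL_def)

lemma GL_I:
  assumes "P \<in> carrier_mat n n" "Q \<in> carrier_mat n n" "P * Q = 1\<^sub>m n"
  shows "P \<in> GL n"
  using assms mat_mult_left_right_inverse[OF assms]
  by (auto simp: GL_def invertible_mat_def inverts_mat_def)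

lemma GL_inverse:
  assumes "P \<in> GL n"
  obtains Q where "Q \<in> GL n" "P * Q = 1\<^sub>m n" "Q * P = 1\<^sub>m n"
proof -
  have P: "P \<in> carrier_mat n n" using assms by (rule GL_carrier)
  obtain Q where Q: "P * Q = 1\<^sub>m n" "Q * P = 1\<^sub>m (dim_row Q)"
    using assms by (auto simp: GL_def invertible_mat_def inverts_mat_def)
  have "dim_col Q = n" using arg_cong[OF Q(1), of dim_col] by simp
  moreover have "dim_row Q = n" using arg_cong[OF Q(2), of dim_col] P by simp
  ultimately have "Q \<in> carrier_mat n n" by auto
  then show ?thesis using that Q P GL_I \<open>dim_row Q = n\<close> by metis
qed

lemma finite_GL: "finite (GL n :: 'a::{field,finite} mat set)"
  by (rule finite_subset[OF _ finite_carrier_mat[of n n]]) (auto simp: GL_def)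

lemma GL_mult:
  assumes "P \<in> GL n" "Q \<in> GL n"
  shows "P * Q \<in> GL n"
proof -
  obtain P' Q' where P': "P' \<in> GL n" "P * P' = 1\<^sub>m n" and Q': "Q' \<in> GL n" "Q * Q' = 1\<^sub>m n"
    using assms GL_inverse by metis
  note c = assms[THEN GL_carrier] P'(1)[THEN GL_carrier] Q'(1)[THEN GL_carrier]
  have "(P * Q) * (Q' * P') = P * ((Q * Q') * P')"
    using c by (simp add: assoc_mult_mat[of _ n n _ n _ n])
  then have "(P * Q) * (Q' * P') = 1\<^sub>m n" using c P' Q' by simp
  then show ?thesis using c by (intro GL_I[of _ _ "Q' * P'"]) auto
qed

lemma GL_cancel:
  assumes "Q \<in> GL n" "A \<in> carrier_mat n n" "B \<in> carrier_mat n n" "A * Q = B * Q"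
  shows "A = B"
proof -
  obtain Q' where Q': "Q' \<in> GL n" "Q * Q' = 1\<^sub>m n" using assms(1) GL_inverse by metis
  have "A * Q * Q' = B * Q * Q'" using assms(4) by simp
  then show ?thesis using assms(2,3) Q'(2) GL_carrier[OF assms(1)] GL_carrier[OF Q'(1)]
    by (simp add: assoc_mult_mat[of _ n n _ n _ n])
qed

lemma GL_of_inj:
  fixes P :: "'a::field mat"
  assumes P: "P \<in> carrier_mat n n" and inj: "\<And>v. v \<in> fvec n \<Longrightarrow> mat_op P v = 0 \<Longrightarrow> v = 0"
  shows "P \<in> GL n"
proof -
  have "det P \<noteq> 0"
  proof
    assume "det P = 0"
    then obtain v where v: "v \<in> carrier_vec n" "v \<noteq> 0\<^sub>v n" "P *\<^sub>v v = 0\<^sub>v n"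
      using det_0_iff_vec_prod_zero_field[OF P] by blast
    define w where "w = (\<lambda>i. if i < n then v $ i else 0)"
    have "mat_op P w = 0"
    proof
      fix i
      show "mat_op P w i = 0 i"
      proof (cases "i < n")
        case True
        then have "(P *\<^sub>v v) $ i = mat_op P w i"
          using P v(1) by (auto simp: mat_op_def w_def scalar_prod_def lessThan_atLeast0)
        then show ?thesis using v(3) True by simp
      qed (use P in \<open>simp add: mat_op_def\<close>)
    qed
    then have "w = 0" using inj by (simp add: w_def fvec_def)
    then have "v $ i = 0" if "i < n" for i using that by (auto simp: w_def fun_eq_iff split: if_splits)
    then show False using v(1,2) by (metis carrier_vecD eq_vecI index_zero_vec(1,2))
  qed
  from det_non_zero_imp_unit[OF P this, of undefined] obtain Q
    where "Q \<in> carrier_mat n n" "P * Q = 1\<^sub>m n"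
    by (auto simp: Units_def ring_mat_def)
  then show ?thesis using GL_I P by blast
qed

text \<open>The adjugate argument carried out in the module: each column of \<open>xI - M\<close>,
  applied to the unit vectors, gives zero. Multiplying by the adjugate shows that the determinant of
  \<open>xI - M\<close> acts as zero on every unit vector.\<close>

lemma cayley_hamilton:
  fixes M :: "'a::{field,finite} mat"
  assumes M: "M \<in> carrier_mat n n" and v: "v \<in> fvec n"
  shows "mat_act M (char_poly M) v = 0"
proof -
  interpret poly_module "mat_act M" by (rule poly_module_mat_act)
  define X where "X = char_poly_matrix M"
  have X: "X \<in> carrier_mat n n" using M by (simp add: X_def)
  have col: "(\<Sum>i<n. mat_act M (X $$ (i, j)) (unit_fun i)) = 0" if j: "j < n" for j
  proof -
    have entry: "X $$ (i, j) = (if i = j then [:0, 1:] else 0) + [:- M $$ (i, j):]" if "i < n" for i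
      using that j M by (simp add: X_def char_poly_matrix_def)
    have "(\<Sum>i<n. mat_act M (X $$ (i, j)) (unit_fun i))
        = (\<Sum>i<n. mat_act M (if i = j then [:0, 1:] else 0) (unit_fun i))
          + (\<Sum>i<n. mat_act M [:- M $$ (i, j):] (unit_fun i))"
      unfolding sum.distrib[symmetric] scale_left_distrib[symmetric]
      by (intro sum.cong refl) (simp add: entry)
    also have "(\<Sum>i<n. mat_act M (if i = j then [:0, 1:] else 0) (unit_fun i)) = mat_op M (unit_fun j)"
    proof -
      have "(\<Sum>i<n. mat_act M (if i = j then [:0, 1:] else 0) (unit_fun i))
          = (\<Sum>i<n. if i = j then mat_act M [:0, 1:] (unit_fun i) else 0)"
        by (intro sum.cong refl) simp
      then show ?thesis using j by (simp only: sum.delta' sum.delta finite_lessThan lessThan_iff if_True mat_act_X)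
    qed
    also have "mat_op M (unit_fun j) + (\<Sum>i<n. mat_act M [:- M $$ (i, j):] (unit_fun i)) = 0"
    proof
      fix k
      have "(\<Sum>i<n. mat_act M [:- M $$ (i, j):] (unit_fun i)) k = (\<Sum>i<n. - M $$ (i, j) * unit_fun i k)"
        unfolding mat_act_const by (induction n) auto
      also have "\<dots> = (if k < n then - M $$ (k, j) else 0)"
        by (simp add: unit_fun_def if_distrib[of "\<lambda>x. _ * x"] cong: if_cong)
      finally show "(mat_op M (unit_fun j) + (\<Sum>i<n. mat_act M [:- M $$ (i, j):] (unit_fun i))) k = 0 k"
        using j M mat_op_unit_fun[of k M j] by (auto simp: mat_op_def)
    qed
    finally show ?thesis .
  qed
  have adj: "adj_mat X \<in> carrier_mat n n" "X * adj_mat X = det X \<cdot>\<^sub>m 1\<^sub>m n" using adj_mat[OF X] by auto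
  have unit: "mat_act M (char_poly M) (unit_fun l) = 0" if l: "l < n" for l
  proof -
    have entry: "(\<Sum>j<n. X $$ (i, j) * adj_mat X $$ (j, l)) = (if i = l then char_poly M else 0)" if "i < n" for i
    proof -
      have "(X * adj_mat X) $$ (i, l) = (\<Sum>j<n. X $$ (i, j) * adj_mat X $$ (j, l))"
        using that l X adj(1) by (auto simp: scalar_prod_def lessThan_atLeast0)
      then show ?thesis using that l by (auto simp: adj(2) char_poly_def simp flip: X_def)
    qed
    have "mat_act M (char_poly M) (unit_fun l)
        = (\<Sum>i<n. mat_act M (if i = l then char_poly M else 0) (unit_fun i))"
    proof -
      have "(\<Sum>i<n. mat_act M (if i = l then char_poly M else 0) (unit_fun i))
          = (\<Sum>i<n. if i = l then mat_act M (char_poly M) (unit_fun i) else 0)"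
        by (intro sum.cong refl) simp
      then show ?thesis using l by simp
    qed
    also have "\<dots> = (\<Sum>i<n. \<Sum>j<n. mat_act M (adj_mat X $$ (j, l)) (mat_act M (X $$ (i, j)) (unit_fun i)))"
      by (intro sum.cong refl) (simp add: entry[symmetric] scale_sum_left mult.commute)
    also have "\<dots> = (\<Sum>j<n. \<Sum>i<n. mat_act M (adj_mat X $$ (j, l)) (mat_act M (X $$ (i, j)) (unit_fun i)))"
      by (rule sum.swap)
    also have "\<dots> = (\<Sum>j<n. mat_act M (adj_mat X $$ (j, l)) (\<Sum>i<n. mat_act M (X $$ (i, j)) (unit_fun i)))"
      by (simp only: scale_sum_right)
    also have "\<dots> = 0" by (intro sum.neutral) (simp add: col)
    finally show ?thesis .
  qed
  let ?h = "mat_act M (char_poly M)"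
  \<comment> \<open>The action is linear, hence given by a matrix, and this matrix is zero because
    its columns are the images of the unit vectors.\<close>
  have "mat_op (op_mat n ?h) v = ?h v"
  proof (rule mat_op_op_mat)
    show "?h (\<lambda>i. c * x i) = (\<lambda>i. c * ?h x i)" for c x
      using scale_left_commute[of "char_poly M" "[:c:]" x] by (simp only: mat_act_const)
    show "?h x \<in> fvec n" if "x \<in> fvec n" for x using mat_act_in_fvec[OF M that] .
    show "?h (x + y) = ?h x + ?h y" for x y by (rule scale_right_distrib)
  qed (rule v)
  moreover have "op_mat n ?h = 0\<^sub>m n n"
    by (intro eq_matI) (auto simp: op_mat_def unit)
  moreover have "mat_op (0\<^sub>m n n) v = 0" by (auto simp: mat_op_def fun_eq_iff)
  ultimately show ?thesis by simp
qed

section \<open>Evaluation of polynomials at a matrix\<close>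

lemma mat_act_monom:
  fixes M :: "'a::{field,finite} mat"
  assumes M: "M \<in> carrier_mat n n" and v: "v \<in> fvec n"
  shows "mat_act M (monom c k) v = (\<lambda>i. c * mat_op (M ^\<^sub>m k) v i)"
  using v
proof (induction k arbitrary: v)
  case 0
  have "mat_op (M ^\<^sub>m 0) v = v" using M 0 by (simp add: mat_op_one)
  then show ?case by (simp only: monom_0 mat_act_const)
next
  case (Suc k)
  interpret poly_module "mat_act M" by (rule poly_module_mat_act)
  have Mv: "mat_op M v \<in> fvec n" using mat_op_in_fvec[of M v] M by simp
  have "monom c (Suc k) = monom c k * [:0, 1:]" by (simp add: monom_Suc mult.commute)
  then have "mat_act M (monom c (Suc k)) v = mat_act M (monom c k) (mat_op M v)"
    by (metis mat_act_X scale_scale)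
  also have "\<dots> = (\<lambda>i. c * mat_op (M ^\<^sub>m k) (mat_op M v) i)" by (rule Suc.IH[OF Mv])
  also have "mat_op (M ^\<^sub>m k) (mat_op M v) = mat_op (M ^\<^sub>m Suc k) v"
    using mat_op_mult[of "M ^\<^sub>m k" n n M n v] M by simp
  finally show ?case .
qed

lemma sum_fun_apply: "(\<Sum>a\<in>A. f a) x = (\<Sum>a\<in>A. f a x)"
  by (induction A rule: infinite_finite_induct) auto

text \<open>Carries the entrywise notion of annihilation, and with it \<open>min_poly\<close>, over
  to the module action.\<close>

lemma mat_act_eq_0_of_poly_mat:
  fixes M :: "'a::{field,finite} mat"
  assumes M: "M \<in> carrier_mat n n" and v: "v \<in> fvec n" and p: "poly_mat p M = 0\<^sub>m (dim_row M) (dim_row M)"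
  shows "mat_act M p v = 0"
proof
  interpret poly_module "mat_act M" by (rule poly_module_mat_act)
  fix i
  have "mat_act M p v = (\<Sum>k\<le>degree p. mat_act M (monom (coeff p k) k) v)"
    by (metis poly_as_sum_of_monoms scale_sum_left)
  then have "mat_act M p v i = (\<Sum>k\<le>degree p. mat_act M (monom (coeff p k) k) v i)"
    by (simp add: sum_fun_apply)
  also have "\<dots> = (\<Sum>k\<le>degree p. coeff p k * mat_op (M ^\<^sub>m k) v i)"
    by (simp add: mat_act_monom[OF M v])
  also have "\<dots> = 0"
  proof (cases "i < n")
    case True
    have "(\<Sum>k\<le>degree p. coeff p k * mat_op (M ^\<^sub>m k) v i)
        = (\<Sum>k\<le>degree p. \<Sum>j<n. coeff p k * (M ^\<^sub>m k) $$ (i, j) * v j)"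
      using True M by (simp add: mat_op_def sum_distrib_left mult.assoc if_distrib[of lessThan] cong: if_cong)
    also have "\<dots> = (\<Sum>j<n. \<Sum>k\<le>degree p. coeff p k * (M ^\<^sub>m k) $$ (i, j) * v j)" by (rule sum.swap)
    also have "\<dots> = (\<Sum>j<n. (\<Sum>k\<le>degree p. coeff p k * (M ^\<^sub>m k) $$ (i, j)) * v j)"
      by (simp add: sum_distrib_right)
    also have "\<dots> = 0" using p True M poly_mat_eq_0_iff[of p "degree p" M] by (intro sum.neutral) auto
    finally show ?thesis .
  qed (use M in \<open>simp add: mat_op_def\<close>)
  finally show "mat_act M p v i = 0 i" by simp
qed

section \<open>Counting vectors, polynomials and residue tuples\<close>

lemma bij_betw_coeff: 
  assumes "0 < d"
  shows "bij_betw coeff {p :: 'a::zero poly. degree p < d} (fvec d)"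
  unfolding bij_betw_def
proof
  show "inj_on coeff {p :: 'a poly. degree p < d}" by (simp add: inj_on_def coeff_inject)
  show "coeff ` {p :: 'a poly. degree p < d} = fvec d"
  proof
    show "coeff ` {p :: 'a poly. degree p < d} \<subseteq> fvec d" by (auto simp: fvec_def coeff_eq_0)
    show "fvec d \<subseteq> coeff ` {p :: 'a poly. degree p < d}"
    proof
      fix v :: "nat \<Rightarrow> 'a" assume v: "v \<in> fvec d"
      define p where "p = Poly (map v [0..<d])"
      have c: "coeff p = v"
        using v by (auto simp: p_def fun_eq_iff nth_default_def fvec_def)
      have "degree p \<le> d - 1" using v assms by (intro degree_le) (auto simp: c fvec_def)
      then show "v \<in> coeff ` {p. degree p < d}" using c assms by force
    qed
  qed
qed

text \<open>For \<open>d = 0\<close> the set is empty although \<open>CARD('a) ^ 0 = 1\<close>,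
  hence the assumption.\<close>

lemma card_degree_less: "0 < d \<Longrightarrow> card {p :: 'a::{zero,finite} poly. degree p < d} = CARD('a) ^ d"
  using bij_betw_same_card[OF bij_betw_coeff] card_fvec by metis

lemma finite_degree_less: "finite {p :: 'a::{zero,finite} poly. degree p < d}"
proof (cases "0 < d")
  case True
  then show ?thesis using bij_betw_finite[OF bij_betw_coeff[OF True]] finite_fvec by metis
qed auto

lemma card_residue_tuples:
  assumes "\<forall>d\<in>set ds. 0 < degree d"
  shows "card (residue_tuples (ds :: 'a::{zero,finite} poly list)) = CARD('a) ^ sum_list (map degree ds)"
  using assms
proof (induction ds)
  case Nil
  have "residue_tuples ([] :: 'a poly list) = {[]}" by (auto simp: residue_tuples_def)
  then show ?case by simp
next
  case (Cons d ds)
  have eq: "residue_tuples (d # ds) = (\<lambda>(p, ps). p # ps) ` ({p. degree p < degree d} \<times> residue_tuples ds)"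
    by (auto simp: residue_tuples_def list_all2_Cons2)
  have "card (residue_tuples (d # ds)) = card ({p :: 'a poly. degree p < degree d} \<times> residue_tuples ds)"
    unfolding eq by (intro card_image inj_onI) auto
  then show ?case using Cons by (simp add: card_cartesian_product card_degree_less power_add)
qed

lemma (in poly_module) card_cyclic_basis:
  assumes "cyclic_basis W vs ds"
  shows "card W = CARD('a) ^ sum_list (map degree ds)"
proof -
  have "bij_betw (\<lambda>ps. lin act ps vs) (residue_tuples ds) W" "\<forall>d\<in>set ds. 0 < degree d"
    using assms by (auto simp: cyclic_basis_def divisor_chain_def)
  then show ?thesis using bij_betw_same_card card_residue_tuples by metis
qed

section \<open>Commuting pairs\<close>

lemma pow_mat_add:
  assumes "A \<in> carrier_mat n n"
  shows "A ^\<^sub>m (i + j) = A ^\<^sub>m i * (A ^\<^sub>m j :: 'a::semiring_1 mat)"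
proof (induction j)
  case (Suc j)
  then show ?case using assms by (simp add: assoc_mult_mat[of _ n n _ n _ n])
qed (use assms in simp)

text \<open>The powers of \<open>A\<close> are periodic with period \<open>t\<close> from exponent
  \<open>a\<close> on; any positive multiple of \<open>t\<close> that is at least \<open>a\<close>
  is a suitable exponent.\<close>

lemma idempotent_power:
  fixes A :: "'a::{semiring_1,finite} mat"
  assumes A: "A \<in> carrier_mat n n"
  obtains k where "0 < k" "A ^\<^sub>m k * A ^\<^sub>m k = A ^\<^sub>m k"
proof -
  have "range (\<lambda>k. A ^\<^sub>m k) \<subseteq> carrier_mat n n" using A by auto
  then have "finite (range (\<lambda>k. A ^\<^sub>m k))" using finite_carrier_mat finite_subset by blast
  then have "\<not> inj (\<lambda>k. A ^\<^sub>m k)" using finite_imageD by blast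
  then obtain a b where ab: "a < b" "A ^\<^sub>m a = A ^\<^sub>m b" unfolding inj_def by (metis linorder_neqE_nat)
  define t where "t = b - a"
  have per: "A ^\<^sub>m (a + i + t) = A ^\<^sub>m (a + i)" for i
  proof -
    have "a + i + t = b + i" using ab(1) by (simp add: t_def)
    then show ?thesis using pow_mat_add[OF A] ab(2) by metis
  qed
  have per': "A ^\<^sub>m (a + i + s * t) = A ^\<^sub>m (a + i)" for i s
  proof (induction s)
    case (Suc s)
    have "a + i + Suc s * t = a + (i + s * t) + t" by simp
    then show ?case using per[of "i + s * t"] Suc by (simp add: ac_simps)
  qed simp
  \<comment> \<open>The factor \<open>Suc a\<close> instead of \<open>a\<close> keeps
    \<open>k\<close> positive when \<open>a = 0\<close>.\<close>
  define k where "k = Suc a * t"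
  have "0 < t" using ab(1) by (simp add: t_def)
  then have "Suc a * 1 \<le> k" unfolding k_def by (intro mult_le_mono) auto
  then have "a \<le> k" "0 < k" by auto
  then have "A ^\<^sub>m (k + k) = A ^\<^sub>m k" using per'[of "k - a" "Suc a"] by (simp add: k_def)
  then show ?thesis using that \<open>0 < k\<close> pow_mat_add[OF A] by metis
qed

lemma mat_op_add_mat:
  assumes "A \<in> carrier_mat n n" "B \<in> carrier_mat n n"
  shows "mat_op (A + B) v = mat_op A v + mat_op B v"
  using assms by (auto simp: mat_op_def fun_eq_iff algebra_simps sum.distrib)

lemma mat_op_minus_mat:
  fixes A B :: "'a::ring mat"
  assumes "A \<in> carrier_mat n n" "B \<in> carrier_mat n n"
  shows "mat_op (A - B) v = mat_op A v - mat_op B v"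
  using assms by (auto simp: mat_op_def fun_eq_iff algebra_simps sum_subtractf)

lemma mat_op_pow_eigen:
  fixes A :: "'a::comm_ring_1 mat"
  assumes "A \<in> carrier_mat n n" "v \<in> fvec n" "mat_op A v = (\<lambda>i. c * v i)"
  shows "mat_op (A ^\<^sub>m k) v = (\<lambda>i. c ^ k * v i)"
proof (induction k)
  case 0
  then show ?case using assms by (simp add: mat_op_one)
next
  case (Suc k)
  have "mat_op (A ^\<^sub>m Suc k) v = mat_op (A ^\<^sub>m k) (mat_op A v)"
    using mat_op_mult[of "A ^\<^sub>m k" n n A n v] assms(1) by simp
  then show ?case using Suc assms(3) by (simp add: mat_op_scale mult.assoc)
qed

text \<open>Every element of the centralizer algebra is the difference of a unit and an idempotent that
  commute with each other: on the Fitting component where \<open>A\<close> is nilpotent, \<open>A + 1\<close> is a unit.\<close>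

lemma strongly_clean:
  fixes A :: "'a::{field,finite} mat"
  assumes A: "A \<in> carrier_mat n n"
  obtains e where "e \<in> carrier_mat n n" "e * e = e" "A * e = e * A" "A + e \<in> GL n"
    "\<And>M. M \<in> carrier_mat n n \<Longrightarrow> M * A = A * M \<Longrightarrow> M * e = e * M"
proof -
  obtain k where k: "0 < k" "A ^\<^sub>m k * A ^\<^sub>m k = A ^\<^sub>m k" using idempotent_power[OF A] by blast
  \<comment> \<open>The projection onto the Fitting component where \<open>A\<close> is invertible;
    \<open>e\<close> below projects onto the nilpotent one.\<close>
  define h where "h = A ^\<^sub>m k"
  have h: "h \<in> carrier_mat n n" "h * h = h" using A k by (auto simp: h_def)
  define e where "e = 1\<^sub>m n - h"
  have e: "e \<in> carrier_mat n n" using h by (simp add: e_def minus_carrier_mat)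
  have "e * e = 1\<^sub>m n * (1\<^sub>m n - h) - h * (1\<^sub>m n - h)"
    unfolding e_def using h(1) by (subst minus_mult_distrib_mat[of _ n n _ _ n]) auto
  also have "h * (1\<^sub>m n - h) = h * 1\<^sub>m n - h * h"
    using h(1) by (subst mult_minus_distrib_mat[of _ n n _ n]) auto
  also have "1\<^sub>m n * (1\<^sub>m n - h) - (h * 1\<^sub>m n - h * h) = e" using h by (auto simp: e_def)
  finally have ee: "e * e = e" .
  have comm: "M * e = e * M" if M: "M \<in> carrier_mat n n" "M * A = A * M" for M
  proof -
    have "M * A ^\<^sub>m j = A ^\<^sub>m j * M" for j
    proof (induction j)
      case (Suc j)
      have "M * A ^\<^sub>m Suc j = (M * A ^\<^sub>m j) * A" using A M by (simp add: assoc_mult_mat[of _ n n _ n _ n])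
      also have "\<dots> = A ^\<^sub>m j * (M * A)" using Suc A M by (simp add: assoc_mult_mat[of _ n n _ n _ n])
      also have "\<dots> = A ^\<^sub>m Suc j * M" using A M by (simp add: assoc_mult_mat[of _ n n _ n _ n])
      finally show ?case .
    qed (use A M in simp)
    then have "M * h = h * M" by (simp add: h_def)
    then show ?thesis unfolding e_def using h(1) M(1)
      by (simp add: mult_minus_distrib_mat[of _ n n _ n] minus_mult_distrib_mat[of _ n n _ _ n])
  qed
  have "A + e \<in> GL n"
  proof (rule GL_of_inj)
    fix v :: "nat \<Rightarrow> 'a" assume v: "v \<in> fvec n" and 0: "mat_op (A + e) v = 0"
    have sum: "mat_op A v + (v - mat_op h v) = 0"
      using 0 A e h v by (simp add: mat_op_add_mat e_def mat_op_minus_mat[of _ n] mat_op_one)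
    have hh: "mat_op h (mat_op h v) = mat_op h v" using mat_op_mult[OF h(1,1), of v] h(2) by simp
    \<comment> \<open>Applying \<open>h\<close> to the relation \<open>sum\<close> cancels the terms
      in \<open>v\<close> and leaves \<open>h A v = 0\<close>. Since \<open>h = h * h\<close> is a
      multiple of \<open>h * A\<close>, also \<open>h v = 0\<close>.\<close>
    have "mat_op h v = mat_op h (mat_op A v + (v - mat_op h v)) - mat_op h (mat_op A v) + mat_op h (mat_op h v)"
    proof -
      have "mat_op h (v - mat_op h v + mat_op h v) = mat_op h (v - mat_op h v) + mat_op h (mat_op h v)"
        by (rule mat_op_add)
      then show ?thesis by (simp add: mat_op_add)
    qed
    then have hA: "mat_op h (mat_op A v) = 0" using sum hh by simp
    obtain l where l: "k = Suc l" using k(1) by (cases k) auto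
    have "h * h = A ^\<^sub>m l * (h * A)"
    proof -
      have "h * h = A ^\<^sub>m (l + (k + 1))" unfolding h_def using pow_mat_add[OF A, of k k] l by simp
      also have "\<dots> = A ^\<^sub>m l * (h * A)" unfolding h_def using pow_mat_add[OF A, of l "k + 1"] A by simp
      finally show ?thesis .
    qed
    then have "mat_op h v = mat_op (A ^\<^sub>m l * (h * A)) v" using h(2) by simp
    also have "\<dots> = mat_op (A ^\<^sub>m l) (mat_op h (mat_op A v))"
      using mat_op_mult[of "A ^\<^sub>m l" n n "h * A" n v] mat_op_mult[OF h(1) A, of v] A h(1) by simp
    also have "\<dots> = 0" by (simp add: hA)
    finally have hv: "mat_op h v = 0" .
    \<comment> \<open>So \<open>v\<close> is an eigenvector of \<open>A\<close> for
      \<open>-1\<close>, and \<open>h\<close>, a power of \<open>A\<close>, acts on it by a sign;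
      but \<open>h v = 0\<close>.\<close>
    then have "mat_op A v = (\<lambda>i. - 1 * v i)" using sum by (auto simp: fun_eq_iff add_eq_0_iff)
    then have "mat_op h v = (\<lambda>i. (- 1) ^ k * v i)" unfolding h_def by (rule mat_op_pow_eigen[OF A v])
    then show "v = 0" using hv by (auto simp: fun_eq_iff)
  qed (use A e in simp)
  then show ?thesis using that[OF e ee] comm[OF A] comm by blast
qed

section \<open>Conjugacy classes of pairs of a matrix and a commuting idempotent\<close>

definition eig1 :: "nat \<Rightarrow> 'a::semiring_1 mat \<Rightarrow> (nat \<Rightarrow> 'a) set" where
  "eig1 n e = {v \<in> fvec n. mat_op e v = v}"

definition eig0 :: "nat \<Rightarrow> 'a::semiring_1 mat \<Rightarrow> (nat \<Rightarrow> 'a) set" where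
  "eig0 n e = {v \<in> fvec n. mat_op e v = 0}"

lemma mat_op_intertwine:
  fixes M N g :: "'a::{field,finite} mat"
  assumes "M \<in> carrier_mat n n" "N \<in> carrier_mat n n" "g \<in> carrier_mat n n" "g * M = N * g"
  shows "mat_op g (mat_act M p v) = mat_act N p (mat_op g v)"
proof (induction p)
  case (pCons a p)
  have "mat_op g (mat_op M w) = mat_op N (mat_op g w)" for w
    using assms mat_op_mult by metis
  then show ?case using pCons by (simp add: mat_op_add mat_op_add_fun mat_op_scale)
next
  case 0
  then show ?case by (simp only: mat_act_0 mat_op_zero)
qed

lemma mat_op_mat_act:
  fixes M e :: "'a::{field,finite} mat"
  assumes "M \<in> carrier_mat n n" "e \<in> carrier_mat n n" "M * e = e * M"
  shows "mat_op e (mat_act M p v) = mat_act M p (mat_op e v)"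
  using assms by (intro mat_op_intertwine) auto

lemma subspace_eig:
  fixes M e :: "'a::{field,finite} mat"
  assumes "M \<in> carrier_mat n n" "e \<in> carrier_mat n n" "M * e = e * M"
  shows "Modules.module.subspace (mat_act M) (eig1 n e)" "Modules.module.subspace (mat_act M) (eig0 n e)"
proof -
  interpret poly_module "mat_act M" by (rule poly_module_mat_act)
  note fv = subspace_fvec[OF assms(1)]
  show "subspace (eig1 n e)"
    by (rule subspaceI)
       (auto simp: eig1_def mat_op_add mat_op_mat_act[OF assms] intro: subspace_0[OF fv] subspace_add[OF fv] subspace_scale[OF fv])
  show "subspace (eig0 n e)"
    by (rule subspaceI)
       (auto simp: eig0_def mat_op_add mat_op_mat_act[OF assms] intro: subspace_0[OF fv] subspace_add[OF fv] subspace_scale[OF fv])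
qed

text \<open>The candidates for invariant factors of submodules. The total degree is only bounded by
  \<open>n\<close>, because the image and the kernel of an idempotent may be smaller than the whole
  space.\<close>

definition divisor_chains :: "'a::field poly \<Rightarrow> nat \<Rightarrow> 'a poly list set" where
  "divisor_chains f n = {ds. divisor_chain ds \<and> (\<forall>d\<in>set ds. d dvd f) \<and> sum_list (map degree ds) \<le> n}"

text \<open>The divisibility by the characteristic polynomial comes from Cayley-Hamilton, the bound
  on the degrees from comparing cardinalities.\<close>

lemma cyclic_basis_in_chains:
  fixes M :: "'a::{field,finite} mat"
  assumes M: "M \<in> carrier_mat n n" and cb: "poly_module.cyclic_basis (mat_act M) W vs ds" and W: "W \<subseteq> fvec n"
  shows "ds \<in> divisor_chains (char_poly M) n"
proof -
  interpret poly_module "mat_act M" by (rule poly_module_mat_act)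
  have "d dvd char_poly M" if d: "d \<in> set ds" for d
  proof -
    obtain i where i: "i < length ds" "d = ds ! i" using d by (metis in_set_conv_nth)
    have "vs ! i \<in> fvec n" using cb i W by (auto simp: cyclic_basis_def list_all2_conv_all_nth)
    then show ?thesis using cyclic_basis_dvd[OF cb i(1)] cayley_hamilton[OF M] i by blast
  qed
  moreover have "CARD('a) ^ sum_list (map degree ds) \<le> CARD('a) ^ n"
    using card_mono[OF finite_fvec W] card_cyclic_basis[OF cb] card_fvec by metis
  moreover have "1 < CARD('a)"
    using card_mono[of "UNIV :: 'a set" "{0, 1}"] by simp
  ultimately show ?thesis using cb by (simp add: divisor_chains_def cyclic_basis_def)
qed

text \<open>The isomorphism type of the pair: invariant factors of \<open>M\<close> on
  \<open>eig1\<close>, which is the image of an idempotent \<open>e\<close>, and on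
  \<open>eig0\<close>, its kernel.\<close>

definition has_type :: "nat \<Rightarrow> 'a::{field,finite} mat \<Rightarrow> 'a mat \<Rightarrow> 'a poly list \<times> 'a poly list \<Rightarrow> bool" where
  "has_type n M e t \<longleftrightarrow>
     (\<exists>vs. poly_module.cyclic_basis (mat_act M) (eig1 n e) vs (fst t)) \<and>
     (\<exists>vs. poly_module.cyclic_basis (mat_act M) (eig0 n e) vs (snd t))"

lemma has_type_exists:
  fixes M e :: "'a::{field,finite} mat"
  assumes "M \<in> carrier_mat n n" "e \<in> carrier_mat n n" "M * e = e * M"
  obtains t where "t \<in> divisor_chains (char_poly M) n \<times> divisor_chains (char_poly M) n" "has_type n M e t"
proof -
  interpret poly_module "mat_act M" by (rule poly_module_mat_act)
  have sub: "eig1 n e \<subseteq> fvec n" "eig0 n e \<subseteq> fvec n" by (auto simp: eig1_def eig0_def)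
  then have "finite (eig1 n e)" "finite (eig0 n e)" using finite_fvec finite_subset by blast+
  then obtain vs ds ws cs where cb: "cyclic_basis (eig1 n e) vs ds" "cyclic_basis (eig0 n e) ws cs"
    using cyclic_basis_exists subspace_eig[OF assms] by metis
  then have "has_type n M e (ds, cs)" by (auto simp: has_type_def)
  moreover have "(ds, cs) \<in> divisor_chains (char_poly M) n \<times> divisor_chains (char_poly M) n"
    using cyclic_basis_in_chains[OF assms(1)] cb sub by blast
  ultimately show ?thesis using that by blast
qed

text \<open>Isomorphisms between the images and between the kernels of the two idempotents are glued
  to one invertible matrix intertwining both members of the pairs.\<close>

lemma has_type_conjugate:
  fixes M e M' e' :: "'a::{field,finite} mat"
  assumes M: "M \<in> carrier_mat n n" "e \<in> carrier_mat n n" "M * e = e * M" "e * e = e"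
    and M': "M' \<in> carrier_mat n n" "e' \<in> carrier_mat n n" "M' * e' = e' * M'" "e' * e' = e'"
    and t: "has_type n M e t" "has_type n M' e' t"
  obtains g where "g \<in> GL n" "g * M = M' * g" "g * e = e' * g"
proof -
  have mod: "poly_module (mat_act M)" "poly_module (mat_act M')" by (rule poly_module_mat_act)+
  interpret A: poly_module "mat_act M" by fact
  interpret B: poly_module "mat_act M'" by fact
  let ?V1 = "eig1 n e" and ?V0 = "eig0 n e" and ?U1 = "eig1 n e'" and ?U0 = "eig0 n e'"
  obtain h where h: "\<And>x y. x \<in> ?V1 \<Longrightarrow> y \<in> ?V1 \<Longrightarrow> h (x + y) = h x + h y"
      "\<And>p x. x \<in> ?V1 \<Longrightarrow> h (mat_act M p x) = mat_act M' p (h x)" "bij_betw h ?V1 ?U1"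
    using cyclic_iso[OF mod] t unfolding has_type_def by metis
  obtain k where k: "\<And>x y. x \<in> ?V0 \<Longrightarrow> y \<in> ?V0 \<Longrightarrow> k (x + y) = k x + k y"
      "\<And>p x. x \<in> ?V0 \<Longrightarrow> k (mat_act M p x) = mat_act M' p (k x)" "bij_betw k ?V0 ?U0"
    using cyclic_iso[OF mod] t unfolding has_type_def by metis
  note V1 = subspace_eig(1)[OF M(1-3)] and V0 = subspace_eig(2)[OF M(1-3)]
  note U1 = subspace_eig(1)[OF M'(1-3)] and U0 = subspace_eig(2)[OF M'(1-3)]
  have h0: "h 0 = 0" and k0: "k 0 = 0"
    using h(1)[of 0 0] k(1)[of 0 0] A.subspace_0[OF V1] A.subspace_0[OF V0] by simp_all
  have eV: "mat_op e x \<in> fvec n" for x using mat_op_in_fvec[of e x] M by simp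
  have ee: "mat_op e (mat_op e x) = mat_op e x" for x using mat_op_mult[OF M(2,2)] M(4) by metis
  have p1: "mat_op e x \<in> ?V1" for x using eV ee by (simp add: eig1_def)
  have ediff: "mat_op e (x - y) = mat_op e x - mat_op e y" for x y
    using mat_op_add[of e "x - y" y] by (simp add: algebra_simps)
  have p0: "x - mat_op e x \<in> ?V0" if "x \<in> fvec n" for x
    using that eV[of x] ee[of x] ediff by (auto simp: eig0_def fvec_def)
  \<comment> \<open>Every vector splits as \<open>e x\<close> plus \<open>x - e x\<close>, with
    \<open>h\<close> responsible for the first part and \<open>k\<close> for the second.\<close>
  define g where "g x = h (mat_op e x) + k (x - mat_op e x)" for x
  have hU: "h x \<in> ?U1" if "x \<in> ?V1" for x using h(3) that by (auto simp: bij_betw_def)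
  have kU: "k x \<in> ?U0" if "x \<in> ?V0" for x using k(3) that by (auto simp: bij_betw_def)
  have add: "g (x + y) = g x + g y" if xy: "x \<in> fvec n" "y \<in> fvec n" for x y
  proof -
    have "(x + y) - mat_op e (x + y) = (x - mat_op e x) + (y - mat_op e y)" by (simp add: mat_op_add)
    then have "k ((x + y) - mat_op e (x + y)) = k (x - mat_op e x) + k (y - mat_op e y)"
      using k(1)[OF p0[OF xy(1)] p0[OF xy(2)]] by (simp only:)
    moreover have "h (mat_op e (x + y)) = h (mat_op e x) + h (mat_op e y)"
      using h(1)[OF p1[of x] p1[of y]] by (simp only: mat_op_add)
    ultimately show ?thesis by (simp only: g_def) (simp add: algebra_simps)
  qed
  have act: "g (mat_act M p x) = mat_act M' p (g x)" if x: "x \<in> fvec n" for p x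
  proof -
    have "mat_op e (mat_act M p x) = mat_act M p (mat_op e x)" by (rule mat_op_mat_act[OF M(1-3)])
    moreover have "mat_act M p x - mat_act M p (mat_op e x) = mat_act M p (x - mat_op e x)"
      by (simp add: A.scale_right_diff_distrib)
    ultimately show ?thesis using h(2)[OF p1, of p x] k(2)[OF p0[OF x], of p] by (simp add: g_def B.scale_right_distrib)
  qed
  have closed: "g x \<in> fvec n" if x: "x \<in> fvec n" for x
    using hU[OF p1, of x] kU[OF p0[OF x]] by (auto simp: g_def eig1_def eig0_def fvec_def)
  have scale: "g (\<lambda>i. c * x i) = (\<lambda>i. c * g x i)" if x: "x \<in> fvec n" for c x
    using act[OF x, of "[:c:]"] by (simp only: mat_act_const)
  define G where "G = op_mat n g"
  have G: "G \<in> carrier_mat n n" by (simp add: G_def)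
  have Gop: "mat_op G x = g x" if "x \<in> fvec n" for x
    unfolding G_def using mat_op_op_mat[of n g, OF add scale closed that] by blast
  have e'g: "mat_op e' (g x) = h (mat_op e x)" if x: "x \<in> fvec n" for x
    using hU[OF p1, of x] kU[OF p0[OF x]] by (simp add: g_def mat_op_add eig1_def eig0_def)
  have "G \<in> GL n"
  proof (rule GL_of_inj[OF G])
    fix v :: "nat \<Rightarrow> 'a" assume v: "v \<in> fvec n" "mat_op G v = 0"
    then have gv: "g v = 0" using Gop by simp
    then have hv: "h (mat_op e v) = 0" using e'g[OF v(1)] by simp
    then have "mat_op e v = 0"
      using inj_onD[OF bij_betw_imp_inj_on[OF h(3)], of "mat_op e v" 0] h0 p1 A.subspace_0[OF V1] by simp
    moreover have "k (v - mat_op e v) = 0" using gv hv by (simp add: g_def)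
    then have "v - mat_op e v = 0"
      using inj_onD[OF bij_betw_imp_inj_on[OF k(3)], of "v - mat_op e v" 0] k0 p0[OF v(1)] A.subspace_0[OF V0] by simp
    ultimately show "v = 0" by simp
  qed
  moreover have "G * M = M' * G"
  proof (rule mat_op_ext)
    fix v :: "nat \<Rightarrow> 'a" assume v: "v \<in> fvec n"
    have "mat_op (G * M) v = g (mat_op M v)"
      using mat_op_mult[OF G M(1)] Gop mat_op_in_fvec[of M v] M(1) by auto
    also have "\<dots> = mat_op M' (g v)" using act[OF v, of "[:0, 1:]"] by (simp only: mat_act_X)
    also have "\<dots> = mat_op (M' * G) v" using mat_op_mult[OF M'(1) G] Gop v by simp
    finally show "mat_op (G * M) v = mat_op (M' * G) v" .
  qed (use G M M' in auto)
  moreover have "G * e = e' * G"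
  proof (rule mat_op_ext)
    fix v :: "nat \<Rightarrow> 'a" assume v: "v \<in> fvec n"
    have "mat_op (G * e) v = g (mat_op e v)"
      using mat_op_mult[OF G M(2)] Gop eV by simp
    also have "\<dots> = h (mat_op e v)" by (simp add: g_def ee k0)
    also have "\<dots> = mat_op (e' * G) v" using mat_op_mult[OF M'(2) G] Gop v e'g by simp
    finally show "mat_op (G * e) v = mat_op (e' * G) v" .
  qed (use G M M' in auto)
  ultimately show ?thesis using that by blast
qed

text \<open>A pair \<open>(M, A)\<close> is encoded by the type of \<open>(M, E A)\<close> and one
  invertible matrix: the unit \<open>A + E A\<close> times a conjugator from a fixed representative
  of that type. The type supplies the representative, conjugation by the matrix recovers
  \<open>M\<close> and \<open>E A\<close>, and then the conjugator can be cancelled to recover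
  \<open>A\<close>.\<close>

lemma card_commuting_pairs:
  fixes f :: "'a::{field,finite} poly"
  assumes fin: "finite (divisor_chains f n)"
  shows "card {(M, A). M \<in> carrier_mat n n \<and> A \<in> carrier_mat n n \<and> M * A = A * M \<and> char_poly M = f}
    \<le> card (GL n :: 'a mat set) * (card (divisor_chains f n))\<^sup>2"
proof -
  let ?S = "{(M, A). M \<in> carrier_mat n n \<and> A \<in> carrier_mat n n \<and> M * A = A * M \<and> char_poly M = f}"
  define ok where "ok M e \<longleftrightarrow> M \<in> carrier_mat n n \<and> e \<in> carrier_mat n n \<and> M * e = e * M \<and> e * e = e \<and> char_poly M = f"
    for M e :: "'a mat"
  have "\<exists>t. t \<in> divisor_chains f n \<times> divisor_chains f n \<and> has_type n M e t" if "ok M e" for M e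
    using that has_type_exists unfolding ok_def by metis
  then obtain \<tau> where \<tau>: "\<And>M e. ok M e \<Longrightarrow> \<tau> M e \<in> divisor_chains f n \<times> divisor_chains f n \<and> has_type n M e (\<tau> M e)" by metis
  \<comment> \<open>A representative pair for each type; its value matters only for types that
    occur.\<close>
  define R where "R t = (SOME (M, e). ok M e \<and> \<tau> M e = t)" for t
  have R: "ok (fst (R t)) (snd (R t)) \<and> \<tau> (fst (R t)) (snd (R t)) = t" if "ok M e" "\<tau> M e = t" for M e t
  proof -
    have "\<exists>z. case z of (M, e) \<Rightarrow> ok M e \<and> \<tau> M e = t" using that by auto
    then have "case R t of (M, e) \<Rightarrow> ok M e \<and> \<tau> M e = t" unfolding R_def by (rule someI_ex)
    then show ?thesis by (simp add: case_prod_beta)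
  qed
  have "\<exists>g. g \<in> GL n \<and> g * fst (R (\<tau> M e)) = M * g \<and> g * snd (R (\<tau> M e)) = e * g" if okM: "ok M e" for M e
  proof -
    let ?N = "fst (R (\<tau> M e))" and ?d = "snd (R (\<tau> M e))"
    have "ok ?N ?d" "\<tau> ?N ?d = \<tau> M e" using R[OF okM refl] by auto
    then have "has_type n ?N ?d (\<tau> M e)" "has_type n M e (\<tau> M e)" using \<tau> okM by metis+
    then show ?thesis using has_type_conjugate \<open>ok ?N ?d\<close> okM unfolding ok_def by metis
  qed
  then obtain g where g: "\<And>M e. ok M e \<Longrightarrow>
      g M e \<in> GL n \<and> g M e * fst (R (\<tau> M e)) = M * g M e \<and> g M e * snd (R (\<tau> M e)) = e * g M e" by metis
  have "\<exists>e. e \<in> carrier_mat n n \<and> e * e = e \<and> A * e = e * A \<and> A + e \<in> GL n \<and>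
      (\<forall>M. M \<in> carrier_mat n n \<longrightarrow> M * A = A * M \<longrightarrow> M * e = e * M)" if "A \<in> carrier_mat n n" for A :: "'a mat"
    using strongly_clean[OF that] by metis
  then obtain E where E: "\<And>A :: 'a mat. A \<in> carrier_mat n n \<Longrightarrow>
      E A \<in> carrier_mat n n \<and> E A * E A = E A \<and> A * E A = E A * A \<and> A + E A \<in> GL n \<and>
      (\<forall>M. M \<in> carrier_mat n n \<longrightarrow> M * A = A * M \<longrightarrow> M * E A = E A * M)" by metis
  define \<Phi> where "\<Phi> = (\<lambda>(M, A). (\<tau> M (E A), (A + E A) * g M (E A)))"
  have okS: "ok M (E A)" if "(M, A) \<in> ?S" for M A using that E[of A] by (simp add: ok_def)
  \<comment> \<open>The unit commutes with \<open>M\<close> and with \<open>E A\<close>, so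
    multiplying the conjugator by it yields another conjugator from the same representative.\<close>
  have conj: "(A + E A) * g M (E A) \<in> GL n"
      "M * ((A + E A) * g M (E A)) = ((A + E A) * g M (E A)) * fst (R (\<tau> M (E A)))"
      "E A * ((A + E A) * g M (E A)) = ((A + E A) * g M (E A)) * snd (R (\<tau> M (E A)))"
    if MA: "(M, A) \<in> ?S" for M A
  proof -
    have c: "M \<in> carrier_mat n n" "A \<in> carrier_mat n n" "M * A = A * M" using MA by auto
    note EA = E[OF c(2)]
    have ok: "ok M (E A)" using MA by (rule okS)
    note gg = g[OF ok]
    have g': "g M (E A) \<in> carrier_mat n n" using gg GL_carrier by blast
    have N: "fst (R (\<tau> M (E A))) \<in> carrier_mat n n" "snd (R (\<tau> M (E A))) \<in> carrier_mat n n"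
      using R[OF ok refl] by (auto simp: ok_def)
    have u: "A + E A \<in> carrier_mat n n" using EA c by simp
    show "(A + E A) * g M (E A) \<in> GL n" using GL_mult EA gg by blast
    have "M * E A = E A * M" using EA c by blast
    then have Mu: "M * (A + E A) = (A + E A) * M"
      using c EA by (simp add: mult_add_distrib_mat[of _ n n _ n] add_mult_distrib_mat[of _ n n _ _ n])
    have eu: "E A * (A + E A) = (A + E A) * E A"
      using c EA by (simp add: mult_add_distrib_mat[of _ n n _ n] add_mult_distrib_mat[of _ n n _ _ n])
    have "M * ((A + E A) * g M (E A)) = (M * (A + E A)) * g M (E A)"
      using c(1) u g' by (simp add: assoc_mult_mat[of _ n n _ n _ n])
    also have "\<dots> = (A + E A) * (M * g M (E A))"
      unfolding Mu using c(1) u g' by (simp add: assoc_mult_mat[of _ n n _ n _ n])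
    also have "\<dots> = ((A + E A) * g M (E A)) * fst (R (\<tau> M (E A)))"
      using gg u g' N by (metis assoc_mult_mat)
    finally show "M * ((A + E A) * g M (E A)) = ((A + E A) * g M (E A)) * fst (R (\<tau> M (E A)))" .
    have "E A * ((A + E A) * g M (E A)) = (E A * (A + E A)) * g M (E A)"
      using EA u g' by (simp add: assoc_mult_mat[of _ n n _ n _ n])
    also have "\<dots> = (A + E A) * (E A * g M (E A))"
      unfolding eu using EA u g' by (simp add: assoc_mult_mat[of _ n n _ n _ n])
    also have "\<dots> = ((A + E A) * g M (E A)) * snd (R (\<tau> M (E A)))"
      using gg u g' N by (metis assoc_mult_mat)
    finally show "E A * ((A + E A) * g M (E A)) = ((A + E A) * g M (E A)) * snd (R (\<tau> M (E A)))" .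
  qed
  have "inj_on \<Phi> ?S"
  proof (rule inj_onI, clarify)
    fix M A M' A'
    assume c: "M \<in> carrier_mat n n" "A \<in> carrier_mat n n" "M * A = A * M" "f = char_poly M"
      and c': "M' \<in> carrier_mat n n" "A' \<in> carrier_mat n n" "M' * A' = A' * M'" "char_poly M' = char_poly M"
      and eq: "\<Phi> (M, A) = \<Phi> (M', A')"
    have S: "(M, A) \<in> ?S" "(M', A') \<in> ?S" using c c' by auto
    define Q where "Q = (A + E A) * g M (E A)"
    have Q': "Q = (A' + E A') * g M' (E A')" and t: "\<tau> M (E A) = \<tau> M' (E A')"
      using eq by (auto simp: \<Phi>_def Q_def)
    note C = conj[OF S(1), folded Q_def] and C' = conj[OF S(2), folded Q', folded t]
    \<comment> \<open>Both matrices satisfy \<open>M * Q = Q * N\<close> with the same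
      \<open>Q\<close> and the same representative \<open>N\<close>.\<close>
    have M: "M = M'" using GL_cancel[OF C(1) c(1) c'(1)] C(2) C'(2) by simp
    have e: "E A = E A'" using GL_cancel[OF C(1), of "E A" "E A'"] E c c' C(3) C'(3) by simp
    have "g M (E A) \<in> GL n" using g okS[OF S(1)] by blast
    moreover have "A + E A \<in> carrier_mat n n" "A' + E A' \<in> carrier_mat n n" using c c' E by simp_all
    moreover have "(A + E A) * g M (E A) = (A' + E A') * g M (E A)" using Q' M e by (simp add: Q_def)
    ultimately have u: "A + E A = A' + E A'" by (rule GL_cancel)
    have "A = A'"
    proof (rule eq_matI)
      fix i j assume ij: "i < dim_row A'" "j < dim_col A'"
      have "E A' \<in> carrier_mat n n" using E c'(2) by blast
      then have "(B + E A') $$ (i, j) = B $$ (i, j) + E A' $$ (i, j)" for B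
        using ij c'(2) by (intro index_add_mat) auto
      then show "A $$ (i, j) = A' $$ (i, j)" using u e by (metis add_right_cancel)
    qed (use c c' in auto)
    then show "M = M' \<and> A = A'" using M by simp
  qed
  moreover have "\<Phi> ` ?S \<subseteq> (divisor_chains f n \<times> divisor_chains f n) \<times> GL n"
  proof (rule image_subsetI)
    fix z assume z: "z \<in> ?S"
    obtain M A where MA: "z = (M, A)" by (cases z)
    show "\<Phi> z \<in> (divisor_chains f n \<times> divisor_chains f n) \<times> GL n"
      using \<tau>[OF okS] conj(1) z unfolding MA \<Phi>_def by simp
  qed
  moreover have "finite ((divisor_chains f n \<times> divisor_chains f n) \<times> (GL n :: 'a mat set))" using fin finite_GL by blast
  ultimately have "card ?S \<le> card ((divisor_chains f n \<times> divisor_chains f n) \<times> (GL n :: 'a mat set))" by (rule card_inj_on_le)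
  then show ?thesis by (simp add: card_cartesian_product power2_eq_square mult.commute)
qed

section \<open>Invariant forms and centralizers\<close>

text \<open>The whole commuting algebra, singular matrices included; its members complete
  \<open>M\<close> to the commuting pairs counted above.\<close>

definition centralizer :: "nat \<Rightarrow> 'a::semiring_0 mat \<Rightarrow> 'a mat set" where
  "centralizer n M = {A \<in> carrier_mat n n. M * A = A * M}"

text \<open>Degenerate forms are included, which makes this set closed under differences.\<close>

definition invariant_forms :: "nat \<Rightarrow> 'a::semiring_0 mat \<Rightarrow> 'a mat set" where
  "invariant_forms n M =
     {L \<in> carrier_mat n n. transpose_mat L = L \<and> transpose_mat M * L * M = L}"

lemma finite_centralizer: "finite (centralizer n M :: 'a::{semiring_0,finite} mat set)"
  by (rule finite_subset[OF _ finite_carrier_mat[of n n]]) (auto simp: centralizer_def)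

lemma finite_invariant_forms: "finite (invariant_forms n M :: 'a::{semiring_0,finite} mat set)"
  by (rule finite_subset[OF _ finite_carrier_mat[of n n]]) (auto simp: invariant_forms_def)

text \<open>An endomorphism may send the generator \<open>vs ! j\<close> to any vector killed by
  \<open>ds ! j\<close>. In the summand \<open>i\<close> such vectors form a space of dimension
  \<open>degree (ds ! max i j)\<close>, the later entry of the chain being the smaller one.\<close>

lemma card_centralizer_ge:
  fixes M :: "'a::{field,finite} mat"
  assumes M: "M \<in> carrier_mat n n" and cb: "poly_module.cyclic_basis (mat_act M) (fvec n) vs ds"
  shows "CARD('a) ^ (\<Sum>i<length ds. \<Sum>j<length ds. degree (ds ! max i j)) \<le> card (centralizer n M)"
proof -
  interpret poly_module "mat_act M" by (rule poly_module_mat_act)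
  define r where "r = length ds"
  have len: "length vs = r" and vsV: "\<And>i. i < r \<Longrightarrow> vs ! i \<in> fvec n"
    and ann: "\<And>i. i < r \<Longrightarrow> mat_act M (ds ! i) (vs ! i) = 0"
    and bij: "bij_betw (\<lambda>ps. lin (mat_act M) ps vs) (residue_tuples ds) (fvec n)"
    and deg: "\<And>i. i < r \<Longrightarrow> 0 < degree (ds ! i)"
    and dvd: "\<And>i j. i < j \<Longrightarrow> j < r \<Longrightarrow> ds ! j dvd ds ! i"
    using cb by (auto simp: cyclic_basis_def divisor_chain_def list_all2_conv_all_nth r_def sorted_wrt_iff_nth_less)
  \<comment> \<open>Generates the part of \<open>F[x]/(ds ! i)\<close> killed by
    \<open>ds ! j\<close>: the cofactor if \<open>ds ! j\<close> is the later entry, and everything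
    otherwise.\<close>
  define c where "c i j = (if i \<le> j then ds ! i div ds ! j else 1)" for i j
  have nz: "ds ! i \<noteq> 0" if "i < r" for i using deg[OF that] by auto
  have dvd': "ds ! j dvd ds ! i" if "i \<le> j" "j < r" for i j using dvd[of i j] that by (cases "i = j") auto
  have cdvd: "ds ! i dvd ds ! j * c i j" and cdeg: "degree p < degree (ds ! max i j) \<Longrightarrow> degree (c i j * p) < degree (ds ! i)"
    and cnz: "c i j \<noteq> 0" if ij: "i < r" "j < r" for i j p
  proof -
    have "ds ! i dvd ds ! j * c i j \<and> (degree p < degree (ds ! max i j) \<longrightarrow> degree (c i j * p) < degree (ds ! i)) \<and> c i j \<noteq> 0"
    proof (cases "i \<le> j")
      case True
      have eq: "ds ! i = ds ! j * c i j" using dvd'[OF True ij(2)] True by (simp add: c_def)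
      then have c0: "c i j \<noteq> 0" using nz[OF ij(1)] by auto
      then have "degree (ds ! i) = degree (ds ! j) + degree (c i j)" using eq nz[OF ij(2)] degree_mult_eq by metis
      moreover have "degree (c i j * p) \<le> degree (c i j) + degree p" by (rule degree_mult_le)
      ultimately show ?thesis using eq c0 True by (auto simp: max_def)
    next
      case False
      then show ?thesis using dvd'[of j i] ij by (simp add: c_def max_def)
    qed
    then show "ds ! i dvd ds ! j * c i j" "degree p < degree (ds ! max i j) \<Longrightarrow> degree (c i j * p) < degree (ds ! i)" "c i j \<noteq> 0"
      by auto
  qed
  \<comment> \<open>A member of \<open>I\<close> lists, for every \<open>j\<close>, the multipliers
    of \<open>c i j\<close> in the image of \<open>vs ! j\<close>.\<close>
  define I where "I = PiE ({..<r} \<times> {..<r}) (\<lambda>(i, j). {p :: 'a poly. degree p < degree (ds ! max i j)})"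
  define cs where "cs Q j = map (\<lambda>i. c i j * Q (i, j)) [0..<r]" for Q :: "nat \<times> nat \<Rightarrow> 'a poly" and j
  define w where "w Q j = lin (mat_act M) (cs Q j) vs" for Q j
  note fv = subspace_fvec[OF M]
  have lincl: "lin (mat_act M) ps us \<in> fvec n" if "length ps = length us" "\<And>i. i < length us \<Longrightarrow> us ! i \<in> fvec n" for ps us
    using that by (auto simp: lin_eq_sum intro!: subspace_sum[OF fv] subspace_scale[OF fv])
  have "\<exists>A. A \<in> centralizer n M \<and> (\<forall>j<r. mat_op A (vs ! j) = w Q j)" for Q
  proof -
    define ws where "ws = map (w Q) [0..<r]"
    have wann: "mat_act M (ds ! j) (w Q j) = 0" if j: "j < r" for j
    proof -
      have "mat_act M (ds ! j) (mat_act M (c i j * Q (i, j)) (vs ! i)) = 0" if i: "i < r" for i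
      proof -
        obtain k where "ds ! j * c i j = ds ! i * k" using cdvd[OF i j] by blast
        then have "ds ! j * (c i j * Q (i, j)) = (k * Q (i, j)) * ds ! i" by (simp add: ac_simps)
        then have "mat_act M (ds ! j) (mat_act M (c i j * Q (i, j)) (vs ! i)) = mat_act M (k * Q (i, j)) (mat_act M (ds ! i) (vs ! i))"
          by (metis scale_scale)
        then show ?thesis using ann[OF i] by simp
      qed
      then show ?thesis
        by (simp add: w_def cs_def lin_eq_sum len scale_sum_right del: scale_scale)
    qed
    have "list_all2 (\<lambda>w d. mat_act M d w = 0) ws ds"
      using wann by (simp add: list_all2_conv_all_nth ws_def r_def)
    from cyclic_hom[OF poly_module_axioms poly_module_axioms cb this]
    obtain h where hadd: "\<And>x y. x \<in> fvec n \<Longrightarrow> y \<in> fvec n \<Longrightarrow> h (x + y) = h x + h y"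
      and hact: "\<And>p x. x \<in> fvec n \<Longrightarrow> h (mat_act M p x) = mat_act M p (h x)"
      and hlin: "\<And>ps. length ps = length ds \<Longrightarrow> h (lin (mat_act M) ps vs) = lin (mat_act M) ps ws" by metis
    have hcl: "h x \<in> fvec n" if x: "x \<in> fvec n" for x
    proof -
      obtain ps where ps: "ps \<in> residue_tuples ds" "x = lin (mat_act M) ps vs"
        using x unfolding bij_betw_imp_surj_on[OF bij, symmetric] by blast
      then have l: "length ps = length ds" by (auto simp: residue_tuples_def list_all2_lengthD)
      have "w Q i \<in> fvec n" for i
        unfolding w_def using vsV len by (intro lincl) (auto simp: cs_def)
      then have "ws ! i \<in> fvec n" if "i < r" for i using that by (simp add: ws_def)
      then show ?thesis using hlin[OF l] ps(2) l lincl[of ps ws] by (simp add: ws_def r_def)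
    qed
    define A where "A = op_mat n h"
    have Aop: "mat_op A x = h x" if "x \<in> fvec n" for x
      unfolding A_def
    proof (rule mat_op_op_mat)
      show "h (\<lambda>i. c * x i) = (\<lambda>i. c * h x i)" if "x \<in> fvec n" for c x
        using hact[OF that, of "[:c:]"] by (simp only: mat_act_const)
    qed (use hadd hcl that in auto)
    have "M * A = A * M"
    proof (rule mat_op_ext)
      fix x :: "nat \<Rightarrow> 'a" assume x: "x \<in> fvec n"
      have "mat_op (A * M) x = h (mat_op M x)"
        using mat_op_mult[of A n n M n x] M Aop mat_op_in_fvec[of M x] by (auto simp: A_def)
      also have "\<dots> = mat_op M (h x)" using hact[OF x, of "[:0, 1:]"] by (simp only: mat_act_X)
      also have "\<dots> = mat_op (M * A) x" using mat_op_mult[of M n n A n x] M Aop[OF x] by (simp add: A_def)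
      finally show "mat_op (M * A) x = mat_op (A * M) x" by simp
    qed (use M in \<open>auto simp: A_def intro!: mult_carrier_mat[of _ _ n]\<close>)
    moreover have "mat_op A (vs ! j) = w Q j" if j: "j < r" for j
    proof -
      \<comment> \<open>The coordinates of the generator \<open>vs ! j\<close> itself, used to read
        off its image.\<close>
      define ps where "ps = map (\<lambda>i. if i = j then 1 else 0 :: 'a poly) [0..<r]"
      have sel: "lin (mat_act M) ps us = us ! j" if "length us = r" for us
      proof -
        have "mat_act M (ps ! i) (us ! i) = (if i = j then us ! i else 0)" if "i < r" for i
          using that by (simp add: ps_def)
        moreover have "length ps = length us" using that by (simp add: ps_def)
        ultimately have "lin (mat_act M) ps us = (\<Sum>i<r. if i = j then us ! i else 0)"
          using that by (simp add: lin_eq_sum)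
        then show ?thesis using j by simp
      qed
      have "h (vs ! j) = ws ! j" using hlin[of ps] sel[OF len] sel[of ws] by (simp add: ps_def ws_def r_def)
      then show ?thesis using Aop[OF vsV[OF j]] j by (simp add: ws_def)
    qed
    moreover have "A \<in> carrier_mat n n" by (simp add: A_def)
    ultimately have "A \<in> centralizer n M" "\<forall>j<r. mat_op A (vs ! j) = w Q j"
      by (simp_all add: centralizer_def)
    then show ?thesis by blast
  qed
  then have "\<exists>A. \<forall>Q. A Q \<in> centralizer n M \<and> (\<forall>j<r. mat_op (A Q) (vs ! j) = w Q j)" by (intro choice allI)
  then obtain A where A: "\<And>Q. A Q \<in> centralizer n M" "\<And>Q j. j < r \<Longrightarrow> mat_op (A Q) (vs ! j) = w Q j" by blast
  have "inj_on A I"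
  proof (rule inj_onI)
    fix Q Q' assume Q: "Q \<in> I" "Q' \<in> I" and eq: "A Q = A Q'"
    have "Q z = Q' z" if z: "z \<in> {..<r} \<times> {..<r}" for z
    proof -
      obtain i j where ij: "z = (i, j)" "i < r" "j < r" using z by auto
      have "w Q j = w Q' j" using A(2)[OF ij(3), of Q] A(2)[OF ij(3), of Q'] eq by simp
      moreover have "cs P j \<in> residue_tuples ds" if "P \<in> I" for P
      proof -
        have "degree (P (k, j)) < degree (ds ! max k j)" if "k < r" for k
          using PiE_mem[OF \<open>P \<in> I\<close>[unfolded I_def], of "(k, j)"] that ij by simp
        then show ?thesis using cdeg ij by (auto simp: residue_tuples_def cs_def list_all2_conv_all_nth r_def)
      qed
      ultimately have "cs Q j = cs Q' j"
        using Q bij_betw_imp_inj_on[OF bij] by (auto simp: w_def inj_on_def)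
      then have "cs Q j ! i = cs Q' j ! i" by simp
      then show ?thesis using ij cnz[OF ij(2,3)] by (simp add: cs_def)
    qed
    then show "Q = Q'" using Q PiE_ext unfolding I_def by blast
  qed
  then have "card I \<le> card (centralizer n M)"
    using A(1) by (intro card_inj_on_le[OF _ _ finite_centralizer]) auto
  moreover have "card I = CARD('a) ^ (\<Sum>i<length ds. \<Sum>j<length ds. degree (ds ! max i j))"
  proof -
    have "card I = (\<Prod>(i, j)\<in>{..<r} \<times> {..<r}. CARD('a) ^ degree (ds ! max i j))"
      unfolding I_def by (subst card_PiE) (auto intro!: prod.cong simp: card_degree_less deg max_def)
    also have "\<dots> = CARD('a) ^ (\<Sum>(i, j)\<in>{..<r} \<times> {..<r}. degree (ds ! max i j))"
      by (simp add: power_sum case_prod_beta)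
    finally show ?thesis by (simp add: sum.cartesian_product r_def)
  qed
  ultimately show ?thesis by simp
qed

section \<open>Symmetric bilinear forms invariant under a matrix\<close>

definition form :: "nat \<Rightarrow> 'a::comm_ring_1 mat \<Rightarrow> (nat \<Rightarrow> 'a) \<Rightarrow> (nat \<Rightarrow> 'a) \<Rightarrow> 'a" where
  "form n L x y = (\<Sum>i<n. x i * mat_op L y i)"

lemma form_add_left: "form n L (x + y) z = form n L x z + form n L y z"
  and form_add_right: "form n L z (x + y) = form n L z x + form n L z y"
  and form_zero_left: "form n L 0 z = 0"
  and form_zero_right: "form n L z 0 = 0"
  and form_scale_left: "form n L (\<lambda>i. c * x i) z = c * form n L x z"
  and form_scale_right: "form n L z (\<lambda>i. c * x i) = c * form n L z x"
  by (simp_all add: form_def mat_op_add mat_op_scale algebra_simps sum.distrib sum_distrib_left)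

lemma form_sum_left: "form n L (\<Sum>a\<in>A. x a) z = (\<Sum>a\<in>A. form n L (x a) z)"
proof (induction A rule: infinite_finite_induct)
  case (insert a A)
  then show ?case by (simp only: sum.insert[OF insert.hyps] form_add_left)
next
  case (infinite A)
  then show ?case by (simp only: sum.infinite[OF infinite] form_zero_left)
qed (simp only: sum.empty form_zero_left)

lemma form_sum_right: "form n L z (\<Sum>a\<in>A. x a) = (\<Sum>a\<in>A. form n L z (x a))"
proof (induction A rule: infinite_finite_induct)
  case (insert a A)
  then show ?case by (simp only: sum.insert[OF insert.hyps] form_add_right)
next
  case (infinite A)
  then show ?case by (simp only: sum.infinite[OF infinite] form_zero_right)
qed (simp only: sum.empty form_zero_right)

lemma form_transpose:
  fixes A :: "'a::comm_ring_1 mat"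
  assumes "A \<in> carrier_mat n n"
  shows "(\<Sum>i<n. mat_op A x i * z i) = (\<Sum>k<n. x k * mat_op (transpose_mat A) z k)"
proof -
  have "(\<Sum>i<n. mat_op A x i * z i) = (\<Sum>i<n. \<Sum>k<n. x k * (A $$ (i, k) * z i))"
    using assms by (simp add: mat_op_def sum_distrib_right) (simp add: ac_simps)
  also have "\<dots> = (\<Sum>k<n. \<Sum>i<n. x k * (A $$ (i, k) * z i))" by (rule sum.swap)
  also have "\<dots> = (\<Sum>k<n. x k * mat_op (transpose_mat A) z k)"
    using assms by (simp add: mat_op_def sum_distrib_left)
  finally show ?thesis .
qed

lemma form_sym:
  assumes "L \<in> carrier_mat n n" "transpose_mat L = L"
  shows "form n L x y = form n L y x"
  using form_transpose[OF assms(1), of y x] assms(2) by (simp add: form_def mult.commute)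

lemma form_invariant:
  assumes "L \<in> carrier_mat n n" "M \<in> carrier_mat n n" "transpose_mat M * L * M = L"
  shows "form n L (mat_op M x) (mat_op M y) = form n L x y"
proof -
  have "form n L (mat_op M x) (mat_op M y) = (\<Sum>k<n. x k * mat_op (transpose_mat M) (mat_op L (mat_op M y)) k)"
    unfolding form_def by (rule form_transpose[OF assms(2)])
  also have "mat_op (transpose_mat M) (mat_op L (mat_op M y)) = mat_op (transpose_mat M * L * M) y"
    using assms(1,2) by (simp add: mat_op_mult[of _ n n _ n])
  finally show ?thesis by (simp add: form_def assms(3))
qed

text \<open>Reduction modulo \<open>ds ! j\<close> extends the vanishing to all polynomials in the
  right argument, invariance moves powers of \<open>M\<close> from the left argument to the right
  one, and symmetry covers \<open>i > j\<close>.\<close>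

lemma invariant_form_eq_0:
  fixes M :: "'a::{field,finite} mat"
  assumes M: "M \<in> GL n" and cb: "poly_module.cyclic_basis (mat_act M) (fvec n) vs ds"
    and L: "L \<in> invariant_forms n M"
    and z: "\<And>i j k. i \<le> j \<Longrightarrow> j < length ds \<Longrightarrow> k < degree (ds ! j) \<Longrightarrow>
      form n L (vs ! i) (mat_act M (monom 1 k) (vs ! j)) = 0"
  shows "L = 0\<^sub>m n n"
proof -
  interpret poly_module "mat_act M" by (rule poly_module_mat_act)
  have Mc: "M \<in> carrier_mat n n" using M by (rule GL_carrier)
  have Lc: "L \<in> carrier_mat n n" "transpose_mat L = L" "transpose_mat M * L * M = L"
    using L by (auto simp: invariant_forms_def)
  define r where "r = length ds"
  have len: "length vs = r" and vsV: "\<And>i. i < r \<Longrightarrow> vs ! i \<in> fvec n"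
    and ann: "\<And>i. i < r \<Longrightarrow> mat_act M (ds ! i) (vs ! i) = 0"
    and bij: "bij_betw (\<lambda>ps. lin (mat_act M) ps vs) (residue_tuples ds) (fvec n)"
    and deg: "\<And>i. i < r \<Longrightarrow> 0 < degree (ds ! i)"
    using cb by (auto simp: cyclic_basis_def divisor_chain_def list_all2_conv_all_nth r_def)
  have 1: "form n L (vs ! i) (mat_act M p (vs ! j)) = 0" if ij: "i \<le> j" "j < r" for i j p
  proof -
    define s where "s = p mod ds ! j"
    have "ds ! j \<noteq> 0" using deg[OF ij(2)] by auto
    then have sdeg: "degree s < degree (ds ! j)" using degree_mod_less[of "ds ! j" p] deg[OF ij(2)] by (auto simp: s_def)
    have "mat_act M p (vs ! j) = mat_act M (p div ds ! j) (mat_act M (ds ! j) (vs ! j)) + mat_act M s (vs ! j)"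
      unfolding s_def by (metis div_mult_mod_eq scale_left_distrib scale_scale)
    then have "mat_act M p (vs ! j) = mat_act M s (vs ! j)" using ann[OF ij(2)] by simp
    also have "\<dots> = (\<Sum>k\<le>degree s. mat_act M (monom (coeff s k) k) (vs ! j))"
      by (metis poly_as_sum_of_monoms scale_sum_left)
    also have "\<dots> = (\<Sum>k\<le>degree s. (\<lambda>l. coeff s k * mat_act M (monom 1 k) (vs ! j) l))"
      by (intro sum.cong refl) (metis mat_act_smult mult.right_neutral smult_monom)
    finally have "form n L (vs ! i) (mat_act M p (vs ! j))
        = (\<Sum>k\<le>degree s. coeff s k * form n L (vs ! i) (mat_act M (monom 1 k) (vs ! j)))"
      by (simp only: form_sum_right form_scale_right)
    also have "\<dots> = 0" using z[OF ij(1)] ij(2) sdeg by (intro sum.neutral) (auto simp: r_def)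
    finally show ?thesis .
  qed
  \<comment> \<open>The invertible \<open>M\<close> permutes the finite cyclic submodule of
    \<open>vs ! j\<close>. A factor \<open>M\<close> can thus be extracted on the right and
    cancelled against one on the left.\<close>
  have surj: "\<exists>s'. mat_act M s (vs ! j) = mat_op M (mat_act M s' (vs ! j))" if j: "j < r" for s j
  proof -
    define U where "U = range (\<lambda>s. mat_act M s (vs ! j))"
    have UV: "U \<subseteq> fvec n" using mat_act_in_fvec[OF Mc vsV[OF j]] by (auto simp: U_def)
    then have "finite U" using finite_fvec finite_subset by blast
    moreover have "mat_op M ` U \<subseteq> U"
      unfolding U_def by (auto simp: mat_act_X[symmetric] simp del: mat_act_pCons)
    moreover have "inj_on (mat_op M) U"
    proof (rule inj_onI)
      fix x y assume xy: "x \<in> U" "y \<in> U" "mat_op M x = mat_op M y"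
      obtain Q where Q: "Q \<in> GL n" "Q * M = 1\<^sub>m n" using M GL_inverse by metis
      have "mat_op Q (mat_op M x) = mat_op Q (mat_op M y)" using xy by simp
      then show "x = y" using mat_op_mult[OF GL_carrier[OF Q(1)] Mc] Q(2) UV xy mat_op_one by (metis subsetD)
    qed
    ultimately have "mat_op M ` U = U" by (rule endo_inj_surj)
    moreover have "mat_act M s (vs ! j) \<in> U" by (simp add: U_def)
    ultimately show ?thesis unfolding U_def by (metis (no_types, lifting) imageE)
  qed
  have 2: "form n L (mat_act M p (vs ! i)) (mat_act M s (vs ! j)) = 0" if ij: "i \<le> j" "j < r" for i j p s
  proof (induction p arbitrary: s)
    case 0
    then show ?case by (simp only: mat_act_0 form_zero_left)
  next
    case (pCons a p)
    obtain s' where s': "mat_act M s (vs ! j) = mat_op M (mat_act M s' (vs ! j))" using surj ij by blast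
    have "form n L (mat_op M (mat_act M p (vs ! i))) (mat_act M s (vs ! j)) = 0"
      unfolding s' form_invariant[OF Lc(1) Mc Lc(3)] by (rule pCons.IH)
    then show ?case using 1[OF ij] by (simp only: mat_act_pCons form_add_left form_scale_left) simp
  qed
  have 3: "form n L (mat_act M p (vs ! i)) (mat_act M s (vs ! j)) = 0" if "i < r" "j < r" for i j p s
    using 2[of i j p s] 2[of j i s p] that form_sym[OF Lc(1,2)] by (metis linear)
  have 4: "form n L x y = 0" if xy: "x \<in> fvec n" "y \<in> fvec n" for x y
  proof -
    obtain ps rs where pr: "ps \<in> residue_tuples ds" "x = lin (mat_act M) ps vs" "rs \<in> residue_tuples ds" "y = lin (mat_act M) rs vs"
      using xy unfolding bij_betw_imp_surj_on[OF bij, symmetric] by blast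
    then have "length ps = length vs" "length rs = length vs"
      using len by (auto simp: residue_tuples_def r_def list_all2_lengthD)
    then show ?thesis using 3 len pr by (simp add: lin_eq_sum form_sum_left form_sum_right)
  qed
  show ?thesis
  proof (rule eq_matI)
    fix i j assume ij: "i < dim_row (0\<^sub>m n n :: 'a mat)" "j < dim_col (0\<^sub>m n n :: 'a mat)"
    have "0 = form n L (unit_fun i) (unit_fun j)" using 4 unit_fun_in_fvec ij by auto
    also have "\<dots> = (\<Sum>k<n. if k = i then mat_op L (unit_fun j) k else 0)"
      unfolding form_def by (intro sum.cong refl) (simp add: unit_fun_def)
    also have "\<dots> = mat_op L (unit_fun j) i" using ij by simp
    also have "\<dots> = L $$ (i, j)" using ij Lc(1) by (simp add: mat_op_unit_fun)
    finally show "L $$ (i, j) = 0\<^sub>m n n $$ (i, j)" using ij by simp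
  qed (use Lc in auto)
qed

lemma form_minus:
  assumes "L \<in> carrier_mat n n" "N \<in> carrier_mat n n"
  shows "form n (L - N) x y = form n L x y - form n N x y"
  using assms by (simp add: form_def mat_op_minus_mat[OF assms] algebra_simps sum_subtractf)

lemma invariant_forms_minus:
  fixes M :: "'a::field mat"
  assumes "M \<in> carrier_mat n n" "L \<in> invariant_forms n M" "N \<in> invariant_forms n M"
  shows "L - N \<in> invariant_forms n M"
proof -
  have c: "L \<in> carrier_mat n n" "N \<in> carrier_mat n n" "transpose_mat M \<in> carrier_mat n n"
    using assms by (auto simp: invariant_forms_def)
  have "transpose_mat M * (L - N) * M = transpose_mat M * L * M - transpose_mat M * N * M"
    using c assms(1) by (simp add: mult_minus_distrib_mat[of _ n n _ n] minus_mult_distrib_mat[of _ n n _ _ n])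
  moreover have "transpose_mat (L - N) = transpose_mat L - transpose_mat N"
    using c by (intro eq_matI) auto
  ultimately show ?thesis using assms c by (auto simp: invariant_forms_def minus_carrier_mat)
qed

text \<open>A form is determined by its values on \<open>vs ! i\<close> and
  \<open>x^k vs ! j\<close> for \<open>i \<le> j\<close> and \<open>k < degree (ds ! j)\<close>;
  each \<open>j\<close> has \<open>Suc j\<close> partners \<open>i\<close>.\<close>

lemma card_invariant_forms_le:
  fixes M :: "'a::{field,finite} mat"
  assumes M: "M \<in> GL n" and cb: "poly_module.cyclic_basis (mat_act M) (fvec n) vs ds"
  shows "card (invariant_forms n M) \<le> CARD('a) ^ (\<Sum>j<length ds. Suc j * degree (ds ! j))"
proof -
  define r where "r = length ds"
  define J where "J = (SIGMA j:{..<r}. {..j})"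
  define T where "T = PiE J (\<lambda>(j, i). PiE {..<degree (ds ! j)} (\<lambda>_. UNIV :: 'a set))"
  define \<Psi> where "\<Psi> L = restrict (\<lambda>(j, i). restrict (\<lambda>k. form n L (vs ! i) (mat_act M (monom 1 k) (vs ! j)))
      {..<degree (ds ! j)}) J" for L
  have finJ: "finite J" by (simp add: J_def)
  have finT: "finite T" unfolding T_def using finJ by (intro finite_PiE) (auto intro!: finite_PiE)
  have "inj_on \<Psi> (invariant_forms n M)"
  proof (rule inj_onI)
    fix L N assume LN: "L \<in> invariant_forms n M" "N \<in> invariant_forms n M" and eq: "\<Psi> L = \<Psi> N"
    have c: "L \<in> carrier_mat n n" "N \<in> carrier_mat n n" using LN by (auto simp: invariant_forms_def)
    have "L - N = 0\<^sub>m n n"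
    proof (rule invariant_form_eq_0[OF M cb])
      show "L - N \<in> invariant_forms n M" using invariant_forms_minus GL_carrier[OF M] LN by blast
      fix i j k assume ijk: "i \<le> j" "j < length ds" "k < degree (ds ! j)"
      have "\<Psi> L (j, i) k = \<Psi> N (j, i) k" using eq by simp
      then show "form n (L - N) (vs ! i) (mat_act M (monom 1 k) (vs ! j)) = 0"
        using ijk by (simp add: \<Psi>_def J_def r_def form_minus[OF c])
    qed
    show "L = N"
    proof (rule eq_matI)
      fix i j assume "i < dim_row N" "j < dim_col N"
      then show "L $$ (i, j) = N $$ (i, j)"
        using arg_cong[OF \<open>L - N = 0\<^sub>m n n\<close>, of "\<lambda>X. X $$ (i, j)"] c by simp
    qed (use c in auto)
  qed
  moreover have "\<Psi> ` invariant_forms n M \<subseteq> T"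
    unfolding \<Psi>_def T_def by (intro image_subsetI) (simp add: restrict_PiE_iff case_prod_beta)
  ultimately have "card (invariant_forms n M) \<le> card T" using finT by (rule card_inj_on_le)
  also have "card T = (\<Prod>(j, i)\<in>J. CARD('a) ^ degree (ds ! j))"
    unfolding T_def using finJ by (subst card_PiE) (auto intro!: prod.cong simp: card_PiE)
  also have "\<dots> = CARD('a) ^ (\<Sum>(j, i)\<in>J. degree (ds ! j))" by (simp add: power_sum case_prod_beta)
  also have "(\<Sum>(j, i)\<in>J. degree (ds ! j)) = (\<Sum>j<r. \<Sum>i\<le>j. degree (ds ! j))"
    unfolding J_def by (rule sum.Sigma[symmetric]) auto
  finally show ?thesis by (simp add: r_def)
qed

text \<open>Exactly \<open>2 * j + 1\<close> index pairs have maximum \<open>j\<close>; the extra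
  sum raises this to \<open>2 * Suc j\<close>. It relates the exponents for centralizers and for
  forms.\<close>

lemma sum_max_index:
  fixes a :: "nat \<Rightarrow> nat"
  shows "(\<Sum>i<r. \<Sum>j<r. a (max i j)) + (\<Sum>j<r. a j) = 2 * (\<Sum>j<r. Suc j * a j)"
proof (induction r)
  case (Suc r)
  have "(\<Sum>i<Suc r. \<Sum>j<Suc r. a (max i j)) = (\<Sum>i<r. \<Sum>j<r. a (max i j)) + (\<Sum>i<r. a (max i r)) + (\<Sum>j<r. a (max r j)) + a r"
    by (simp add: sum.distrib)
  also have "(\<Sum>i<r. a (max i r)) = r * a r" by (simp add: max_def)
  also have "(\<Sum>j<r. a (max r j)) = r * a r" by (simp add: max_def)
  finally show ?case using Suc by (simp add: algebra_simps)
qed simp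

text \<open>In each product \<open>a i * a j\<close> the factor with the smaller index is at most
  \<open>m\<close>, the other one is \<open>a (max i j)\<close>.\<close>

lemma square_sum_le_sum_max:
  fixes a :: "nat \<Rightarrow> nat"
  assumes "\<And>i j. i \<le> j \<Longrightarrow> j < r \<Longrightarrow> a j \<le> a i" "\<And>i. i < r \<Longrightarrow> a i \<le> m"
  shows "(\<Sum>i<r. a i)\<^sup>2 \<le> m * (\<Sum>i<r. \<Sum>j<r. a (max i j))"
proof -
  have "(\<Sum>i<r. a i)\<^sup>2 = (\<Sum>i<r. \<Sum>j<r. a i * a j)" by (simp add: power2_eq_square sum_product)
  also have "\<dots> \<le> (\<Sum>i<r. \<Sum>j<r. m * a (max i j))"
  proof (intro sum_mono)
    fix i j assume ij: "i \<in> {..<r}" "j \<in> {..<r}"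
    show "a i * a j \<le> m * a (max i j)"
    proof (cases "i \<le> j")
      case True
      then show ?thesis using assms(2)[of i] ij by (simp add: max_def)
    next
      case False
      then have "a i * a j \<le> a i * m" using assms(2)[of j] ij by (intro mult_le_mono2) simp
      then show ?thesis using False by (simp add: max_def mult.commute)
    qed
  qed
  finally show ?thesis by (simp add: sum_distrib_left)
qed

text \<open>With centralizer exponent \<open>D\<close> and form exponent \<open>s\<close>, the
  relations \<open>2 s = D + n\<close> and \<open>n^2 \<le> m D\<close> give
  \<open>s - D = (n - D)/2 \<le> n/2 - n^2/(2m)\<close>.\<close>

lemma card_invariant_forms_le_centralizer:
  fixes M :: "'a::{field,finite} mat"
  assumes M: "M \<in> GL n" and p: "p \<noteq> 0" "degree p \<le> m" "\<And>v. v \<in> fvec n \<Longrightarrow> mat_act M p v = 0" and m: "0 < m"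
  shows "real (card (invariant_forms n M))
    \<le> real (card (centralizer n M)) * real CARD('a) powr (real n / 2 - (real n)\<^sup>2 / (2 * real m))"
proof -
  interpret poly_module "mat_act M" by (rule poly_module_mat_act)
  have Mc: "M \<in> carrier_mat n n" using M by (rule GL_carrier)
  obtain vs ds where cb: "cyclic_basis (fvec n) vs ds"
    using cyclic_basis_exists[OF finite_fvec subspace_fvec[OF Mc]] by blast
  let ?q = "CARD('a)"
  have q: "1 < ?q" using card_mono[of "UNIV :: 'a set" "{0, 1}"] by simp
  define r where "r = length ds"
  define a where "a i = degree (ds ! i)" for i
  have dvd: "ds ! j dvd ds ! i" if "i \<le> j" "j < r" for i j
    using cb that by (cases "i = j") (auto simp: cyclic_basis_def divisor_chain_def r_def sorted_wrt_iff_nth_less)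
  have nz: "ds ! i \<noteq> 0" if "i < r" for i
  proof -
    have "0 < degree (ds ! i)" using cb that by (simp add: cyclic_basis_def divisor_chain_def r_def)
    then show ?thesis by auto
  qed
  have "?q ^ sum_list (map degree ds) = ?q ^ n" using card_cyclic_basis[OF cb] card_fvec by metis
  then have n: "(\<Sum>i<r. a i) = n" using q by (simp add: sum_list_sum_nth r_def a_def lessThan_atLeast0)
  have am: "a i \<le> m" if "i < r" for i
  proof -
    have "vs ! i \<in> fvec n" using cb that by (auto simp: cyclic_basis_def list_all2_conv_all_nth r_def)
    then have "ds ! i dvd p" using cyclic_basis_dvd[OF cb] that p(3) by (simp add: r_def)
    from dvd_imp_degree_le[OF this p(1)] show ?thesis using p(2) by (simp add: a_def)
  qed
  define D where "D = (\<Sum>i<r. \<Sum>j<r. a (max i j))"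
  define s where "s = (\<Sum>j<r. Suc j * a j)"
  have Ds: "D + n = 2 * s" using sum_max_index[of a r] n by (simp add: D_def s_def)
  have "n\<^sup>2 \<le> m * D"
    unfolding D_def n[symmetric] by (rule square_sum_le_sum_max) (use dvd nz am in \<open>auto simp: a_def intro!: dvd_imp_degree_le\<close>)
  then have "(real n)\<^sup>2 \<le> real m * real D" by (metis of_nat_le_iff of_nat_mult of_nat_power)
  then have "(real n)\<^sup>2 / real m \<le> real D" using m by (simp add: field_simps)
  moreover have "real D + real n = 2 * real s" using Ds by (metis of_nat_add of_nat_mult of_nat_numeral)
  moreover have "(real n)\<^sup>2 / (2 * real m) = (real n)\<^sup>2 / real m / 2" by simp
  ultimately have exp: "real s \<le> real D + (real n / 2 - (real n)\<^sup>2 / (2 * real m))" by linarith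
  have cent: "real (?q ^ D) \<le> real (card (centralizer n M))"
    using card_centralizer_ge[OF Mc cb] unfolding D_def a_def r_def by (rule of_nat_mono)
  have "real (card (invariant_forms n M)) \<le> real (?q ^ s)"
    using card_invariant_forms_le[OF M cb] unfolding s_def a_def r_def by (rule of_nat_mono)
  also have "\<dots> = real ?q powr real s" using q by (simp add: powr_realpow)
  also have "\<dots> \<le> real ?q powr (real D + (real n / 2 - (real n)\<^sup>2 / (2 * real m)))"
    using exp q by (intro powr_mono) auto
  also have "\<dots> = real (?q ^ D) * real ?q powr (real n / 2 - (real n)\<^sup>2 / (2 * real m))"
    using q by (simp add: powr_add powr_realpow)
  also have "\<dots> \<le> real (card (centralizer n M)) * real ?q powr (real n / 2 - (real n)\<^sup>2 / (2 * real m))"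
    by (rule mult_right_mono[OF cent powr_ge_zero])
  finally show ?thesis .
qed

section \<open>Counting in the orthogonal group\<close>

text \<open>An annihilating polynomial of degree at most \<open>m\<close> replaces a minimal
  polynomial of degree exactly \<open>m\<close>. This weaker condition suffices for an upper bound
  and transfers along conjugation directly.\<close>

definition annihilated_class :: "nat \<Rightarrow> 'a::{field,finite} poly \<Rightarrow> nat \<Rightarrow> 'a mat set" where
  "annihilated_class n f m = {M \<in> GL n. char_poly M = f \<and>
     (\<exists>p. p \<noteq> 0 \<and> degree p \<le> m \<and> (\<forall>v\<in>fvec n. mat_act M p v = 0))}"

definition orthogonal_mats :: "nat \<Rightarrow> 'a::semiring_0 mat \<Rightarrow> 'a mat set" where
  "orthogonal_mats n K = {P \<in> carrier_mat n n. transpose_mat P * K * P = K}"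

lemma finite_annihilated_class: "finite (annihilated_class n f m)"
  by (rule finite_subset[OF _ finite_GL[of n]]) (auto simp: annihilated_class_def)

lemma finite_orthogonal_mats: "finite (orthogonal_mats n K :: 'a::{semiring_0,finite} mat set)"
  by (rule finite_subset[OF _ finite_carrier_mat[of n n]]) (auto simp: orthogonal_mats_def)

lemma congruence_mult:
  fixes A B K :: "'a::comm_ring_1 mat"
  assumes "A \<in> carrier_mat n n" "B \<in> carrier_mat n n" "K \<in> carrier_mat n n"
  shows "transpose_mat (A * B) * K * (A * B) = transpose_mat B * (transpose_mat A * K * A) * B"
  using assms by (simp add: transpose_mult[of _ n n _ n] assoc_mult_mat[of _ n n _ n _ n])

lemma annihilated_class_conjugate:
  assumes M: "M \<in> annihilated_class n f m" and P: "P \<in> GL n" "Q \<in> GL n" "P * Q = 1\<^sub>m n" "Q * P = 1\<^sub>m n"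
  shows "Q * M * P \<in> annihilated_class n f m"
proof -
  have MG: "M \<in> GL n" using M by (simp add: annihilated_class_def)
  note c = GL_carrier[OF MG] GL_carrier[OF P(1)] GL_carrier[OF P(2)]
  have "similar_mat_wit (Q * M * P) M Q P"
    unfolding similar_mat_wit_def Let_def using c P by auto
  then have "char_poly (Q * M * P) = f"
    using char_poly_similar[of "Q * M * P" M] M by (auto simp: similar_mat_def annihilated_class_def)
  moreover have "Q * M * P \<in> GL n" using MG P GL_mult by blast
  moreover obtain p where p: "p \<noteq> 0" "degree p \<le> m" "\<forall>v\<in>fvec n. mat_act M p v = 0"
    using M by (auto simp: annihilated_class_def)
  have "mat_act (Q * M * P) p v = 0" if v: "v \<in> fvec n" for v
  proof -
    let ?N = "Q * M * P"
    have N: "?N \<in> carrier_mat n n" using c by auto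
    have "P * ?N = (P * Q) * M * P" using c by (simp add: assoc_mult_mat[of _ n n _ n _ n])
    then have PN: "P * ?N = M * P" using P c by simp
    have "mat_op P (mat_act ?N p v) = mat_act M p (mat_op P v)"
      by (rule mat_op_intertwine[OF N c(1,2) PN])
    also have "\<dots> = 0" using p(3) mat_op_in_fvec[of P v] c by auto
    finally have "mat_op Q (mat_op P (mat_act ?N p v)) = 0" by simp
    then show ?thesis
      using mat_op_mult[OF c(3,2)] P(4) mat_op_one[OF mat_act_in_fvec[OF N v]] by metis
  qed
  ultimately show ?thesis using p by (auto simp: annihilated_class_def)
qed

text \<open>Conjugating \<open>M\<close> by \<open>P\<close> and transporting \<open>K\<close> along \<open>P\<close> trades elements of one fixed orthogonal
  group for pairs of an arbitrary matrix and a symmetric form that it preserves.\<close>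

lemma card_class_orthogonal_le_forms:
  fixes K :: "'a::{field,finite} mat"
  assumes K: "K \<in> carrier_mat n n" "transpose_mat K = K"
  shows "card (annihilated_class n f m \<inter> orthogonal_mats n K) * card (GL n :: 'a mat set)
    \<le> card (orthogonal_mats n K) * (\<Sum>M\<in>annihilated_class n f m. card (invariant_forms n M))"
proof -
  let ?S = "annihilated_class n f m"
  have "\<exists>Q. Q \<in> GL n \<and> P * Q = 1\<^sub>m n \<and> Q * P = 1\<^sub>m n" if "P \<in> GL n" for P :: "'a mat"
    using GL_inverse[OF that] by metis
  then obtain iv where iv: "\<And>P :: 'a mat. P \<in> GL n \<Longrightarrow> iv P \<in> GL n \<and> P * iv P = 1\<^sub>m n \<and> iv P * P = 1\<^sub>m n" by metis
  \<comment> \<open>One fixed matrix transporting \<open>K\<close> to \<open>L\<close>, for each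
    form \<open>L\<close> congruent to \<open>K\<close>; it depends on \<open>L\<close>
    alone.\<close>
  define P0 where "P0 L = (SOME P. P \<in> GL n \<and> transpose_mat P * K * P = L)" for L
  have P0: "P0 L \<in> GL n \<and> transpose_mat (P0 L) * K * P0 L = L" if "P \<in> GL n" "transpose_mat P * K * P = L" for P L
    unfolding P0_def by (rule someI[of _ P]) (use that in simp)
  define form where "form P = transpose_mat P * K * P" for P
  \<comment> \<open>\<open>P\<close> is recorded by its form and by its deviation from the chosen
    transporter of that form, which is an isometry of \<open>K\<close>.\<close>
  define \<Theta> where "\<Theta> = (\<lambda>(M, P). (P * iv (P0 (form P)), (iv P * M * P, form P)))"
  let ?D = "(?S \<inter> orthogonal_mats n K) \<times> (GL n :: 'a mat set)"
  let ?C = "orthogonal_mats n K \<times> (SIGMA M:?S. invariant_forms n M)"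
  have "inj_on \<Theta> ?D"
  proof (rule inj_onI, clarify)
    fix M P M' P'
    assume M: "M \<in> ?S" "M \<in> orthogonal_mats n K" "P \<in> GL n" and M': "M' \<in> ?S" "M' \<in> orthogonal_mats n K" "P' \<in> GL n"
      and eq: "\<Theta> (M, P) = \<Theta> (M', P')"
    have f: "form P = form P'" using eq by (simp add: \<Theta>_def)
    have G: "iv (P0 (form P)) \<in> GL n" using P0[OF M(3)] iv by (simp add: form_def)
    have "P * iv (P0 (form P)) = P' * iv (P0 (form P))" using eq f by (simp add: \<Theta>_def)
    then have PP: "P = P'" using GL_cancel[OF G] M(3) M'(3) GL_carrier by blast
    have c: "M \<in> carrier_mat n n" "M' \<in> carrier_mat n n" "P \<in> carrier_mat n n" "iv P \<in> carrier_mat n n"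
      using M(2) M'(2) GL_carrier[OF M(3)] GL_carrier[OF conjunct1[OF iv[OF M(3)]]] by (simp_all add: orthogonal_mats_def)
    have "iv P * M * P = iv P * M' * P" using eq PP by (simp add: \<Theta>_def)
    then have "iv P * M = iv P * M'" using GL_cancel[OF M(3), of "iv P * M" "iv P * M'"] c by simp
    then have "P * (iv P * M) = P * (iv P * M')" by simp
    then have "M = M'" using c iv[OF M(3)] by (simp add: assoc_mult_mat[of _ n n _ n _ n, symmetric])
    then show "M = M' \<and> P = P'" using PP by simp
  qed
  moreover have "\<Theta> ` ?D \<subseteq> ?C"
  proof (rule image_subsetI, clarify)
    fix M P :: "'a mat" assume M: "M \<in> ?S" "M \<in> orthogonal_mats n K" "P \<in> GL n"
    define L where "L = form P"
    have p0: "P0 L \<in> GL n" "form (P0 L) = L" using P0[OF M(3)] by (auto simp: L_def form_def)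
    have c: "M \<in> carrier_mat n n" "P \<in> carrier_mat n n" "iv P \<in> carrier_mat n n" "P0 L \<in> carrier_mat n n" "iv (P0 L) \<in> carrier_mat n n"
      using M(2) GL_carrier[OF M(3)] GL_carrier[OF p0(1)] GL_carrier[OF conjunct1[OF iv[OF M(3)]]]
        GL_carrier[OF conjunct1[OF iv[OF p0(1)]]] by (simp_all add: orthogonal_mats_def)
    have MK: "transpose_mat M * K * M = K" using M(2) by (simp add: orthogonal_mats_def)
    have "form (P * iv (P0 L)) = transpose_mat (iv (P0 L)) * L * iv (P0 L)"
      unfolding form_def using congruence_mult[OF c(2,5) K(1)] by (simp add: L_def form_def)
    also have "\<dots> = form (P0 L * iv (P0 L))"
      using congruence_mult[OF c(4,5) K(1)] p0(2) by (simp add: form_def)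
    also have "\<dots> = K" using iv[OF p0(1)] K by (simp add: form_def)
    finally have 1: "P * iv (P0 L) \<in> orthogonal_mats n K" using c by (simp add: orthogonal_mats_def form_def)
    have 2: "iv P * M * P \<in> ?S" using annihilated_class_conjugate[OF M(1,3)] iv[OF M(3)] by blast
    have N: "iv P * M * P \<in> carrier_mat n n" using c by auto
    have "P * (iv P * M * P) = (P * iv P) * M * P" using c by (simp add: assoc_mult_mat[of _ n n _ n _ n])
    then have PN: "P * (iv P * M * P) = M * P" using c iv[OF M(3)] by simp
    have "transpose_mat (iv P * M * P) * L * (iv P * M * P) = form (P * (iv P * M * P))"
      using congruence_mult[OF c(2) N K(1)] by (simp add: form_def L_def)
    also have "\<dots> = L" using congruence_mult[OF c(1,2) K(1)] MK by (simp add: PN form_def L_def)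
    finally have "transpose_mat (iv P * M * P) * L * (iv P * M * P) = L" .
    moreover have "transpose_mat L = L"
      using c K by (simp add: L_def form_def transpose_mult[of _ n n _ n] assoc_mult_mat[of _ n n _ n _ n])
    moreover have "L \<in> carrier_mat n n" using c K by (simp add: L_def form_def)
    ultimately have "L \<in> invariant_forms n (iv P * M * P)" by (simp add: invariant_forms_def)
    then show "\<Theta> (M, P) \<in> ?C" using 1 2 by (simp add: \<Theta>_def L_def)
  qed
  moreover have "finite ?C"
    using finite_orthogonal_mats finite_annihilated_class finite_invariant_forms by (intro finite_cartesian_product finite_SigmaI) auto
  ultimately have "card ?D \<le> card ?C" by (rule card_inj_on_le)
  moreover have "card (SIGMA M:?S. invariant_forms n M) = (\<Sum>M\<in>?S. card (invariant_forms n M))"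
    by (intro card_SigmaI ballI finite_annihilated_class finite_invariant_forms)
  ultimately show ?thesis by (simp only: card_cartesian_product)
qed

text \<open>Replacing forms by centralizer elements, at the cost of the factor \<open>?x\<close>,
  turns the sum over the class into a number of commuting pairs. Their bound contains the factor
  \<open>card ?G\<close>, which cancels.\<close>

lemma card_class_orthogonal_le:
  fixes K :: "'a::{field,finite} mat"
  assumes K: "K \<in> carrier_mat n n" "transpose_mat K = K" and m: "0 < m" and fin: "finite (divisor_chains f n)"
  shows "real (card (annihilated_class n f m \<inter> orthogonal_mats n K)) \<le> real (card (orthogonal_mats n K)) *
    (real (card (divisor_chains f n)))\<^sup>2 * real CARD('a) powr (real n / 2 - (real n)\<^sup>2 / (2 * real m))"
proof -
  let ?S = "annihilated_class n f m" and ?x = "real CARD('a) powr (real n / 2 - (real n)\<^sup>2 / (2 * real m))"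
  let ?G = "GL n :: 'a mat set" and ?T = "divisor_chains f n"
  have "(\<Sum>M\<in>?S. real (card (invariant_forms n M))) \<le> (\<Sum>M\<in>?S. real (card (centralizer n M)) * ?x)"
  proof (rule sum_mono)
    fix M assume "M \<in> ?S"
    then show "real (card (invariant_forms n M)) \<le> real (card (centralizer n M)) * ?x"
      using card_invariant_forms_le_centralizer[OF _ _ _ _ m] by (auto simp: annihilated_class_def)
  qed
  also have "\<dots> = real (card (SIGMA M:?S. centralizer n M)) * ?x"
  proof -
    have "card (SIGMA M:?S. centralizer n M) = (\<Sum>M\<in>?S. card (centralizer n M))"
      by (intro card_SigmaI ballI finite_annihilated_class finite_centralizer)
    then show ?thesis by (simp add: sum_distrib_right)
  qed
  also have "\<dots> \<le> (real (card ?G) * (real (card ?T))\<^sup>2) * ?x"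
  proof (rule mult_right_mono)
    have "(SIGMA M:?S. centralizer n M)
        \<subseteq> {(M, A). M \<in> carrier_mat n n \<and> A \<in> carrier_mat n n \<and> M * A = A * M \<and> char_poly M = f}"
      by (auto simp: annihilated_class_def centralizer_def GL_def)
    moreover have "finite {(M, A). M \<in> carrier_mat n n \<and> A \<in> carrier_mat n n \<and> M * A = A * M \<and> char_poly M = f}"
      by (rule finite_subset[of _ "carrier_mat n n \<times> carrier_mat n n"])
         (auto intro: finite_carrier_mat)
    ultimately have "card (SIGMA M:?S. centralizer n M)
        \<le> card {(M, A). M \<in> carrier_mat n n \<and> A \<in> carrier_mat n n \<and> M * A = A * M \<and> char_poly M = f}"
      by (intro card_mono)
    also have "\<dots> \<le> card ?G * (card ?T)\<^sup>2" by (rule card_commuting_pairs[OF fin])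
    finally have "card (SIGMA M:?S. centralizer n M) \<le> card ?G * (card ?T)\<^sup>2" .
    then show "real (card (SIGMA M:?S. centralizer n M)) \<le> real (card ?G) * (real (card ?T))\<^sup>2"
      by (metis of_nat_le_iff of_nat_mult of_nat_power)
  qed simp
  finally have sum: "(\<Sum>M\<in>?S. real (card (invariant_forms n M))) \<le> (real (card ?G) * (real (card ?T))\<^sup>2) * ?x" .
  have "real (card (?S \<inter> orthogonal_mats n K)) * real (card ?G)
      \<le> real (card (orthogonal_mats n K)) * (\<Sum>M\<in>?S. real (card (invariant_forms n M)))"
    using card_class_orthogonal_le_forms[OF K, of f m] by (simp flip: of_nat_sum of_nat_mult)
  also have "\<dots> \<le> real (card (orthogonal_mats n K)) * ((real (card ?G) * (real (card ?T))\<^sup>2) * ?x)"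
    by (rule mult_left_mono[OF sum]) simp
  finally have "real (card (?S \<inter> orthogonal_mats n K)) * real (card ?G)
      \<le> (real (card (orthogonal_mats n K)) * (real (card ?T))\<^sup>2 * ?x) * real (card ?G)" by (simp add: ac_simps)
  moreover have "1\<^sub>m n \<in> ?G" by (rule GL_I[of _ _ "1\<^sub>m n"]) auto
  then have "0 < real (card ?G)" using finite_GL card_gt_0_iff by (metis empty_iff of_nat_0_less_iff)
  ultimately show ?thesis by simp
qed

text \<open>Isometries have determinant \<open>1\<close> or \<open>- 1\<close>. Right multiplication
  by one fixed isometry of determinant \<open>- 1\<close> embeds all those of determinant
  \<open>- 1\<close> into the special group.\<close>

lemma card_orthogonal_le:
  fixes K :: "'a::{field,finite} mat"
  assumes K: "K \<in> GL n"
  shows "card (orthogonal_mats n K) \<le> 2 * card (special_orthogonal n K)"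
proof -
  have Kc: "K \<in> carrier_mat n n" using K by (rule GL_carrier)
  have inO: "P \<in> GL n \<and> (det P = 1 \<or> det P = - 1)" if P: "P \<in> orthogonal_mats n K" for P
  proof -
    have c: "P \<in> carrier_mat n n" "transpose_mat P * K * P = K" using P by (auto simp: orthogonal_mats_def)
    obtain Q where Q: "Q \<in> GL n" "Q * K = 1\<^sub>m n" using GL_inverse[OF K] by metis
    have Qc: "Q \<in> carrier_mat n n" using Q GL_carrier by blast
    have "det (transpose_mat P * K * P) = det P * det K * det P"
      using det_mult[of "transpose_mat P * K" n P] det_mult[of "transpose_mat P" n K] Determinant.det_transpose[OF c(1)] c Kc
      by simp
    then have "det P * det K * det P = det K" using c by simp
    moreover have "det Q * det K = 1" using det_mult[OF Qc Kc] Q by simp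
    then have "det K \<noteq> 0" by auto
    ultimately have "det P * det P = 1" by (simp add: ac_simps)
    then have "det P = 1 \<or> det P = - 1" by (simp add: square_eq_1_iff)
    moreover define R where "R = Q * (transpose_mat P * K)"
    have R: "R \<in> carrier_mat n n" using c Qc Kc by (simp add: R_def)
    have "R * P = Q * (transpose_mat P * K * P)"
      unfolding R_def using c(1) Qc Kc by (simp add: assoc_mult_mat[of _ n n _ n _ n])
    then have "R * P = 1\<^sub>m n" using c(2) Q(2) by simp
    then have "P * R = 1\<^sub>m n" by (rule mat_mult_left_right_inverse[OF R c(1)])
    then have "P \<in> GL n" by (rule GL_I[OF c(1) R])
    ultimately show ?thesis by blast
  qed
  define N where "N = {P \<in> orthogonal_mats n K. det P = - 1}"
  have sub: "orthogonal_mats n K \<subseteq> special_orthogonal n K \<union> N"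
    using inO by (auto simp: N_def special_orthogonal_def orthogonal_mats_def GL_def)
  have "card N \<le> card (special_orthogonal n K)"
  proof (cases "N = {}")
    case False
    then obtain R where R: "R \<in> N" by blast
    then have RG: "R \<in> GL n" and RO: "R \<in> carrier_mat n n" "transpose_mat R * K * R = K" "det R = - 1"
      using inO by (auto simp: N_def orthogonal_mats_def)
    have "inj_on (\<lambda>P. P * R) N"
      by (rule inj_onI) (use GL_cancel[OF RG] in \<open>auto simp: N_def orthogonal_mats_def\<close>)
    moreover have "(\<lambda>P. P * R) ` N \<subseteq> special_orthogonal n K"
    proof (rule image_subsetI)
      fix P assume P: "P \<in> N"
      then have PO: "P \<in> GL n" "P \<in> carrier_mat n n" "transpose_mat P * K * P = K" "det P = - 1"
        using inO by (auto simp: N_def orthogonal_mats_def)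
      have "P * R \<in> GL n" using PO RG GL_mult by blast
      moreover have "transpose_mat (P * R) * K * (P * R) = K"
        using congruence_mult[OF PO(2) RO(1) Kc] PO RO by simp
      moreover have "det (P * R) = 1" using det_mult[OF PO(2) RO(1)] PO RO by simp
      ultimately show "P * R \<in> special_orthogonal n K" by (simp add: special_orthogonal_def GL_def)
    qed
    ultimately show ?thesis using finite_special_orthogonal by (rule card_inj_on_le)
  qed simp
  moreover have "finite N" using finite_subset[OF _ finite_orthogonal_mats[of n K], of N] by (auto simp: N_def)
  then have "card (orthogonal_mats n K) \<le> card (special_orthogonal n K \<union> N)"
    using sub finite_special_orthogonal by (intro card_mono) auto
  moreover have "card (special_orthogonal n K \<union> N) \<le> card (special_orthogonal n K) + card N" by (rule card_Un_le)
  ultimately show ?thesis by linarith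
qed

lemma prob_min_poly_char_poly_le:
  fixes K :: "'a::{field,finite} mat"
  assumes K: "K \<in> GL n" "transpose_mat K = K" and m: "0 < m" and fin: "finite (divisor_chains f n)"
  shows "measure_pmf.prob (pmf_of_set (special_orthogonal n K)) {M. degree (min_poly M) = m \<and> char_poly M = f}
    \<le> 2 * (real (card (divisor_chains f n)))\<^sup>2 * real CARD('a) powr (real n / 2 - (real n)\<^sup>2 / (2 * real m))"
proof -
  let ?SO = "special_orthogonal n K" and ?E = "{M. degree (min_poly M) = m \<and> char_poly M = f}"
  let ?x = "(real (card (divisor_chains f n)))\<^sup>2 * real CARD('a) powr (real n / 2 - (real n)\<^sup>2 / (2 * real m))"
  have Kc: "K \<in> carrier_mat n n" using K GL_carrier by blast
  have ne: "?SO \<noteq> {}" using one_in_special_orthogonal[OF Kc] by blast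
  have "?SO \<inter> ?E \<subseteq> annihilated_class n f m \<inter> orthogonal_mats n K"
  proof
    fix M assume M: "M \<in> ?SO \<inter> ?E"
    then have Mc: "M \<in> carrier_mat n n" by (simp add: special_orthogonal_def)
    have mp: "is_min_poly M (min_poly M)" by (rule is_min_poly_min_poly[OF Mc])
    then have "min_poly M \<noteq> 0" "\<forall>v\<in>fvec n. mat_act M (min_poly M) v = 0"
      using mat_act_eq_0_of_poly_mat[OF Mc] by (auto simp: is_min_poly_def)
    then show "M \<in> annihilated_class n f m \<inter> orthogonal_mats n K"
      using M by (auto simp: special_orthogonal_def annihilated_class_def orthogonal_mats_def GL_def)
  qed
  then have "card (?SO \<inter> ?E) \<le> card (annihilated_class n f m \<inter> orthogonal_mats n K)"
    using finite_annihilated_class by (intro card_mono) auto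
  then have "real (card (?SO \<inter> ?E)) \<le> real (card (orthogonal_mats n K)) * ?x"
    using card_class_orthogonal_le[OF Kc K(2) m fin] by (simp add: mult.assoc)
  also have "\<dots> \<le> (2 * real (card ?SO)) * ?x"
    using card_orthogonal_le[OF K(1)] by (intro mult_right_mono) auto
  finally have "real (card (?SO \<inter> ?E)) \<le> (2 * ?x) * real (card ?SO)" by (simp add: ac_simps)
  moreover have "0 < real (card ?SO)" using ne finite_special_orthogonal by (simp add: card_gt_0_iff)
  ultimately have "real (card (?SO \<inter> ?E)) / real (card ?SO) \<le> 2 * ?x" by (simp add: divide_le_eq)
  moreover have "measure_pmf.prob (pmf_of_set ?SO) ?E = real (card (?SO \<inter> ?E)) / real (card ?SO)"
    using measure_pmf_of_set[OF ne finite_special_orthogonal] by simp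
  ultimately show ?thesis by (simp add: mult.assoc)
qed

section \<open>Counting chains of divisors\<close>

definition irreducible_divisors :: "'a::field poly \<Rightarrow> 'a poly set" where
  "irreducible_divisors f = {g. irreducible g \<and> monic g \<and> g dvd f}"

lemma finite_irreducible_divisors:
  fixes f :: "'a::{field,finite} poly"
  assumes "f \<noteq> 0"
  shows "finite (irreducible_divisors f)"
  by (rule finite_subset[OF _ finite_degree_less[of "Suc (degree f)"]])
     (auto simp: irreducible_divisors_def less_Suc_eq_le intro: dvd_imp_degree_le[OF _ assms])

lemma degree_pos_irreducible: "irreducible (g :: 'a::field poly) \<Longrightarrow> 0 < degree g"
  by (auto simp: irreducible_def is_unit_iff_degree)

text \<open>Exponent \<open>0\<close> for missing factors lets all divisors of \<open>f\<close>
  share one index set.\<close>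

lemma exponents_exist:
  fixes f :: "'a::{field,finite} poly"
  assumes g: "monic g" "g dvd f" and f: "f \<noteq> 0"
  obtains a where "g = (\<Prod>s\<in>irreducible_divisors f. s ^ a s)"
proof -
  obtain A b where Ab: "finite A" "g = (\<Prod>s\<in>A. s ^ Suc (b s))" "A \<subseteq> {q. irreducible q \<and> monic q}"
    using monic_irreducible_factorization[OF g(1)] by auto
  have "s dvd g" if "s \<in> A" for s
  proof -
    have "s dvd s ^ Suc (b s)" by simp
    also have "\<dots> dvd g" unfolding Ab(2) using Ab(1) that by (rule dvd_prodI)
    finally show ?thesis .
  qed
  then have sub: "A \<subseteq> irreducible_divisors f"
    using Ab(3) g(2) dvd_trans by (auto simp: irreducible_divisors_def)
  define a where "a s = (if s \<in> A then Suc (b s) else 0)" for s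
  have "g = (\<Prod>s\<in>A. s ^ a s)" unfolding Ab(2) by (intro prod.cong) (auto simp: a_def)
  also have "\<dots> = (\<Prod>s\<in>irreducible_divisors f. s ^ a s)"
    using finite_irreducible_divisors[OF f] sub by (intro prod.mono_neutral_left) (auto simp: a_def)
  finally show ?thesis using that by blast
qed

lemma sum_triangle: "(\<Sum>i<n. \<Sum>j\<in>{i..<n}. a j) = (\<Sum>j<n. Suc j * a j)" for a :: "nat \<Rightarrow> nat"
proof (induction n)
  case (Suc n)
  have "(\<Sum>i<Suc n. \<Sum>j\<in>{i..<Suc n}. a j) = (\<Sum>i<Suc n. (\<Sum>j\<in>{i..<n}. a j) + a n)"
    by (intro sum.cong refl) simp
  also have "\<dots> = (\<Sum>i<n. \<Sum>j\<in>{i..<n}. a j) + Suc n * a n" by (simp add: sum.distrib)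
  finally show ?case using Suc by simp
qed simp

text \<open>Here \<open>a (s, i)\<close> stands for the exponent of the irreducible \<open>s\<close>
  in the quotient of the chain entries \<open>i\<close> and \<open>i + 1\<close>. That quotient is a
  factor of the \<open>Suc i\<close> entries with indices \<open>0\<close> to \<open>i\<close>,
  hence the weight. The range \<open>{..n}\<close> keeps the ambient function space finite.\<close>

definition exponent_functions :: "'a set \<Rightarrow> nat \<Rightarrow> ('a \<times> nat \<Rightarrow> nat) set" where
  "exponent_functions S n = {a \<in> (S \<times> {..<n}) \<rightarrow>\<^sub>E {..n}. (\<Sum>(s, i)\<in>S \<times> {..<n}. Suc i * a (s, i)) \<le> n}"

text \<open>A chain is recovered from its successive quotients, each entry being the product of all
  quotients from its index on. The quotients are factored into irreducible divisors of
  \<open>f\<close>.\<close>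

lemma divisor_chain_encoding:
  fixes f :: "'a::{field,finite} poly"
  assumes f: "f \<noteq> 0" and ds: "ds \<in> divisor_chains f n"
  obtains a where "a \<in> exponent_functions (irreducible_divisors f) n"
    "ds = filter (\<lambda>p. p \<noteq> 1) (map (\<lambda>i. \<Prod>j\<in>{i..<n}. \<Prod>s\<in>irreducible_divisors f. s ^ a (s, j)) [0..<n])"
proof -
  let ?S = "irreducible_divisors f"
  define l where "l = length ds"
  have mon: "\<And>i. i < l \<Longrightarrow> monic (ds ! i)" and deg: "\<And>i. i < l \<Longrightarrow> 0 < degree (ds ! i)"
    and dvd: "\<And>i j. i < j \<Longrightarrow> j < l \<Longrightarrow> ds ! j dvd ds ! i" and dvdf: "\<And>i. i < l \<Longrightarrow> ds ! i dvd f"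
    and tot: "(\<Sum>i<l. degree (ds ! i)) \<le> n"
    using ds by (auto simp: divisor_chains_def divisor_chain_def l_def sorted_wrt_iff_nth_less
        sum_list_sum_nth lessThan_atLeast0)
  have "(\<Sum>i<l. 1) \<le> (\<Sum>i<l. degree (ds ! i))" by (rule sum_mono) (use deg in \<open>auto simp: Suc_le_eq\<close>)
  then have ln: "l \<le> n" using tot by simp
  \<comment> \<open>The chain padded by \<open>1\<close>, so that the last entry also equals its own
    quotient; the final \<open>filter\<close> removes the padding.\<close>
  define D where "D i = (if i < l then ds ! i else 1)" for i
  define g where "g i = D i div D (Suc i)" for i
  have Dm: "monic (D i)" for i using mon by (simp add: D_def)
  have Dg: "D i = g i * D (Suc i)" for i
  proof -
    have "D (Suc i) dvd D i" using dvd[of i "Suc i"] by (simp add: D_def)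
    then show ?thesis by (simp add: g_def)
  qed
  have gm: "monic (g i)" for i using Dg[of i] Dm[of i] Dm[of "Suc i"] by (metis lead_coeff_mult mult.right_neutral)
  have "g i dvd f" for i
  proof -
    have "g i dvd D i" using Dg by (metis dvd_triv_left)
    also have "D i dvd f" using dvdf by (simp add: D_def)
    finally show ?thesis .
  qed
  then have "\<exists>b. g i = (\<Prod>s\<in>?S. s ^ b s)" for i using exponents_exist[OF gm _ f] by metis
  then obtain b where b: "\<And>i. g i = (\<Prod>s\<in>?S. s ^ b i s)" by metis
  have Dprod: "D i = (\<Prod>j\<in>{i..<n}. g j)" if "i \<le> n" for i
    using that
  proof (induction rule: inc_induct)
    case base
    then show ?case using ln by (simp add: D_def)
  next
    case (step i)
    then have "{i..<n} = insert i {Suc i..<n}" by auto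
    then show ?case using step Dg[of i] by simp
  qed
  have gnz: "g i \<noteq> 0" for i using gm[of i] by auto
  have "(\<Sum>i<n. degree (D i)) = (\<Sum>i<l. degree (ds ! i))"
    using ln by (intro sum.mono_neutral_cong_right) (auto simp: D_def)
  then have "(\<Sum>i<n. degree (D i)) \<le> n" using tot by simp
  also have "(\<Sum>i<n. degree (D i)) = (\<Sum>i<n. \<Sum>j\<in>{i..<n}. degree (g j))"
    using gnz by (intro sum.cong refl) (simp add: Dprod degree_prod_eq_sum_degree)
  finally have w: "(\<Sum>j<n. Suc j * degree (g j)) \<le> n" unfolding sum_triangle .
  \<comment> \<open>Irreducible factors have degree at least \<open>1\<close>, so exponents may be
    counted in place of degrees.\<close>
  have gdeg: "(\<Sum>s\<in>?S. b i s) \<le> degree (g i)" for i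
  proof -
    have "degree (g i) = (\<Sum>s\<in>?S. degree (s ^ b i s))"
      unfolding b by (rule degree_prod_eq_sum_degree) (auto simp: irreducible_divisors_def)
    also have "\<dots> = (\<Sum>s\<in>?S. degree s * b i s)"
      by (intro sum.cong refl degree_power_eq) (auto simp: irreducible_divisors_def)
    also have "(\<Sum>s\<in>?S. b i s) \<le> \<dots>"
      by (rule sum_mono) (use degree_pos_irreducible in \<open>auto simp: irreducible_divisors_def Suc_le_eq\<close>)
    finally show ?thesis .
  qed
  have fin: "finite ?S" by (rule finite_irreducible_divisors[OF f])
  define a where "a = restrict (\<lambda>(s, i). b i s) (?S \<times> {..<n})"
  have "(\<Sum>(s, i)\<in>?S \<times> {..<n}. Suc i * a (s, i)) = (\<Sum>s\<in>?S. \<Sum>i<n. Suc i * b i s)"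
    unfolding sum.cartesian_product by (intro sum.cong refl) (auto simp: a_def)
  also have "\<dots> = (\<Sum>i<n. Suc i * (\<Sum>s\<in>?S. b i s))"
    unfolding sum_distrib_left by (rule sum.swap)
  also have "\<dots> \<le> (\<Sum>j<n. Suc j * degree (g j))"
    by (intro sum_mono mult_le_mono2) (rule gdeg)
  finally have wt: "(\<Sum>(s, i)\<in>?S \<times> {..<n}. Suc i * a (s, i)) \<le> n" using w by linarith
  have "a z \<le> n" if z: "z \<in> ?S \<times> {..<n}" for z
  proof -
    have "a z \<le> (\<lambda>(s, i). Suc i * a (s, i)) z" by (cases z) simp
    also have "\<dots> \<le> (\<Sum>(s, i)\<in>?S \<times> {..<n}. Suc i * a (s, i))"
      using z fin by (intro member_le_sum) auto
    finally show ?thesis using wt by linarith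
  qed
  moreover have "a \<in> extensional (?S \<times> {..<n})" by (simp add: a_def)
  ultimately have "a \<in> exponent_functions ?S n" using wt by (auto simp: exponent_functions_def PiE_def Pi_def)
  moreover have "ds = filter (\<lambda>p. p \<noteq> 1) (map (\<lambda>i. \<Prod>j\<in>{i..<n}. \<Prod>s\<in>?S. s ^ a (s, j)) [0..<n])"
  proof -
    have "(\<Prod>j\<in>{i..<n}. \<Prod>s\<in>?S. s ^ a (s, j)) = D i" if "i < n" for i
    proof -
      have "(\<Prod>s\<in>?S. s ^ a (s, j)) = g j" if "j < n" for j
        unfolding b using that by (intro prod.cong refl) (simp add: a_def)
      then show ?thesis using that by (simp add: Dprod)
    qed
    then have eq: "map (\<lambda>i. \<Prod>j\<in>{i..<n}. \<Prod>s\<in>?S. s ^ a (s, j)) [0..<n] = map D [0..<n]" by simp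
    have "[0..<n] = [0..<l] @ [l..<n]" using ln by (metis le_add_diff_inverse upt_add_eq_append zero_le)
    moreover have "D i \<noteq> 1" if "i < l" for i using deg[OF that] that by (auto simp: D_def)
    moreover have "D i = 1" if "l \<le> i" for i using that by (simp add: D_def)
    ultimately have "filter (\<lambda>p. p \<noteq> 1) (map D [0..<n]) = map D [0..<l]"
      by (simp add: filter_map filter_empty_conv filter_id_conv)
    also have "map D [0..<l] = ds" by (rule nth_equalityI) (auto simp: l_def D_def)
    finally show ?thesis unfolding eq by (rule sym)
  qed
  ultimately show ?thesis using that by blast
qed

lemma finite_exponent_functions:
  assumes "finite S"
  shows "finite (exponent_functions S n)"
  by (rule finite_subset[of _ "(S \<times> {..<n}) \<rightarrow>\<^sub>E {..n}"])
     (use assms in \<open>auto simp: exponent_functions_def intro!: finite_PiE\<close>)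

lemma card_divisor_chains_le:
  fixes f :: "'a::{field,finite} poly"
  assumes f: "f \<noteq> 0"
  shows "finite (divisor_chains f n)"
    and "card (divisor_chains f n) \<le> card (exponent_functions (irreducible_divisors f) n)"
proof -
  let ?A = "exponent_functions (irreducible_divisors f) n"
  let ?r = "\<lambda>a. filter (\<lambda>p. p \<noteq> 1) (map (\<lambda>i. \<Prod>j\<in>{i..<n}. \<Prod>s\<in>irreducible_divisors f. s ^ a (s, j)) [0..<n])"
  have sub: "divisor_chains f n \<subseteq> ?r ` ?A"
  proof
    fix ds assume "ds \<in> divisor_chains f n"
    from divisor_chain_encoding[OF f this] obtain a where "a \<in> ?A" "ds = ?r a" .
    then show "ds \<in> ?r ` ?A" by (intro image_eqI)
  qed
  have fin: "finite ?A" using finite_exponent_functions finite_irreducible_divisors[OF f] by blast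
  show "finite (divisor_chains f n)" using sub fin finite_subset by blast
  show "card (divisor_chains f n) \<le> card ?A" using surj_card_le[OF fin sub] .
qed

text \<open>Rankin's trick: each exponent function is weighted by \<open>x\<close> to the power of its total weight.\<close>

lemma card_exponent_functions_le:
  fixes x :: real
  assumes S: "finite S" and x: "0 < x" "x < 1"
  shows "real (card (exponent_functions S n)) \<le> (1 / x) ^ n * exp (real (card S) / (1 - x)\<^sup>2)"
proof -
  let ?Z = "S \<times> {..<n}" and ?P = "(S \<times> {..<n}) \<rightarrow>\<^sub>E {..n}"
  define wt where "wt a = (\<Sum>(s, i)\<in>?Z. Suc i * a (s, i))" for a :: "'a \<times> nat \<Rightarrow> nat"
  have finZ: "finite ?Z" using S by simp
  have finP: "finite ?P" using finZ by (intro finite_PiE) auto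
  have sub: "exponent_functions S n \<subseteq> ?P" by (auto simp: exponent_functions_def)
  \<comment> \<open>With \<open>y = x ^ Suc i\<close> the geometric series is
    \<open>1 + y/(1 - y)\<close>, at most the exponential of \<open>y/(1 - y)\<close>; the bounds
    \<open>y \<le> x ^ i\<close> and \<open>y \<le> x\<close> simplify that exponent.\<close>
  have geom: "(\<Sum>c\<le>n. (x ^ Suc i) ^ c) \<le> exp (x ^ i / (1 - x))" for i
  proof -
    define y where "y = x ^ Suc i"
    have y: "0 < y" "y \<le> x ^ i" "y \<le> x"
      using x by (auto simp: y_def power_le_one intro: mult_left_le_one_le mult_left_le)
    then have "y < 1" using x by linarith
    note y = y this
    have "(\<Sum>c\<le>n. y ^ c) \<le> (\<Sum>c. y ^ c)"
      using y by (intro sum_le_suminf summable_geometric) auto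
    also have "\<dots> = 1 / (1 - y)" using y by (intro suminf_geometric) auto
    also have "\<dots> = 1 + y / (1 - y)" using y by (simp add: field_simps)
    also have "\<dots> \<le> exp (y / (1 - y))" by (rule exp_ge_add_one_self)
    also have "y / (1 - y) \<le> x ^ i / (1 - x)" using y x by (intro frac_le) auto
    then have "exp (y / (1 - y)) \<le> exp (x ^ i / (1 - x))" by simp
    finally show ?thesis by (simp add: y_def)
  qed
  have "real (card (exponent_functions S n)) = (\<Sum>a\<in>exponent_functions S n. 1)" by simp
  also have "\<dots> \<le> (\<Sum>a\<in>exponent_functions S n. (1 / x) ^ n * x ^ wt a)"
  proof (rule sum_mono)
    fix a assume "a \<in> exponent_functions S n"
    then have "wt a \<le> n" by (simp add: exponent_functions_def wt_def)
    then have "x ^ n \<le> x ^ wt a" using x by (intro power_decreasing) auto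
    then show "1 \<le> (1 / x) ^ n * x ^ wt a" using x by (simp add: power_one_over field_simps)
  qed
  also have "\<dots> \<le> (\<Sum>a\<in>?P. (1 / x) ^ n * x ^ wt a)" using x finP sub by (intro sum_mono2) auto
  also have "\<dots> = (1 / x) ^ n * (\<Sum>a\<in>?P. \<Prod>z\<in>?Z. (x ^ Suc (snd z)) ^ a z)"
    unfolding sum_distrib_left wt_def power_sum
    by (intro sum.cong refl) (simp add: case_prod_beta power_mult del: power_Suc mult_Suc)
  \<comment> \<open>The weight is additive over the coordinates, so the sum over all functions
    factors into one sum per coordinate.\<close>
  also have "(\<Sum>a\<in>?P. \<Prod>z\<in>?Z. (x ^ Suc (snd z)) ^ a z) = (\<Prod>z\<in>?Z. \<Sum>c\<le>n. (x ^ Suc (snd z)) ^ c)"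
    using finZ by (intro prod_sum_PiE[symmetric]) auto
  also have "\<dots> \<le> (\<Prod>z\<in>?Z. exp (x ^ snd z / (1 - x)))"
    using geom x by (intro prod_mono) (auto intro!: sum_nonneg)
  also have "\<dots> = exp (\<Sum>z\<in>?Z. x ^ snd z / (1 - x))" using finZ by (rule exp_sum[symmetric])
  also have "\<dots> \<le> exp (real (card S) / (1 - x)\<^sup>2)"
  proof -
    have "(\<Sum>z\<in>?Z. x ^ snd z / (1 - x)) = (\<Sum>s\<in>S. \<Sum>i<n. x ^ i / (1 - x))"
      unfolding sum.cartesian_product by (simp add: case_prod_beta)
    also have "\<dots> = real (card S) * ((\<Sum>i<n. x ^ i) / (1 - x))" by (simp add: sum_divide_distrib)
    also have "(\<Sum>i<n. x ^ i) \<le> 1 / (1 - x)"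
    proof -
      have "(\<Sum>i<n. x ^ i) \<le> (\<Sum>i. x ^ i)" using x by (intro sum_le_suminf summable_geometric) auto
      then show ?thesis using x by (simp add: suminf_geometric)
    qed
    then have "real (card S) * ((\<Sum>i<n. x ^ i) / (1 - x)) \<le> real (card S) * ((1 / (1 - x)) / (1 - x))"
      using x by (intro mult_left_mono divide_right_mono) auto
    also have "\<dots> = real (card S) / (1 - x)\<^sup>2" by (simp add: power2_eq_square)
    finally show ?thesis by simp
  qed
  finally show ?thesis using x by (simp add: mult_left_mono)
qed

text \<open>Distinct monic irreducible polynomials do not divide one another, so each new prime
  factor divides the remaining cofactor.\<close>

lemma prod_irreducible_dvd:
  fixes f :: "'a::field poly"
  assumes "finite A" "A \<subseteq> irreducible_divisors f"
  shows "\<Prod>A dvd f"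
  using assms
proof (induction A)
  case (insert s A)
  then obtain k where k: "f = \<Prod>A * k" by auto
  have s: "irreducible s" "monic s" "s dvd f" using insert by (auto simp: irreducible_divisors_def)
  have prime: "prime_elem s" using s(1) by (rule field_poly_irreducible_imp_prime)
  have "\<not> s dvd \<Prod>A"
  proof
    assume "s dvd \<Prod>A"
    with insert.hyps(1) obtain t where t: "t \<in> A" "s dvd t"
    proof (induction A)
      case (insert a A)
      then show ?case using prime_elem_dvd_multD[OF prime, of a "\<Prod>A"] by auto
    next
      case empty
      then show ?case using s(1) by auto
    qed
    have it: "irreducible t" "monic t" using t insert.prems by (auto simp: irreducible_divisors_def)
    have "t dvd s" using irreducibleD'[OF it(1) t(2)] s(1) by auto
    then have "s = t" using t(2) s(2) it(2) by (intro poly_dvd_antisym) auto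
    then show False using t insert.hyps by simp
  qed
  then have "s dvd k" using s(3) prime k prime_elem_dvd_mult_iff by blast
  then show ?case using k insert.hyps by (simp add: mult.commute mult_dvd_mono)
qed simp

text \<open>The first term counts all polynomials of degree at most \<open>d\<close>. Every other
  irreducible divisor uses up at least \<open>Suc d\<close> of the degree of
  \<open>f\<close>.\<close>

lemma card_irreducible_divisors_le:
  fixes f :: "'a::{field,finite} poly"
  assumes f: "f \<noteq> 0"
  shows "real (card (irreducible_divisors f)) \<le> real (CARD('a) ^ Suc d) + real (degree f) / real (Suc d)"
proof -
  let ?S = "irreducible_divisors f"
  define A where "A = {s \<in> ?S. d < degree s}"
  have fin: "finite ?S" by (rule finite_irreducible_divisors[OF f])
  have finA: "finite A" "A \<subseteq> ?S" using fin by (auto simp: A_def)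
  have "?S \<subseteq> {p. degree p < Suc d} \<union> A" by (auto simp: A_def)
  then have "card ?S \<le> card ({p :: 'a poly. degree p < Suc d} \<union> A)"
    using finite_degree_less finA by (intro card_mono) auto
  also have "\<dots> \<le> CARD('a) ^ Suc d + card A" using card_Un_le card_degree_less[of "Suc d"] by (metis zero_less_Suc)
  finally have 1: "card ?S \<le> CARD('a) ^ Suc d + card A" .
  have "Suc d * card A \<le> (\<Sum>s\<in>A. degree s)"
    using sum_bounded_below[of A "Suc d" degree] by (simp add: A_def Suc_le_eq mult.commute)
  also have "\<dots> = degree (\<Prod>A)"
    using finA by (subst degree_prod_eq_sum_degree) (auto simp: irreducible_divisors_def)
  also have "\<dots> \<le> degree f" by (rule dvd_imp_degree_le[OF prod_irreducible_dvd[OF finA] f])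
  finally have "real (Suc d) * real (card A) \<le> real (degree f)" by (metis of_nat_le_iff of_nat_mult)
  then have "real (card A) \<le> real (degree f) / real (Suc d)" by (simp add: field_simps)
  moreover have "real (card ?S) \<le> real (CARD('a) ^ Suc d) + real (card A)"
    using 1 by (metis of_nat_add of_nat_le_iff)
  ultimately show ?thesis by linarith
qed

text \<open>Half of \<open>\<epsilon>\<close> pays for the factor \<open>(1 / x) ^ n\<close>, the
  other half for irreducible divisors of degree above \<open>d\<close>. Those of degree at most
  \<open>d\<close> are bounded in number and contribute the constant \<open>B\<close>.\<close>

lemma card_divisor_chains_subexponential:
  assumes "0 < (\<epsilon> :: real)"
  obtains B where "0 < B" "\<And>f :: 'a::{field,finite} poly. f \<noteq> 0 \<Longrightarrow>
    real (card (divisor_chains f (degree f))) \<le> B * exp (\<epsilon> * real (degree f))"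
proof -
  define x where "x = exp (- \<epsilon> / 2)"
  have x: "0 < x" "x < 1" using assms by (auto simp: x_def)
  define L where "L = 1 / (1 - x)\<^sup>2"
  have L: "0 < L" using x by (simp add: L_def)
  \<comment> \<open>Taken so large that the divisors of degree above \<open>d\<close> cost at most
    \<open>\<epsilon> / 2\<close> per unit of degree.\<close>
  obtain d :: nat where d: "2 * L / \<epsilon> < real d" using reals_Archimedean2 by blast
  then have Ld: "L / real (Suc d) \<le> \<epsilon> / 2" using assms by (simp add: field_simps)
  define B where "B = exp (L * real (CARD('a) ^ Suc d))"
  show ?thesis
  proof (rule that)
    show "0 < B" by (simp add: B_def)
    fix f :: "'a poly" assume f: "f \<noteq> 0"
    let ?n = "degree f" and ?S = "irreducible_divisors f"
    have "real (card (divisor_chains f ?n)) \<le> real (card (exponent_functions ?S ?n))"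
      using card_divisor_chains_le(2)[OF f] by simp
    also have "\<dots> \<le> (1 / x) ^ ?n * exp (real (card ?S) / (1 - x)\<^sup>2)"
      by (rule card_exponent_functions_le[OF finite_irreducible_divisors[OF f] x])
    also have "(1 / x) ^ ?n = exp (\<epsilon> / 2 * real ?n)"
      by (simp add: x_def exp_minus field_simps flip: exp_of_nat_mult)
    also have "real (card ?S) / (1 - x)\<^sup>2 = L * real (card ?S)" by (simp add: L_def)
    also have "exp (L * real (card ?S)) \<le> exp (L * real (CARD('a) ^ Suc d) + \<epsilon> / 2 * real ?n)"
    proof -
      have "L * real (card ?S) \<le> L * (real (CARD('a) ^ Suc d) + real ?n / real (Suc d))"
        using L card_irreducible_divisors_le[OF f] by (intro mult_left_mono) auto
      also have "\<dots> = L * real (CARD('a) ^ Suc d) + L / real (Suc d) * real ?n" by (simp add: field_simps)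
      also have "\<dots> \<le> L * real (CARD('a) ^ Suc d) + \<epsilon> / 2 * real ?n"
        using Ld by (intro add_left_mono mult_right_mono) auto
      finally show ?thesis by simp
    qed
    also have "exp (\<epsilon> / 2 * real ?n) * exp (L * real (CARD('a) ^ Suc d) + \<epsilon> / 2 * real ?n) = B * exp (\<epsilon> * real ?n)"
      by (simp add: B_def field_simps flip: exp_add)
    finally show "real (card (divisor_chains f ?n)) \<le> B * exp (\<epsilon> * real ?n)" by simp
  qed
qed

text \<open>Makes the estimate uniform: over a fixed finite field there are finitely many
  polynomials of each degree, so one may take the maximum.\<close>

lemma subexponential_divisor_chains_bound:
  obtains T :: "nat \<Rightarrow> nat" where "\<And>n. 1 \<le> T n"
    "\<And>f :: 'a::{field,finite} poly. f \<noteq> 0 \<Longrightarrow> card (divisor_chains f (degree f)) \<le> T (degree f)"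
    "(\<lambda>n. ln (real (T n))) \<in> o(\<lambda>n. real n)"
proof -
  define F where "F n = {f :: 'a poly. degree f = n \<and> f \<noteq> 0}" for n
  \<comment> \<open>The inserted \<open>1\<close> keeps the logarithm nonnegative.\<close>
  define T where "T n = Max (insert 1 ((\<lambda>f. card (divisor_chains f n)) ` F n))" for n
  have "finite (F n)" for n
    by (rule finite_subset[OF _ finite_degree_less[of "Suc n"]]) (auto simp: F_def)
  then have fin: "finite (insert 1 ((\<lambda>f. card (divisor_chains f n)) ` F n))" for n by simp
  have T1: "1 \<le> T n" for n unfolding T_def by (rule Max_ge[OF fin]) simp
  have Tf: "card (divisor_chains f (degree f)) \<le> T (degree f)" if "f \<noteq> 0" for f :: "'a poly"
    unfolding T_def by (rule Max_ge[OF fin]) (use that in \<open>simp add: F_def\<close>)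
  have "(\<lambda>n. ln (real (T n))) \<in> o(\<lambda>n. real n)"
  proof (rule landau_o.smallI)
    fix c :: real assume c: "0 < c"
    then obtain B where B: "0 < B" "\<And>f :: 'a poly. f \<noteq> 0 \<Longrightarrow>
        real (card (divisor_chains f (degree f))) \<le> B * exp (c / 2 * real (degree f))"
      using card_divisor_chains_subexponential[of "c / 2"] by (metis half_gt_zero)
    \<comment> \<open>From \<open>N\<close> on the constant \<open>ln (1 + B)\<close> is absorbed by
      the half of \<open>c\<close> that remains.\<close>
    obtain N :: nat where N: "ln (1 + B) / (c / 2) < real N" using reals_Archimedean2 by blast
    have "norm (ln (real (T n))) \<le> c * norm (real n)" if n: "N \<le> n" for n
    proof -
      have "T n \<in> insert 1 ((\<lambda>f. card (divisor_chains f n)) ` F n)" unfolding T_def by (rule Max_in[OF fin]) simp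
      then have "real (T n) \<le> (1 + B) * exp (c / 2 * real n)"
      proof
        assume "T n = 1"
        moreover have "1 \<le> exp (c / 2 * real n)" using c by simp
        then have "1 * 1 \<le> (1 + B) * exp (c / 2 * real n)" using B(1) by (intro mult_mono) auto
        ultimately show ?thesis by simp
      next
        assume "T n \<in> (\<lambda>f. card (divisor_chains f n)) ` F n"
        then have "real (T n) \<le> B * exp (c / 2 * real n)" using B(2) by (auto simp: F_def)
        also have "\<dots> \<le> (1 + B) * exp (c / 2 * real n)" by (intro mult_right_mono) auto
        finally show ?thesis .
      qed
      then have "ln (real (T n)) \<le> ln ((1 + B) * exp (c / 2 * real n))" using T1[of n] by simp
      also have "\<dots> = ln (1 + B) + c / 2 * real n" using B(1) by (simp add: ln_mult)
      also have "ln (1 + B) \<le> c / 2 * real n"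
      proof -
        have "ln (1 + B) < real N * (c / 2)" using N c by (simp add: field_simps)
        also have "\<dots> \<le> real n * (c / 2)" using n c by (intro mult_right_mono) auto
        finally show ?thesis by (simp add: mult.commute)
      qed
      finally have "ln (real (T n)) \<le> c * real n" by simp
      moreover have "0 \<le> ln (real (T n))" using T1[of n] by simp
      ultimately show ?thesis by simp
    qed
    then show "\<forall>\<^sub>F n in sequentially. norm (ln (real (T n))) \<le> c * norm (real n)"
      by (auto simp: eventually_sequentially)
  qed
  then show ?thesis using that T1 Tf by blast
qed

section \<open>The probability bound with an error exponent depending only on the field and on
  n\<close>

theorem theorem5p4:
  fixes p k q :: nat
  assumes "prime p" and "odd p" and "k > 0" and "q = p ^ k"
    and "CARD('a::{field,finite}) = q"
  shows "\<exists>C>0. \<exists>e\<in>o(\<lambda>n::nat. real n).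
    \<forall>n. \<forall>K\<in>carrier_mat n n. \<forall>f::'a poly. \<forall>\<delta>::nat.
      invertible_mat K \<and> transpose_mat K = K \<and>
      monic f \<and> self_reciprocal f \<and> degree f = n \<and> \<not> [:0, 1:] dvd f \<and> \<delta> < n \<longrightarrow>
      measure_pmf.prob (pmf_of_set (special_orthogonal n K))
        {M. degree (min_poly M) = n - \<delta> \<and> char_poly M = f}
      \<le> C * real q powr
          (real n / 2 - (real n)\<^sup>2 / (2 * (real n - real \<delta>)) + e n)"
proof -
  have q: "1 < real q" using card_mono[of "UNIV :: 'a set" "{0, 1}"] assms(5) by simp
  obtain T :: "nat \<Rightarrow> nat" where T: "\<And>n. 1 \<le> T n"
    "\<And>f :: 'a poly. f \<noteq> 0 \<Longrightarrow> card (divisor_chains f (degree f)) \<le> T (degree f)"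
    "(\<lambda>n. ln (real (T n))) \<in> o(\<lambda>n. real n)"
    using subexponential_divisor_chains_bound by metis
  \<comment> \<open>Chosen so that \<open>q powr e n\<close> is exactly the square of
    \<open>T n\<close>: the chains enter squared, one for each summand cut out by the
    idempotent.\<close>
  define e where "e n = 2 / ln (real q) * ln (real (T n))" for n
  have "2 / ln (real q) \<noteq> 0" using q by simp
  then have "e \<in> o(\<lambda>n. real n)" unfolding e_def using T(3) by (rule landau_o.small.cmult_in_iff[THEN iffD2])
  moreover have "measure_pmf.prob (pmf_of_set (special_orthogonal n K))
        {M. degree (min_poly M) = n - \<delta> \<and> char_poly M = f}
      \<le> 2 * real q powr (real n / 2 - (real n)\<^sup>2 / (2 * (real n - real \<delta>)) + e n)"
    if K: "K \<in> carrier_mat n n" "invertible_mat K" "transpose_mat K = K"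
      and f: "monic f" "degree f = n" and \<delta>: "\<delta> < n" for n K \<delta> and f :: "'a poly"
  proof -
    let ?y = "real n / 2 - (real n)\<^sup>2 / (2 * (real n - real \<delta>))"
    have f0: "f \<noteq> 0" using f by auto
    have "measure_pmf.prob (pmf_of_set (special_orthogonal n K)) {M. degree (min_poly M) = n - \<delta> \<and> char_poly M = f}
      \<le> 2 * (real (card (divisor_chains f n)))\<^sup>2 * real CARD('a) powr (real n / 2 - (real n)\<^sup>2 / (2 * real (n - \<delta>)))"
      using K \<delta> card_divisor_chains_le(1)[OF f0] by (intro prob_min_poly_char_poly_le) (auto simp: GL_def)
    also have "\<dots> = 2 * (real (card (divisor_chains f n)))\<^sup>2 * real q powr ?y"
      using \<delta> assms(5) by (simp add: of_nat_diff)
    also have "\<dots> \<le> 2 * (real (T n))\<^sup>2 * real q powr ?y"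
      using T(2)[OF f0] f(2) by (intro mult_right_mono mult_left_mono power_mono) auto
    also have "(real (T n))\<^sup>2 = real q powr e n"
    proof -
      have "real q powr e n = exp (2 * ln (real (T n)))" using q by (simp add: powr_def e_def)
      also have "\<dots> = exp (ln (real (T n))) ^ 2" by (simp add: power2_eq_square flip: exp_add)
      also have "\<dots> = (real (T n))\<^sup>2" using T(1)[of n] by simp
      finally show ?thesis by simp
    qed
    also have "2 * real q powr e n * real q powr ?y = 2 * real q powr (?y + e n)"
      by (simp add: powr_add)
    finally show ?thesis .
  qed
  \<comment> \<open>The constant \<open>2\<close> is the bound for the index of the special
    orthogonal group in the orthogonal group.\<close>
  ultimately show ?thesis by (intro exI[of _ 2] conjI bexI[of _ e]) auto
qed

end
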